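(* Let $A$, $B$, $C$ be $C^*$-algebras and let $(F,\pi)\in \mathrm{Cor}(B,C)$. Then the assignment $$(-)\otimes_\pi F:\mathrm{PosCor}(A,B)\to \mathrm{PosCor}(A,C),\qquad (E,\phi)\mapsto (E\otimes_\pi F,\ \phi(-)\otimes_\pi I),\qquad (\eta,\alpha)\mapsto(\hat\eta,\alpha)$$ defines a covariant functor. Here, for a morphism $(\eta,\alpha):(E_1,\phi_1)\to(E_2,\phi_2)$, $\hat\eta\in\mathcal{L}(E_1\otimes_\pi F,E_2\otimes_\pi F)$ is the unique adjointable map with $\hat\eta(x\dot\otimes f)=\eta(x)\dot\otimes f$ for all $x\in E_1$, $f\in F$.
   Context: Hilbert modules are right modules with inner product linear in the second variable; $\mathcal{L}(E_1,E_2)$ is the set of adjointable maps and $\mathcal{L}(E)=\mathcal{L}(E,E)$. A completely positive map $\phi:A\to\mathcal{L}(E)$ is strict if there is an approximate unit $(a_\lambda)$ of $A$ such that $(\phi(a_\lambda))$ is Cauchy in the strict topology on $\mathcal{L}(E)$, i.e. the topology generated by the seminorms $T\mapsto\|Tx\|$ and $T\mapsto\|T^*x\|$, $x\in E$. The category $\mathrm{PosCor}(A,B)$: objects are pairs $(E,\phi)$ with $E$ a Hilbert $B$-module and $\phi:A\to\mathcal{L}(E)$ a strict completely positive map; a morphism $(E_1,\phi_1)\to(E_2,\phi_2)$ is a pair $(\eta,\alpha)$ with $\eta\in\mathcal{L}(E_1,E_2)$ and $\alpha$ a $*$-automorphism of $A$ such that $\phi_2(\alpha(a))\circ\eta=\eta\circ\phi_1(a)$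 for all $a\in A$; composition is $(\xi,\beta)\circ(\eta,\alpha)=(\xi\circ\eta,\beta\circ\alpha)$. $\mathrm{Cor}(B,C)$ is the full subcategory of $\mathrm{PosCor}(B,C)$ whose objects are pairs $(F,\pi)$ with $F$ a Hilbert $C$-module and $\pi:B\to\mathcal{L}(F)$ a non-degenerate $*$-homomorphism (the span of $\pi(B)F$ is dense in $F$). For a Hilbert $B$-module $E$ and $(F,\pi)\in\mathrm{Cor}(B,C)$, the interior tensor product $E\otimes_\pi F$ is the Hilbert $C$-module obtained by completing $E\otimes_B F=(E\otimes_{\mathrm{alg}}F)/\langle xb\otimes y-x\otimes\pi(b)y\rangle$ for the inner product $\langle x_1\dot\otimes y_1,x_2\dot\otimes y_2\rangle=\langle y_1,\pi(\langle x_1,x_2\rangle)y_2\rangle$, where $x\dot\otimes y$ denotes the class of $x\otimes y$. For $T\in\mathcal{L}(E)$, $T\otimes_\pi I\in\mathcal{L}(E\otimes_\pi F)$ is the map with $(T\otimes_\pi I)(x\dot\otimes y)=Tx\dot\otimes y$. *)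

theory Defs
  imports "HOL-Analysis.Analysis" "HOL-Library.Poly_Mapping"
begin

section \<open>C*-algebras\<close>

text \<open>Not necessarily unital, and the zero algebra is allowed.\<close>

class cstar_algebra = real_normed_algebra + banach +
  fixes scaleC :: "complex \<Rightarrow> 'a \<Rightarrow> 'a"  (infixr "*\<^sub>C" 75)
    and star :: "'a \<Rightarrow> 'a"
  assumes scaleC_add_right: "c *\<^sub>C (x + y) = c *\<^sub>C x + c *\<^sub>C y"
    and scaleC_add_left: "(c + d) *\<^sub>C x = c *\<^sub>C x + d *\<^sub>C x"
    and scaleC_scaleC: "c *\<^sub>C d *\<^sub>C x = (c * d) *\<^sub>C x"
    and scaleR_scaleC: "r *\<^sub>R x = complex_of_real r *\<^sub>C x"
    and mult_scaleC_left: "(c *\<^sub>C x) * y = c *\<^sub>C (x * y)"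
    and mult_scaleC_right: "x * (c *\<^sub>C y) = c *\<^sub>C (x * y)"
    and norm_scaleC: "norm (c *\<^sub>C x) = cmod c * norm x"
    and star_star: "star (star x) = x"
    and star_add: "star (x + y) = star x + star y"
    and star_scaleC: "star (c *\<^sub>C x) = cnj c *\<^sub>C star x"
    and star_mult: "star (x * y) = star y * star x"
    and cstar_identity: "norm (star x * x) = (norm x)\<^sup>2"

definition cstar_positive :: "'a::cstar_algebra \<Rightarrow> bool" where
  "cstar_positive a \<longleftrightarrow> (\<exists>b. a = star b * b)"

text \<open>Positivity in the C*-algebra of \<open>n \<times> n\<close> matrices over \<open>'a\<close>, i.e. being of the form \<open>X\<^sup>* X\<close>.
  Only the entries with indices below \<open>n\<close> matter.\<close>

definition cstar_mat_positive :: "nat \<Rightarrow> (nat \<Rightarrow> nat \<Rightarrow> 'a::cstar_algebra) \<Rightarrow> bool" where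
  "cstar_mat_positive n M \<longleftrightarrow>
     (\<exists>X. \<forall>i<n. \<forall>j<n. M i j = (\<Sum>k<n. star (X k i) * X k j))"

definition star_automorphism :: "('a::cstar_algebra \<Rightarrow> 'a) \<Rightarrow> bool" where
  "star_automorphism \<alpha> \<longleftrightarrow> bij \<alpha> \<and>
     (\<forall>a b. \<alpha> (a + b) = \<alpha> a + \<alpha> b) \<and>
     (\<forall>c a. \<alpha> (c *\<^sub>C a) = c *\<^sub>C \<alpha> a) \<and>
     (\<forall>a b. \<alpha> (a * b) = \<alpha> a * \<alpha> b) \<and>
     (\<forall>a. \<alpha> (star a) = star (\<alpha> a))"

text \<open>An approximate unit \<open>(a\<^sub>\<lambda>)\<close> is a net of positive contractions; it is represented by the
  filter on the algebra generated by its tails. Conversely every proper filter arises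
  from a net in this way, and the conditions below only depend on the tails.\<close>

definition approximate_unit :: "'a::cstar_algebra filter \<Rightarrow> bool" where
  "approximate_unit U \<longleftrightarrow> U \<noteq> bot \<and>
     (\<forall>\<^sub>F u in U. cstar_positive u \<and> norm u \<le> 1) \<and>
     (\<forall>a. ((\<lambda>u. u * a) \<longlongrightarrow> a) U \<and> ((\<lambda>u. a * u) \<longlongrightarrow> a) U)"


section \<open>Hilbert modules\<close>

record ('b, 'e) hmod =
  hcarrier :: "'e set"
  hzero :: 'e
  hadd :: "'e \<Rightarrow> 'e \<Rightarrow> 'e"
  hscale :: "complex \<Rightarrow> 'e \<Rightarrow> 'e"
  hact :: "'e \<Rightarrow> 'b \<Rightarrow> 'e"
  hinner :: "'e \<Rightarrow> 'e \<Rightarrow> 'b"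

definition hdiff :: "('b, 'e) hmod \<Rightarrow> 'e \<Rightarrow> 'e \<Rightarrow> 'e" where
  "hdiff E x y = hadd E x (hscale E (-1) y)"

definition hnorm :: "('b::cstar_algebra, 'e) hmod \<Rightarrow> 'e \<Rightarrow> real" where
  "hnorm E x = sqrt (norm (hinner E x x))"

primrec hsum :: "('b, 'e) hmod \<Rightarrow> (nat \<Rightarrow> 'e) \<Rightarrow> nat \<Rightarrow> 'e" where
  "hsum E f 0 = hzero E"
| "hsum E f (Suc n) = hadd E (hsum E f n) (f n)"

definition hCauchy :: "('b::cstar_algebra, 'e) hmod \<Rightarrow> (nat \<Rightarrow> 'e) \<Rightarrow> bool" where
  "hCauchy E X \<longleftrightarrow> (\<forall>n. X n \<in> hcarrier E) \<and>
     (\<forall>e>0. \<exists>N. \<forall>m\<ge>N. \<forall>n\<ge>N. hnorm E (hdiff E (X m) (X n)) < e)"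

locale hilbert_module =
  fixes E :: "('b::cstar_algebra, 'e) hmod"
  assumes zero_closed: "hzero E \<in> hcarrier E"
    and add_closed: "\<lbrakk>x \<in> hcarrier E; y \<in> hcarrier E\<rbrakk> \<Longrightarrow> hadd E x y \<in> hcarrier E"
    and scale_closed: "x \<in> hcarrier E \<Longrightarrow> hscale E c x \<in> hcarrier E"
    and act_closed: "x \<in> hcarrier E \<Longrightarrow> hact E x b \<in> hcarrier E"
    and add_assoc: "\<lbrakk>x \<in> hcarrier E; y \<in> hcarrier E; z \<in> hcarrier E\<rbrakk>
      \<Longrightarrow> hadd E (hadd E x y) z = hadd E x (hadd E y z)"
    and add_comm: "\<lbrakk>x \<in> hcarrier E; y \<in> hcarrier E\<rbrakk> \<Longrightarrow> hadd E x y = hadd E y x"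
    and add_zero: "x \<in> hcarrier E \<Longrightarrow> hadd E x (hzero E) = x"
    and add_inverse: "x \<in> hcarrier E \<Longrightarrow> \<exists>y\<in>hcarrier E. hadd E x y = hzero E"
    and scale_add_right: "\<lbrakk>x \<in> hcarrier E; y \<in> hcarrier E\<rbrakk>
      \<Longrightarrow> hscale E c (hadd E x y) = hadd E (hscale E c x) (hscale E c y)"
    and scale_add_left: "x \<in> hcarrier E
      \<Longrightarrow> hscale E (c + d) x = hadd E (hscale E c x) (hscale E d x)"
    and scale_scale: "x \<in> hcarrier E \<Longrightarrow> hscale E c (hscale E d x) = hscale E (c * d) x"
    and scale_one: "x \<in> hcarrier E \<Longrightarrow> hscale E 1 x = x"
    and act_add_left: "\<lbrakk>x \<in> hcarrier E; y \<in> hcarrier E\<rbrakk>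
      \<Longrightarrow> hact E (hadd E x y) b = hadd E (hact E x b) (hact E y b)"
    and act_add_right: "x \<in> hcarrier E
      \<Longrightarrow> hact E x (b + b') = hadd E (hact E x b) (hact E x b')"
    and act_act: "x \<in> hcarrier E \<Longrightarrow> hact E (hact E x b) b' = hact E x (b * b')"
    and act_scale_left: "x \<in> hcarrier E \<Longrightarrow> hact E (hscale E c x) b = hscale E c (hact E x b)"
    and act_scale_right: "x \<in> hcarrier E \<Longrightarrow> hact E x (c *\<^sub>C b) = hscale E c (hact E x b)"
    and inner_add: "\<lbrakk>x \<in> hcarrier E; y \<in> hcarrier E; z \<in> hcarrier E\<rbrakk>
      \<Longrightarrow> hinner E x (hadd E y z) = hinner E x y + hinner E x z"
    and inner_scale: "\<lbrakk>x \<in> hcarrier E; y \<in> hcarrier E\<rbrakk>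
      \<Longrightarrow> hinner E x (hscale E c y) = c *\<^sub>C hinner E x y"
    and inner_act: "\<lbrakk>x \<in> hcarrier E; y \<in> hcarrier E\<rbrakk>
      \<Longrightarrow> hinner E x (hact E y b) = hinner E x y * b"
    and inner_star: "\<lbrakk>x \<in> hcarrier E; y \<in> hcarrier E\<rbrakk> \<Longrightarrow> star (hinner E x y) = hinner E y x"
    and inner_positive: "x \<in> hcarrier E \<Longrightarrow> cstar_positive (hinner E x x)"
    and inner_definite: "\<lbrakk>x \<in> hcarrier E; hinner E x x = 0\<rbrakk> \<Longrightarrow> x = hzero E"
    and complete: "hCauchy E X
      \<Longrightarrow> \<exists>x\<in>hcarrier E. (\<lambda>n. hnorm E (hdiff E (X n) x)) \<longlonglongrightarrow> 0"

text \<open>Maps between modules are functions on the carrier, extended by \<open>undefined\<close> outside of it.\<close>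

definition is_adjoint ::
  "('b, 'e) hmod \<Rightarrow> ('b, 'f) hmod \<Rightarrow> ('e \<Rightarrow> 'f) \<Rightarrow> ('f \<Rightarrow> 'e) \<Rightarrow> bool" where
  "is_adjoint E\<^sub>1 E\<^sub>2 T S \<longleftrightarrow>
     T \<in> hcarrier E\<^sub>1 \<rightarrow>\<^sub>E hcarrier E\<^sub>2 \<and> S \<in> hcarrier E\<^sub>2 \<rightarrow>\<^sub>E hcarrier E\<^sub>1 \<and>
     (\<forall>x\<in>hcarrier E\<^sub>1. \<forall>y\<in>hcarrier E\<^sub>2. hinner E\<^sub>2 (T x) y = hinner E\<^sub>1 x (S y))"

definition adjointable :: "('b, 'e) hmod \<Rightarrow> ('b, 'f) hmod \<Rightarrow> ('e \<Rightarrow> 'f) set" where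
  "adjointable E\<^sub>1 E\<^sub>2 = {T. \<exists>S. is_adjoint E\<^sub>1 E\<^sub>2 T S}"

definition adjoint_map :: "('b, 'e) hmod \<Rightarrow> ('b, 'f) hmod \<Rightarrow> ('e \<Rightarrow> 'f) \<Rightarrow> ('f \<Rightarrow> 'e)" where
  "adjoint_map E\<^sub>1 E\<^sub>2 T = (THE S. is_adjoint E\<^sub>1 E\<^sub>2 T S)"


section \<open>Maps from a C*-algebra into the adjointable operators\<close>

definition linear_into_adjointable ::
  "('b, 'e) hmod \<Rightarrow> ('a::cstar_algebra \<Rightarrow> 'e \<Rightarrow> 'e) \<Rightarrow> bool" where
  "linear_into_adjointable E \<phi> \<longleftrightarrow>
     (\<forall>a. \<phi> a \<in> adjointable E E) \<and>
     (\<forall>a a'. \<forall>x\<in>hcarrier E. \<phi> (a + a') x = hadd E (\<phi> a x) (\<phi> a' x)) \<and>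
     (\<forall>c a. \<forall>x\<in>hcarrier E. \<phi> (c *\<^sub>C a) x = hscale E c (\<phi> a x))"

text \<open>Positivity in the \<open>n \<times> n\<close> matrices over the adjointable operators.\<close>

definition op_mat_positive ::
  "('b, 'e) hmod \<Rightarrow> nat \<Rightarrow> (nat \<Rightarrow> nat \<Rightarrow> 'e \<Rightarrow> 'e) \<Rightarrow> bool" where
  "op_mat_positive E n M \<longleftrightarrow>
     (\<exists>Y. (\<forall>k<n. \<forall>i<n. Y k i \<in> adjointable E E) \<and>
       (\<forall>i<n. \<forall>j<n. \<forall>x\<in>hcarrier E.
          M i j x = hsum E (\<lambda>k. adjoint_map E E (Y k i) (Y k j x)) n))"

definition completely_positive ::
  "('b, 'e) hmod \<Rightarrow> ('a::cstar_algebra \<Rightarrow> 'e \<Rightarrow> 'e) \<Rightarrow> bool" where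
  "completely_positive E \<phi> \<longleftrightarrow> linear_into_adjointable E \<phi> \<and>
     (\<forall>n M. cstar_mat_positive n M \<longrightarrow> op_mat_positive E n (\<lambda>i j. \<phi> (M i j)))"

text \<open>The Cauchy condition along the approximate unit, for each of the two kinds of seminorms
  generating the strict topology.\<close>

definition strict_map ::
  "('b::cstar_algebra, 'e) hmod \<Rightarrow> ('a::cstar_algebra \<Rightarrow> 'e \<Rightarrow> 'e) \<Rightarrow> bool" where
  "strict_map E \<phi> \<longleftrightarrow> (\<exists>U. approximate_unit U \<and>
     (\<forall>x\<in>hcarrier E. \<forall>e>0. \<exists>P. eventually P U \<and>
        (\<forall>u v. P u \<longrightarrow> P v \<longrightarrow>
           hnorm E (hdiff E (\<phi> u x) (\<phi> v x)) < e \<and>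
           hnorm E (hdiff E (adjoint_map E E (\<phi> u) x) (adjoint_map E E (\<phi> v) x)) < e)))"

definition star_hom_into_adjointable ::
  "('c, 'f) hmod \<Rightarrow> ('b::cstar_algebra \<Rightarrow> 'f \<Rightarrow> 'f) \<Rightarrow> bool" where
  "star_hom_into_adjointable F \<pi> \<longleftrightarrow> linear_into_adjointable F \<pi> \<and>
     (\<forall>a b. \<pi> (a * b) = compose (hcarrier F) (\<pi> a) (\<pi> b)) \<and>
     (\<forall>b. \<pi> (star b) = adjoint_map F F (\<pi> b))"

inductive_set hspan :: "('c, 'f) hmod \<Rightarrow> 'f set \<Rightarrow> 'f set" for F S where
  hspan_zero: "hzero F \<in> hspan F S"
| hspan_base: "x \<in> S \<Longrightarrow> x \<in> hspan F S"
| hspan_add: "\<lbrakk>x \<in> hspan F S; y \<in> hspan F S\<rbrakk> \<Longrightarrow> hadd F x y \<in> hspan F S"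
| hspan_scale: "x \<in> hspan F S \<Longrightarrow> hscale F c x \<in> hspan F S"

definition nondegenerate ::
  "('c::cstar_algebra, 'f) hmod \<Rightarrow> ('b \<Rightarrow> 'f \<Rightarrow> 'f) \<Rightarrow> bool" where
  "nondegenerate F \<pi> \<longleftrightarrow>
     (\<forall>y\<in>hcarrier F. \<forall>e>0. \<exists>z\<in>hspan F {\<pi> b x | b x. x \<in> hcarrier F}.
        hnorm F (hdiff F y z) < e)"


section \<open>Categories and functors\<close>

text \<open>Hom-sets are not required to be disjoint, so composition and the action of a functor
  on morphisms take the objects involved as arguments.\<close>

record ('o, 'm) category =
  Ob :: "'o set"
  Hom :: "'o \<Rightarrow> 'o \<Rightarrow> 'm set"
  Id :: "'o \<Rightarrow> 'm"
  Comp :: "'o \<Rightarrow> 'o \<Rightarrow> 'o \<Rightarrow> 'm \<Rightarrow> 'm \<Rightarrow> 'm"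

definition is_category :: "('o, 'm) category \<Rightarrow> bool" where
  "is_category \<C> \<longleftrightarrow>
     (\<forall>X\<in>Ob \<C>. Id \<C> X \<in> Hom \<C> X X) \<and>
     (\<forall>X\<in>Ob \<C>. \<forall>Y\<in>Ob \<C>. \<forall>Z\<in>Ob \<C>. \<forall>f\<in>Hom \<C> X Y. \<forall>g\<in>Hom \<C> Y Z.
        Comp \<C> X Y Z g f \<in> Hom \<C> X Z) \<and>
     (\<forall>X\<in>Ob \<C>. \<forall>Y\<in>Ob \<C>. \<forall>f\<in>Hom \<C> X Y.
        Comp \<C> X X Y f (Id \<C> X) = f \<and> Comp \<C> X Y Y (Id \<C> Y) f = f) \<and>
     (\<forall>W\<in>Ob \<C>. \<forall>X\<in>Ob \<C>. \<forall>Y\<in>Ob \<C>. \<forall>Z\<in>Ob \<C>.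
        \<forall>f\<in>Hom \<C> W X. \<forall>g\<in>Hom \<C> X Y. \<forall>h\<in>Hom \<C> Y Z.
        Comp \<C> W X Z (Comp \<C> X Y Z h g) f = Comp \<C> W Y Z h (Comp \<C> W X Y g f))"

definition is_functor ::
  "('o, 'm) category \<Rightarrow> ('p, 'n) category \<Rightarrow> ('o \<Rightarrow> 'p) \<Rightarrow> ('o \<Rightarrow> 'o \<Rightarrow> 'm \<Rightarrow> 'n) \<Rightarrow> bool" where
  "is_functor \<C> \<D> FO FM \<longleftrightarrow> is_category \<C> \<and> is_category \<D> \<and>
     (\<forall>X\<in>Ob \<C>. FO X \<in> Ob \<D>) \<and>
     (\<forall>X\<in>Ob \<C>. \<forall>Y\<in>Ob \<C>. \<forall>f\<in>Hom \<C> X Y. FM X Y f \<in> Hom \<D> (FO X) (FO Y)) \<and>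
     (\<forall>X\<in>Ob \<C>. FM X X (Id \<C> X) = Id \<D> (FO X)) \<and>
     (\<forall>X\<in>Ob \<C>. \<forall>Y\<in>Ob \<C>. \<forall>Z\<in>Ob \<C>. \<forall>f\<in>Hom \<C> X Y. \<forall>g\<in>Hom \<C> Y Z.
        FM X Z (Comp \<C> X Y Z g f) = Comp \<D> (FO X) (FO Y) (FO Z) (FM Y Z g) (FM X Y f))"


section \<open>The categories of positive correspondences and correspondences\<close>

text \<open>The type \<open>'e\<close> bounds the size of the modules that occur as objects.\<close>

type_synonym ('a, 'b, 'e) correspondence = "('b, 'e) hmod \<times> ('a \<Rightarrow> 'e \<Rightarrow> 'e)"
type_synonym ('a, 'e) correspondence_map = "('e \<Rightarrow> 'e) \<times> ('a \<Rightarrow> 'a)"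

definition PosCor ::
  "(('a::cstar_algebra, 'b::cstar_algebra, 'e) correspondence, ('a, 'e) correspondence_map) category"
where
  "PosCor = \<lparr>
     Ob = {(E, \<phi>). hilbert_module E \<and> completely_positive E \<phi> \<and> strict_map E \<phi>},
     Hom = (\<lambda>(E\<^sub>1, \<phi>\<^sub>1) (E\<^sub>2, \<phi>\<^sub>2). {(\<eta>, \<alpha>). \<eta> \<in> adjointable E\<^sub>1 E\<^sub>2 \<and> star_automorphism \<alpha> \<and>
        (\<forall>a. compose (hcarrier E\<^sub>1) (\<phi>\<^sub>2 (\<alpha> a)) \<eta> = compose (hcarrier E\<^sub>1) \<eta> (\<phi>\<^sub>1 a))}),
     Id = (\<lambda>(E, \<phi>). (restrict id (hcarrier E), id)),
     Comp = (\<lambda>(E\<^sub>1, \<phi>\<^sub>1) (E\<^sub>2, \<phi>\<^sub>2) (E\<^sub>3, \<phi>\<^sub>3) (\<xi>, \<beta>) (\<eta>, \<alpha>).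
        (compose (hcarrier E\<^sub>1) \<xi> \<eta>, \<beta> \<circ> \<alpha>)) \<rparr>"

definition Cor ::
  "(('b::cstar_algebra, 'c::cstar_algebra, 'f) correspondence, ('b, 'f) correspondence_map) category"
where
  "Cor = PosCor \<lparr> Ob :=
     {(F, \<pi>). hilbert_module F \<and> star_hom_into_adjointable F \<pi> \<and> nondegenerate F \<pi>} \<rparr>"


section \<open>The balanced algebraic tensor product\<close>

text \<open>Elements of the free complex vector space on \<open>E \<times> F\<close> are finitely supported functions.\<close>

type_synonym ('e, 'f) formal = "('e \<times> 'f) \<Rightarrow>\<^sub>0 complex"

definition formal_scale :: "complex \<Rightarrow> ('e, 'f) formal \<Rightarrow> ('e, 'f) formal" where
  "formal_scale c u = Poly_Mapping.map ((*) c) u"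

lemma lookup_formal_scale: "Poly_Mapping.lookup (formal_scale c u) p = c * Poly_Mapping.lookup u p"
  by (simp add: formal_scale_def Poly_Mapping.map.rep_eq when_def)

interpretation formal: module formal_scale
  by unfold_locales
    (auto intro!: poly_mapping_eqI simp: lookup_formal_scale lookup_add algebra_simps)

abbreviation formal_tensor :: "'e \<Rightarrow> 'f \<Rightarrow> ('e, 'f) formal" where
  "formal_tensor x y \<equiv> Poly_Mapping.single (x, y) 1"

definition formal_carrier :: "('b, 'e) hmod \<Rightarrow> ('c, 'f) hmod \<Rightarrow> ('e, 'f) formal set" where
  "formal_carrier E F = {u. Poly_Mapping.keys u \<subseteq> hcarrier E \<times> hcarrier F}"

definition tensor_relations ::
  "('b, 'e) hmod \<Rightarrow> ('c, 'f) hmod \<Rightarrow> ('b \<Rightarrow> 'f \<Rightarrow> 'f) \<Rightarrow> ('e, 'f) formal set" where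
  "tensor_relations E F \<pi> =
     {formal_tensor (hadd E x x') y - formal_tensor x y - formal_tensor x' y | x x' y.
        x \<in> hcarrier E \<and> x' \<in> hcarrier E \<and> y \<in> hcarrier F} \<union>
     {formal_tensor x (hadd F y y') - formal_tensor x y - formal_tensor x y' | x y y'.
        x \<in> hcarrier E \<and> y \<in> hcarrier F \<and> y' \<in> hcarrier F} \<union>
     {formal_tensor (hscale E c x) y - formal_scale c (formal_tensor x y) | c x y.
        x \<in> hcarrier E \<and> y \<in> hcarrier F} \<union>
     {formal_tensor x (hscale F c y) - formal_scale c (formal_tensor x y) | c x y.
        x \<in> hcarrier E \<and> y \<in> hcarrier F} \<union>
     {formal_tensor (hact E x b) y - formal_tensor x (\<pi> b y) | x b y.
        x \<in> hcarrier E \<and> y \<in> hcarrier F}"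

definition tensor_coset ::
  "('b, 'e) hmod \<Rightarrow> ('c, 'f) hmod \<Rightarrow> ('b \<Rightarrow> 'f \<Rightarrow> 'f) \<Rightarrow> ('e, 'f) formal \<Rightarrow> ('e, 'f) formal set"
where
  "tensor_coset E F \<pi> u = {v. v - u \<in> formal.span (tensor_relations E F \<pi>)}"

definition formal_act ::
  "('c, 'f) hmod \<Rightarrow> ('e, 'f) formal \<Rightarrow> 'c \<Rightarrow> ('e, 'f) formal" where
  "formal_act F u c =
     (\<Sum>p\<in>Poly_Mapping.keys u.
        Poly_Mapping.single (fst p, hact F (snd p) c) (Poly_Mapping.lookup u p))"

definition formal_inner ::
  "('b, 'e) hmod \<Rightarrow> ('c::cstar_algebra, 'f) hmod \<Rightarrow> ('b \<Rightarrow> 'f \<Rightarrow> 'f) \<Rightarrow>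
   ('e, 'f) formal \<Rightarrow> ('e, 'f) formal \<Rightarrow> 'c" where
  "formal_inner E F \<pi> u v =
     (\<Sum>p\<in>Poly_Mapping.keys u. \<Sum>q\<in>Poly_Mapping.keys v.
        (cnj (Poly_Mapping.lookup u p) * Poly_Mapping.lookup v q) *\<^sub>C
        hinner F (snd p) (\<pi> (hinner E (fst p) (fst q)) (snd q)))"

definition some_rep :: "'x set \<Rightarrow> 'x" where
  "some_rep P = (SOME u. u \<in> P)"

definition balanced_tensor ::
  "('b, 'e) hmod \<Rightarrow> ('c::cstar_algebra, 'f) hmod \<Rightarrow> ('b \<Rightarrow> 'f \<Rightarrow> 'f) \<Rightarrow>
   ('c, ('e, 'f) formal set) hmod" where
  "balanced_tensor E F \<pi> = \<lparr>
     hcarrier = tensor_coset E F \<pi> ` formal_carrier E F,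
     hzero = tensor_coset E F \<pi> 0,
     hadd = (\<lambda>P Q. tensor_coset E F \<pi> (some_rep P + some_rep Q)),
     hscale = (\<lambda>c P. tensor_coset E F \<pi> (formal_scale c (some_rep P))),
     hact = (\<lambda>P c. tensor_coset E F \<pi> (formal_act F (some_rep P) c)),
     hinner = (\<lambda>P Q. formal_inner E F \<pi> (some_rep P) (some_rep Q)) \<rparr>"


section \<open>Completion and the interior tensor product\<close>

text \<open>Cauchy sequences modulo null sequences.\<close>

definition completion_class ::
  "('c::cstar_algebra, 'x) hmod \<Rightarrow> (nat \<Rightarrow> 'x) \<Rightarrow> (nat \<Rightarrow> 'x) set" where
  "completion_class M X =
     {Y. hCauchy M Y \<and> (\<lambda>n. hnorm M (hdiff M (Y n) (X n))) \<longlonglongrightarrow> 0}"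

definition completion ::
  "('c::cstar_algebra, 'x) hmod \<Rightarrow> ('c, (nat \<Rightarrow> 'x) set) hmod" where
  "completion M = \<lparr>
     hcarrier = completion_class M ` {X. hCauchy M X},
     hzero = completion_class M (\<lambda>n. hzero M),
     hadd = (\<lambda>P Q. completion_class M (\<lambda>n. hadd M (some_rep P n) (some_rep Q n))),
     hscale = (\<lambda>c P. completion_class M (\<lambda>n. hscale M c (some_rep P n))),
     hact = (\<lambda>P b. completion_class M (\<lambda>n. hact M (some_rep P n) b)),
     hinner = (\<lambda>P Q. lim (\<lambda>n. hinner M (some_rep P n) (some_rep Q n))) \<rparr>"

type_synonym ('e, 'f) interior = "(nat \<Rightarrow> ('e, 'f) formal set) set"

definition interior_tensor ::
  "('b, 'e) hmod \<Rightarrow> ('c::cstar_algebra, 'f) hmod \<Rightarrow> ('b \<Rightarrow> 'f \<Rightarrow> 'f) \<Rightarrow>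
   ('c, ('e, 'f) interior) hmod" where
  "interior_tensor E F \<pi> = completion (balanced_tensor E F \<pi>)"

definition simple_tensor ::
  "('b, 'e) hmod \<Rightarrow> ('c::cstar_algebra, 'f) hmod \<Rightarrow> ('b \<Rightarrow> 'f \<Rightarrow> 'f) \<Rightarrow>
   'e \<Rightarrow> 'f \<Rightarrow> ('e, 'f) interior" where
  "simple_tensor E F \<pi> x y =
     completion_class (balanced_tensor E F \<pi>) (\<lambda>n. tensor_coset E F \<pi> (formal_tensor x y))"

definition is_tensor_extension ::
  "('b, 'e) hmod \<Rightarrow> ('b, 'e) hmod \<Rightarrow> ('c::cstar_algebra, 'f) hmod \<Rightarrow> ('b \<Rightarrow> 'f \<Rightarrow> 'f) \<Rightarrow>
   ('e \<Rightarrow> 'e) \<Rightarrow> (('e, 'f) interior \<Rightarrow> ('e, 'f) interior) \<Rightarrow> bool" where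
  "is_tensor_extension E\<^sub>1 E\<^sub>2 F \<pi> \<eta> h \<longleftrightarrow>
     h \<in> adjointable (interior_tensor E\<^sub>1 F \<pi>) (interior_tensor E\<^sub>2 F \<pi>) \<and>
     (\<forall>x\<in>hcarrier E\<^sub>1. \<forall>f\<in>hcarrier F.
        h (simple_tensor E\<^sub>1 F \<pi> x f) = simple_tensor E\<^sub>2 F \<pi> (\<eta> x) f)"

text \<open>For \<open>E\<^sub>1 = E\<^sub>2\<close> this is the operator \<open>\<eta> \<otimes>\<^sub>\<pi> I\<close>.\<close>

definition tensor_extension ::
  "('b, 'e) hmod \<Rightarrow> ('b, 'e) hmod \<Rightarrow> ('c::cstar_algebra, 'f) hmod \<Rightarrow> ('b \<Rightarrow> 'f \<Rightarrow> 'f) \<Rightarrow>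
   ('e \<Rightarrow> 'e) \<Rightarrow> ('e, 'f) interior \<Rightarrow> ('e, 'f) interior" where
  "tensor_extension E\<^sub>1 E\<^sub>2 F \<pi> \<eta> = (THE h. is_tensor_extension E\<^sub>1 E\<^sub>2 F \<pi> \<eta> h)"

definition tensor_obj ::
  "('c::cstar_algebra, 'f) hmod \<Rightarrow> ('b \<Rightarrow> 'f \<Rightarrow> 'f) \<Rightarrow>
   ('a, 'b, 'e) correspondence \<Rightarrow> ('a, 'c, ('e, 'f) interior) correspondence" where
  "tensor_obj F \<pi> = (\<lambda>(E, \<phi>). (interior_tensor E F \<pi>, \<lambda>a. tensor_extension E E F \<pi> (\<phi> a)))"

definition tensor_mor ::
  "('c::cstar_algebra, 'f) hmod \<Rightarrow> ('b \<Rightarrow> 'f \<Rightarrow> 'f) \<Rightarrow>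
   ('a, 'b, 'e) correspondence \<Rightarrow> ('a, 'b, 'e) correspondence \<Rightarrow>
   ('a, 'e) correspondence_map \<Rightarrow> ('a, ('e, 'f) interior) correspondence_map" where
  "tensor_mor F \<pi> = (\<lambda>(E\<^sub>1, \<phi>\<^sub>1) (E\<^sub>2, \<phi>\<^sub>2) (\<eta>, \<alpha>). (tensor_extension E\<^sub>1 E\<^sub>2 F \<pi> \<eta>, \<alpha>))"

end

theory Submission
  imports Defs
begin

text \<open>The point is to control \<open>T \<otimes> I\<close> on the algebraic tensor product without functional calculus in
  \<open>\<L>(E)\<close>. All spectral input takes place in the coefficient algebra: a self-adjoint contraction \<open>h\<close>
  has a root \<open>1 - k\<close> of \<open>1 - h\<close>, and this yields the positive cone and the Cauchy--Schwarz inequality.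
  The semi-inner product on \<open>E \<otimes> F\<close> is positive because one vector \<open>x\<close> at a time can be eliminated
  from a Gram form by iterating \<open>1 - x\<langle>x, \<cdot>\<rangle>\<close>. Adjointable maps are bounded (uniform boundedness),
  and Cauchy--Schwarz iterated along the orbits of \<open>T\<^sup>*T \<otimes> I\<close> then gives
  \<open>\<parallel>T \<otimes> I\<parallel> \<le> \<parallel>T\<parallel>\<close>. An adjointable map is determined by its values on simple tensors,
  so functoriality, linearity and complete positivity of \<open>\<phi>(-) \<otimes> I\<close> can be read off there; strictness
  follows since positive maps are bounded on positive contractions.\<close>

section \<open>Positive elements of C*-algebras\<close>

text \<open>The operators on a module form only a set of functions on a carrier, not a type of class
  \<open>cstar_algebra\<close>. So the usual arguments (a root of \<open>K^2 - T* T\<close> for the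
  norm of \<open>T \<otimes> I\<close>, positivity in matrix algebras over \<open>'b\<close> for the
  inner product) are not at hand, and each operator fact is reduced to identities between
  coefficients. The coefficient algebra may lack a unit, so its cone is studied in a unitization and
  pulled back; products such as \<open>(1 - k) b\<close> are written \<open>b - k * b\<close>.
  Adjointability only says that an adjoint exists: linearity comes from moving the map across the
  inner product, boundedness from completeness of the domain. Definiteness of the form on the
  algebraic tensor product is never established. Passing to Cauchy sequences modulo null sequences
  removes null vectors, and before that step norm identities are derived from equal inner squares
  rather than from equal vectors. For strictness only the seminorms without adjoints need an
  estimate: along positive contractions the operators are self-adjoint, so both kinds
  coincide.\<close>

context cstar_algebra
begin

lemma scaleC_one [simp]: "1 *\<^sub>C x = x"
  using scaleR_scaleC[of 1 x] by (simp add: scaleR_one)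

lemma scaleC_zero_left [simp]: "0 *\<^sub>C x = 0"
  using scaleC_add_left[of 0 0 x] by simp

lemma scaleC_zero_right [simp]: "c *\<^sub>C 0 = 0"
  using scaleC_add_right[of c 0 0] by simp

lemma scaleC_minus_right [simp]: "c *\<^sub>C (- x) = - (c *\<^sub>C x)"
  using scaleC_add_right[of c x "- x"] by (simp add: eq_neg_iff_add_eq_0 add.commute)

lemma scaleC_minus_left [simp]: "(- c) *\<^sub>C x = - (c *\<^sub>C x)"
  using scaleC_add_left[of c "- c" x] by (simp add: eq_neg_iff_add_eq_0 add.commute)

lemma scaleC_diff_right: "c *\<^sub>C (x - y) = c *\<^sub>C x - c *\<^sub>C y"
  using scaleC_add_right[of c x "- y"] by simp

lemma star_zero [simp]: "star 0 = 0"
  using star_add[of 0 0] by simp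

lemma star_minus: "star (- x) = - star x"
  using star_add[of x "- x"] by (simp add: eq_neg_iff_add_eq_0 add.commute)

lemma star_diff: "star (x - y) = star x - star y"
  using star_add[of x "- y"] by (simp add: star_minus)

lemma star_scaleR: "star (r *\<^sub>R x) = r *\<^sub>R star x"
  by (simp add: scaleR_scaleC star_scaleC)

lemma scaleC_scaleR: "c *\<^sub>C (r *\<^sub>R x) = r *\<^sub>R (c *\<^sub>C x)"
  by (simp add: scaleR_scaleC scaleC_scaleC mult.commute)

lemma scaleC_sum_right: "c *\<^sub>C (\<Sum>i\<in>I. f i) = (\<Sum>i\<in>I. c *\<^sub>C f i)"
  by (induction I rule: infinite_finite_induct) (auto simp: scaleC_add_right)

lemma star_sum: "star (\<Sum>i\<in>I. f i) = (\<Sum>i\<in>I. star (f i))"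
  by (induction I rule: infinite_finite_induct) (auto simp: star_add)

lemma norm_star [simp]: "norm (star x) = norm x"
proof -
  have le: "norm y \<le> norm (star y)" for y
  proof (cases "norm y = 0")
    case False
    have "(norm y)\<^sup>2 \<le> norm (star y) * norm y"
      using norm_mult_ineq[of "star y" y] by (simp add: cstar_identity)
    with False show ?thesis by (simp add: power2_eq_square)
  qed simp
  show ?thesis using le[of x] le[of "star x"] by (simp add: star_star)
qed

lemma norm_square_self_adjoint: "star k = k \<Longrightarrow> norm (k * k) = (norm k)\<^sup>2"
  using cstar_identity[of k] by simp

end

lemma bounded_linear_scaleC: "bounded_linear (\<lambda>x::'a::cstar_algebra. c *\<^sub>C x)"
  by (rule bounded_linear_intro[where K = "cmod c"])
     (auto simp: scaleC_add_right scaleC_scaleR norm_scaleC)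

lemma bounded_linear_star: "bounded_linear (star :: 'a::cstar_algebra \<Rightarrow> 'a)"
  by (rule bounded_linear_intro[where K = 1]) (auto simp: star_add star_scaleR)

lemmas tendsto_scaleC = bounded_linear.tendsto[OF bounded_linear_scaleC]
lemmas tendsto_star = bounded_linear.tendsto[OF bounded_linear_star]

text \<open>The Riesz--Nagy iteration \<open>y \<mapsto> (h + y\<^sup>2) / 2\<close>: the limit \<open>k\<close> makes \<open>1 - k\<close> a square root
  of \<open>1 - h\<close>. It is dominated by the same iteration for the number \<open>1\<close>.\<close>

lemma self_adjoint_root:
  fixes h :: "'a::cstar_algebra"
  assumes sa: "star h = h" and le: "norm h \<le> 1"
  obtains k where "star k = k" "norm k \<le> 1" "k + k - k * k = h" "\<And>c. c * h = h * c \<Longrightarrow> c * k = k * c"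
proof -
  define y where "y = rec_nat 0 (\<lambda>_ y. (1/2) *\<^sub>R (h + y * y))"
  define e :: "nat \<Rightarrow> real" where "e = rec_nat 0 (\<lambda>_ t. (1/2) * (1 + t * t))"
  have y0: "y 0 = 0" and yS: "\<And>n. y (Suc n) = (1/2) *\<^sub>R (h + y n * y n)" by (auto simp: y_def)
  have e0: "e 0 = 0" and eS: "\<And>n. e (Suc n) = (1/2) * (1 + e n * e n)" by (auto simp: e_def)
  have comm: "c * y n = y n * c" if "c * h = h * c" for c n
  proof (induction n)
    case (Suc n)
    have "c * (y n * y n) = (y n * y n) * c" by (metis Suc mult.assoc)
    then show ?case by (simp add: yS algebra_simps that)
  qed (simp add: y0)
  have ysa: "star (y n) = y n" for n
    by (induction n) (auto simp: y0 yS star_scaleR star_add star_mult sa)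
  have e1: "0 \<le> e n \<and> e n \<le> 1" for n
  proof (induction n)
    case (Suc n)
    then have "e n * e n \<le> 1 * 1" by (intro mult_mono) auto
    then show ?case using Suc by (auto simp: eS)
  qed (simp add: e0)
  have yle: "norm (y n) \<le> e n" for n
  proof (induction n)
    case (Suc n)
    have "norm (h + y n * y n) \<le> 1 + e n * e n"
      using le norm_triangle_ineq[of h "y n * y n"] norm_mult_ineq[of "y n" "y n"]
        mult_mono[OF Suc Suc] e1[of n] by auto
    then show ?case by (simp add: yS eS)
  qed (simp add: y0 e0)
  have step: "norm (y (Suc n) - y n) \<le> e (Suc n) - e n" for n
  proof (induction n)
    case 0 then show ?case using le by (simp add: y0 yS e0 eS)
  next
    case (Suc n)
    \<comment> \<open>The case \<open>c = h\<close> of \<open>comm\<close> says that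
      \<open>y n\<close> commutes with \<open>h\<close>; applying \<open>comm\<close> once more, it
      commutes with \<open>y (Suc n)\<close>. This permits the factorization of the difference of
      squares below.\<close>
    have c: "y n * y (Suc n) = y (Suc n) * y n"
      by (rule comm) (rule comm[OF refl, symmetric])
    have "y (Suc (Suc n)) - y (Suc n) = (1/2) *\<^sub>R (y (Suc n) * y (Suc n) - y n * y n)"
      by (subst (1 2) yS) (simp add: algebra_simps)
    also have "y (Suc n) * y (Suc n) - y n * y n = (y (Suc n) - y n) * (y (Suc n) + y n)"
      using c by (simp add: algebra_simps)
    finally have "norm (y (Suc (Suc n)) - y (Suc n)) \<le> (1/2) * (norm (y (Suc n) - y n) * norm (y (Suc n)
        + y n))"
      using norm_mult_ineq by simp
    also have "\<dots> \<le> (1/2) * ((e (Suc n) - e n) * (e (Suc n) + e n))"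
      using Suc norm_triangle_ineq[of "y (Suc n)" "y n"] yle[of n] yle[of "Suc n"]
      order_trans[OF norm_ge_zero Suc]
      by (intro mult_left_mono mult_mono) auto
    also have "\<dots> = e (Suc (Suc n)) - e (Suc n)"
      by (subst (3 4) eS) (simp add: algebra_simps)
    finally show ?case .
  qed
  \<comment> \<open>Telescoping against the bounded monotone sequence \<open>e\<close> makes
    \<open>y\<close> Cauchy. A contraction argument would break down at \<open>norm h = 1\<close>,
    where the Lipschitz constants of the iteration may approach 1.\<close>
  have dist: "norm (y (n + m) - y n) \<le> e (n + m) - e n" for n m
  proof (induction m)
    case (Suc m)
    then show ?case using step[of "n + m"] norm_triangle_ineq[of "y (Suc (n + m)) - y (n + m)" "y (n + m)
        - y n"]
      by simp
  qed simp
  have "e n \<le> e (Suc n)" for n using step[of n] norm_ge_zero by (meson diff_ge_0_iff_ge order_trans)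
  then have "incseq e" by (rule incseq_SucI)
  then obtain l where "e \<longlonglongrightarrow> l" using incseq_convergent[of e 1] e1 by blast
  then have "Cauchy e" by (rule LIMSEQ_imp_Cauchy)
  have "Cauchy y"
  proof (rule metric_CauchyI)
    fix r :: real assume "r > 0"
    then obtain M where M: "\<And>m n. m \<ge> M \<Longrightarrow> n \<ge> M \<Longrightarrow> dist (e m) (e n) < r"
      using \<open>Cauchy e\<close> metric_CauchyD by blast
    have main: "dist (y m) (y n) < r" if "m \<ge> n" "n \<ge> M" for m n
      using dist[of n "m - n"] M[of m n] that by (auto simp: dist_norm)
    show "\<exists>M. \<forall>m\<ge>M. \<forall>n\<ge>M. dist (y m) (y n) < r"
      by (metis main dist_commute nle_le)
  qed
  then obtain k where k: "y \<longlonglongrightarrow> k" using Cauchy_convergent convergent_def by blast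
  have "(\<lambda>n. y (Suc n)) \<longlonglongrightarrow> (1/2) *\<^sub>R (h + k * k)"
    unfolding yS by (intro tendsto_intros k)
  then have "k = (1/2) *\<^sub>R (h + k * k)"
    using LIMSEQ_unique[OF LIMSEQ_Suc[OF k]] by blast
  then have "2 *\<^sub>R k = h + k * k"
    by (metis scaleR_scaleR scaleR_one mult_2 field_sum_of_halves mult.commute times_divide_eq_left
        mult_1 div_self zero_neq_numeral)
  then have eq: "k + k - k * k = h" by (simp add: scaleR_2)
  show thesis
  proof
    show "star k = k" using LIMSEQ_unique[OF tendsto_star[OF k]] k by (simp add: ysa)
    show "norm k \<le> 1" by (rule LIMSEQ_le_const2[OF tendsto_norm[OF k]]) (use yle e1 order_trans in blast)
    show "k + k - k * k = h" by fact
    show "c * k = k * c" if "c * h = h * c" for c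
    proof -
      have "(\<lambda>n. c * y n) \<longlonglongrightarrow> c * k" "(\<lambda>n. y n * c) \<longlonglongrightarrow> k * c" by (intro tendsto_intros k)+
      then show ?thesis using LIMSEQ_unique by (simp add: comm[OF that])
    qed
  qed
qed

text \<open>The norm \<open>max \<bar>l\<bar> \<parallel>x \<mapsto> lx + ax\<parallel>\<close> on \<open>\<complex> \<oplus> 'a\<close> is a C*-norm whether or not \<open>'a\<close> already
  has a unit; the operator norm alone would be degenerate in the unital case.\<close>

datatype 'a unitization = Unitize (uscalar: complex) (uelem: 'a)

definition uact :: "'a::cstar_algebra unitization \<Rightarrow> 'a \<Rightarrow> 'a" where
  "uact u x = uscalar u *\<^sub>C x + uelem u * x"

lemma bounded_linear_uact: "bounded_linear (uact u)"
  unfolding uact_def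
  by (intro bounded_linear_add bounded_linear_scaleC bounded_linear_mult_right)

instantiation unitization :: (cstar_algebra) real_vector
begin
definition "0 = Unitize 0 0"
definition "u + v = Unitize (uscalar u + uscalar v) (uelem u + uelem v)"
definition "- u = Unitize (- uscalar u) (- uelem u)"
definition "u - v = Unitize (uscalar u - uscalar v) (uelem u - uelem v)"
definition "r *\<^sub>R u = Unitize (of_real r * uscalar u) (r *\<^sub>R uelem u)"
instance
  by intro_classes
    (auto simp: zero_unitization_def plus_unitization_def uminus_unitization_def
       minus_unitization_def scaleR_unitization_def algebra_simps)
end

lemma uscalar_simps [simp]: "uscalar 0 = 0" "uscalar (u + v) = uscalar u + uscalar v"
  "uscalar (- u) = - uscalar u" "uscalar (u - v) = uscalar u - uscalar v"
  "uscalar (r *\<^sub>R u) = of_real r * uscalar u"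
  by (simp_all add: zero_unitization_def plus_unitization_def uminus_unitization_def
       minus_unitization_def scaleR_unitization_def)

lemma uelem_simps [simp]: "uelem 0 = 0" "uelem (u + v) = uelem u + uelem v"
  "uelem (- u) = - uelem u" "uelem (u - v) = uelem u - uelem v"
  "uelem (r *\<^sub>R u) = r *\<^sub>R uelem u"
  by (simp_all add: zero_unitization_def plus_unitization_def uminus_unitization_def
       minus_unitization_def scaleR_unitization_def)

instantiation unitization :: (cstar_algebra) ring_1
begin
definition "1 = Unitize 1 0"
definition "u * v = Unitize (uscalar u * uscalar v)
  (uscalar u *\<^sub>C uelem v + uscalar v *\<^sub>C uelem u + uelem u * uelem v)"
instance
proof
  fix a b c :: "'a unitization"
  show "a * b * c = a * (b * c)"
    by (auto simp: times_unitization_def algebra_simps scaleC_add_right mult_scaleC_left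
        mult_scaleC_right
        scaleC_scaleC mult_ac)
qed (auto simp: times_unitization_def one_unitization_def zero_unitization_def plus_unitization_def 
   algebra_simps scaleC_add_right scaleC_add_left)
end

lemma umult_simps [simp]: "uscalar 1 = 1" "uelem 1 = 0" "uscalar (u * v) = uscalar u * uscalar v"
  "uelem (u * v) = uscalar u *\<^sub>C uelem v + uscalar v *\<^sub>C uelem u + uelem u * uelem v"
  by (simp_all add: one_unitization_def times_unitization_def)

lemma uact_mult: "uact (u * v) x = uact u (uact v x)"
  by (simp add: uact_def scaleC_add_right scaleC_scaleC mult_scaleC_left mult_scaleC_right algebra_simps)

lemma uact_add: "uact (u + v) x = uact u x + uact v x"
  by (simp add: uact_def scaleC_add_left algebra_simps)

instantiation unitization :: (cstar_algebra) "{real_normed_algebra_1}"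
begin
definition "norm u = max (cmod (uscalar u)) (onorm (uact u))"
definition "dist u v = norm (u - v :: 'a unitization)"
definition "sgn u = inverse (norm u) *\<^sub>R (u :: 'a unitization)"
definition "uniformity = (INF e\<in>{0<..}. principal {(x, y :: 'a unitization). dist x y < e})"
definition "open U = (\<forall>x\<in>U. eventually (\<lambda>(x', y). x' = x \<longrightarrow> y \<in> U) (uniformity ::
    ('a unitization \<times> 'a unitization) filter))"
instance
proof
  fix u v :: "'a unitization" and r :: real
  show "dist u v = norm (u - v)" by (rule dist_unitization_def)
  show "sgn u = inverse (norm u) *\<^sub>R u" by (rule sgn_unitization_def)
  show "uniformity = (INF e\<in>{0<..}. principal {(x, y :: 'a unitization). dist x y < e})"
    by (rule uniformity_unitization_def)
  show "open U = (\<forall>x\<in>U. eventually (\<lambda>(x', y). x' = x \<longrightarrow> y \<in> U) uniformity)" for U :: "'a unitization set"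
    by (rule open_unitization_def)
  show "norm (u + v) \<le> norm u + norm v"
    using norm_triangle_ineq[of "uscalar u" "uscalar v"] onorm_triangle[OF bounded_linear_uact[of u]
        bounded_linear_uact[of v]]
    by (auto simp: norm_unitization_def uact_add[abs_def])
  show "norm (r *\<^sub>R u) = \<bar>r\<bar> * norm u"
  proof -
    have "uact (r *\<^sub>R u) = (\<lambda>x. r *\<^sub>R uact u x)"
      by (auto simp: uact_def fun_eq_iff scaleR_scaleC scaleC_add_right scaleC_scaleC mult_scaleC_left)
    then show ?thesis
      using onorm_scaleR[OF bounded_linear_uact[of u], of r]
      by (simp add: norm_unitization_def norm_mult max_mult_distrib_left)
  qed
  show "norm u = 0 \<longleftrightarrow> u = 0"
  proof
    assume "norm u = 0"
    then have 1: "uscalar u = 0" and "onorm (uact u) \<le> 0"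
      using onorm_pos_le[OF bounded_linear_uact[of u]] by (auto simp: norm_unitization_def max_def split:
          if_splits)
    then have "uact u x = 0" for x
      using onorm_eq_0[OF bounded_linear_uact[of u]] onorm_pos_le[OF bounded_linear_uact[of u]] by force
    \<comment> \<open>With zero scalar part the action is left multiplication; testing it on
      \<open>star (uelem u)\<close> lets the C*-identity recover the element.\<close>
    then have "uelem u * star (uelem u) = 0" using 1 by (simp add: uact_def)
    then have "norm (star (star (uelem u)) * star (uelem u)) = 0" by (simp add: star_star)
    then have "uelem u = 0" unfolding cstar_identity by simp
    with 1 show "u = 0" by (cases u) (simp add: zero_unitization_def)
  next
    assume "u = 0" then show "norm u = 0" by (simp add: norm_unitization_def uact_def[abs_def]
        onorm_zero)
  qed
  show "norm (u * v) \<le> norm u * norm v"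
  proof -
    have "onorm (uact (u * v)) \<le> onorm (uact u) * onorm (uact v)"
      using onorm_compose[OF bounded_linear_uact[of u] bounded_linear_uact[of v]]
      by (simp add: uact_mult[abs_def] comp_def)
    also have "\<dots> \<le> norm u * norm v"
      by (intro mult_mono) (auto simp: norm_unitization_def onorm_pos_le[OF bounded_linear_uact] intro:
          max.coboundedI1)
    finally have 1: "onorm (uact (u * v)) \<le> norm u * norm v" .
    have "cmod (uscalar (u * v)) \<le> norm u * norm v"
      by (auto simp: norm_mult norm_unitization_def intro!: mult_mono intro: max.coboundedI1)
    with 1 show ?thesis by (subst norm_unitization_def) simp
  qed
  show "norm (1 :: 'a unitization) = 1"
    using onorm_id_le[where 'a = 'a] by (simp add: norm_unitization_def uact_def[abs_def])
  show "r *\<^sub>R u * v = r *\<^sub>R (u * v)" "u * r *\<^sub>R v = r *\<^sub>R (u * v)"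
    by (auto simp: scaleR_unitization_def times_unitization_def scaleC_add_right scaleR_scaleC
        scaleC_scaleC
       mult_scaleC_left mult_scaleC_right mult_ac)
qed
end

lemma norm_uact: "norm (uact u x) \<le> norm u * norm x"
  by (rule order_trans[OF onorm[OF bounded_linear_uact]])
     (auto intro!: mult_right_mono simp: norm_unitization_def)

lemma norm_uscalar: "cmod (uscalar u) \<le> norm u"
  by (simp add: norm_unitization_def)

text \<open>Applying \<open>u\<close> to \<open>star (uelem u)\<close> yields the square of
  \<open>norm (uelem u)\<close> up to the scalar term, and each of the two terms costs one
  \<open>norm u\<close>. Together with \<open>norm_uscalar\<close> and
  \<open>norm_unitization_le\<close> this makes the norm equivalent to the sum of the coordinate
  norms, as completeness requires.\<close>

lemma norm_uelem: "norm (uelem u) \<le> 2 * norm u"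
proof (cases "uelem u = 0")
  case False
  have "(norm (uelem u))\<^sup>2 = norm (uelem u * star (uelem u))"
    using cstar_identity[of "star (uelem u)"] by (simp add: star_star)
  also have "\<dots> = norm (uact u (star (uelem u)) - uscalar u *\<^sub>C star (uelem u))" by (simp add: uact_def)
  also have "\<dots> \<le> norm u * norm (uelem u) + norm u * norm (uelem u)"
    using norm_uact[of u "star (uelem u)"] norm_uscalar[of u] norm_triangle_ineq4[of "uact u (star (uelem
        u))" "uscalar u *\<^sub>C star (uelem u)"]
      mult_right_mono[OF norm_uscalar[of u] norm_ge_zero[of "uelem u"]]
    by (simp add: norm_scaleC)
  finally have "norm (uelem u) * norm (uelem u) \<le> (2 * norm u) * norm (uelem u)" by (simp add:
      power2_eq_square)
  then show ?thesis using False by simp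
qed simp

lemma norm_unitization_le: "norm u \<le> cmod (uscalar u) + norm (uelem u)"
proof -
  have "norm (uact u x) \<le> (cmod (uscalar u) + norm (uelem u)) * norm x" for x
    using norm_triangle_ineq[of "uscalar u *\<^sub>C x" "uelem u * x"] norm_mult_ineq[of "uelem u" x]
    by (simp add: uact_def norm_scaleC algebra_simps)
  then have "onorm (uact u) \<le> cmod (uscalar u) + norm (uelem u)" by (intro onorm_bound) auto
  then show ?thesis by (simp add: norm_unitization_def)
qed

instantiation unitization :: (cstar_algebra) cstar_algebra
begin
definition "c *\<^sub>C u = Unitize (c * uscalar u) (c *\<^sub>C uelem u)"
definition "star u = Unitize (cnj (uscalar u)) (star (uelem u))"

instance
proof
  fix u v :: "'a unitization" and c d :: complex and r :: real
  show "c *\<^sub>C (u + v) = c *\<^sub>C u + c *\<^sub>C v" "(c + d) *\<^sub>C u = c *\<^sub>C u + d *\<^sub>C u"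
    "c *\<^sub>C d *\<^sub>C u = (c * d) *\<^sub>C u" "r *\<^sub>R u = complex_of_real r *\<^sub>C u"
    "(c *\<^sub>C u) * v = c *\<^sub>C (u * v)" "u * (c *\<^sub>C v) = c *\<^sub>C (u * v)"
    by (auto simp: scaleC_unitization_def plus_unitization_def times_unitization_def
        scaleR_unitization_def
      scaleC_add_right scaleC_add_left scaleC_scaleC mult_scaleC_left mult_scaleC_right scaleR_scaleC
          algebra_simps)
  show "star (star u) = u" "star (u + v) = star u + star v" "star (c *\<^sub>C u) = cnj c *\<^sub>C star u"
    "star (u * v) = star v * star u"
    by (auto simp: star_unitization_def scaleC_unitization_def plus_unitization_def times_unitization_def
      star_star star_add star_scaleC star_mult)
  have act: "uact (c *\<^sub>C u) x = c *\<^sub>C uact u x" for c u and x :: 'a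
    by (simp add: uact_def scaleC_unitization_def scaleC_add_right scaleC_scaleC mult_scaleC_left)
  have le: "norm (c *\<^sub>C u) \<le> cmod c * norm u" for c and u :: "'a unitization"
  proof -
    have "onorm (uact (c *\<^sub>C u)) \<le> cmod c * norm u"
      using norm_uact[of u] by (intro onorm_bound) (auto simp: act norm_scaleC mult.assoc intro!:
          mult_left_mono)
    moreover have "cmod (uscalar (c *\<^sub>C u)) \<le> cmod c * norm u"
      by (auto simp: scaleC_unitization_def norm_mult intro!: mult_left_mono norm_uscalar)
    ultimately show ?thesis by (subst norm_unitization_def) simp
  qed
  show "norm (c *\<^sub>C u) = cmod c * norm u"
  proof (cases "c = 0")
    case False
    have "inverse c *\<^sub>C c *\<^sub>C u = u" using False
      by (cases u) (simp add: scaleC_unitization_def scaleC_scaleC flip: mult.assoc)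
    then have "norm u \<le> cmod (inverse c) * norm (c *\<^sub>C u)" using le[of "inverse c" "c *\<^sub>C u"] by simp
    then have "cmod c * norm u \<le> norm (c *\<^sub>C u)"
      using False mult_left_mono[of "norm u" "cmod (inverse c) * norm (c *\<^sub>C u)" "cmod c"]
      by (simp add: norm_inverse flip: mult.assoc)
    with le[of c u] show ?thesis by simp
  qed (use le[of 0 u] in simp)
  \<comment> \<open>The algebra \<open>'a\<close> is a Hilbert module over itself: the inner square
    of \<open>u x\<close> is \<open>star x\<close> times \<open>u* u\<close> applied to
    \<open>x\<close>. The reverse inequality only needs that \<open>star\<close> is
    isometric.\<close>
  have sq: "(norm u)\<^sup>2 \<le> norm (star u * u)" for u :: "'a unitization"
  proof -
    have "(norm (uact u x))\<^sup>2 \<le> norm (star u * u) * (norm x)\<^sup>2" for x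
    proof -
      have "star (uact u x) * uact u x = star x * uact (star u * u) x"
        by (simp add: uact_mult)
           (simp add: uact_def star_unitization_def star_add star_mult star_scaleC mult_scaleC_left
               mult_scaleC_right algebra_simps scaleC_add_right
             scaleC_scaleC mult.commute)
      then have "(norm (uact u x))\<^sup>2 = norm (star x * uact (star u * u) x)" by (metis cstar_identity)
      also have "\<dots> \<le> norm x * norm (uact (star u * u) x)" using norm_mult_ineq[of "star x"] by simp
      also have "\<dots> \<le> norm x * (norm (star u * u) * norm x)" by (intro mult_left_mono norm_uact) auto
      finally show ?thesis by (simp add: power2_eq_square mult_ac)
    qed
    then have "norm (uact u x) \<le> sqrt (norm (star u * u)) * norm x" for x
      by (metis norm_ge_zero real_le_rsqrt real_sqrt_mult real_sqrt_abs abs_norm_cancel)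
    then have "onorm (uact u) \<le> sqrt (norm (star u * u))" by (intro onorm_bound) auto
    moreover have "cmod (uscalar u) \<le> sqrt (norm (star u * u))"
      using norm_uscalar[of "star u * u"]
      by (intro real_le_rsqrt) (simp add: star_unitization_def norm_mult power2_eq_square)
    ultimately have "norm u \<le> sqrt (norm (star u * u))" by (subst norm_unitization_def) simp
    then show ?thesis by (simp add: sqrt_ge_absD)
  qed
  have st: "norm u \<le> norm (star u)" for u :: "'a unitization"
  proof (cases "norm u = 0")
    case False
    have "(norm u)\<^sup>2 \<le> norm (star u) * norm u" using sq[of u] norm_mult_ineq[of "star u" u] by linarith
    with False show ?thesis by (simp add: power2_eq_square)
  qed simp
  have "norm (star u) = norm u"
    using st[of u] st[of "star u"] \<open>star (star u) = u\<close> by simp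
  then have "norm (star u * u) \<le> (norm u)\<^sup>2"
    using norm_mult_ineq[of "star u" u] by (simp add: power2_eq_square)
  with sq[of u] show "norm (star u * u) = (norm u)\<^sup>2" by simp
next
  fix X :: "nat \<Rightarrow> 'a unitization" assume C: "Cauchy X"
  have "Cauchy (\<lambda>n. uscalar (X n))"
    using C norm_uscalar[of "X m - X n" for m n] unfolding Cauchy_def dist_norm
    by (metis uscalar_simps(4) order_le_less_trans)
  moreover have "Cauchy (\<lambda>n. uelem (X n))"
  proof (rule metric_CauchyI)
    fix e :: real assume "e > 0"
    then obtain M where "\<forall>m\<ge>M. \<forall>n\<ge>M. dist (X m) (X n) < e / 2" using C half_gt_zero unfolding Cauchy_def
        by blast
    then show "\<exists>M. \<forall>m\<ge>M. \<forall>n\<ge>M. dist (uelem (X m)) (uelem (X n)) < e"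
      using norm_uelem[of "X m - X n" for m n] unfolding dist_norm
      by (intro exI[of _ M]) (smt (verit) uelem_simps(4) field_sum_of_halves)
  qed
  ultimately obtain l a where "(\<lambda>n. uscalar (X n)) \<longlonglongrightarrow> l" "(\<lambda>n. uelem (X n)) \<longlonglongrightarrow> a"
    using Cauchy_convergent convergent_def by metis
  then have "(\<lambda>n. cmod (uscalar (X n) - l) + norm (uelem (X n) - a)) \<longlonglongrightarrow> cmod (l - l) + norm (a - a)"
    by (intro tendsto_intros)
  then have "(\<lambda>n. cmod (uscalar (X n) - l) + norm (uelem (X n) - a)) \<longlonglongrightarrow> 0" by simp
  moreover have "norm (X n - Unitize l a) \<le> cmod (uscalar (X n) - l) + norm (uelem (X n) - a)" for n
    using norm_unitization_le[of "X n - Unitize l a"] by simp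
  ultimately have "(\<lambda>n. norm (X n - Unitize l a)) \<longlonglongrightarrow> 0"
    using tendsto_sandwich[OF always_eventually always_eventually tendsto_const,
        of 0 "\<lambda>n. norm (X n - Unitize l a)" "\<lambda>n. cmod (uscalar (X n) - l) + norm (uelem (X n) - a)"]
    by simp
  then have "(\<lambda>n. X n - Unitize l a) \<longlonglongrightarrow> 0" by (rule tendsto_norm_zero_cancel)
  then have "X \<longlonglongrightarrow> Unitize l a" by (simp add: LIM_zero_iff)
  then show "convergent X" by (auto simp: convergent_def)
qed
end

lemma uscaleC_simps [simp]: "uscalar (c *\<^sub>C u) = c * uscalar u" "uelem (c *\<^sub>C u) = c *\<^sub>C uelem u"
  "uscalar (star u) = cnj (uscalar u)" "uelem (star u) = star (uelem u)"
  by (simp_all add: scaleC_unitization_def star_unitization_def)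

text \<open>Positivity of self-adjoint elements is handled through \<open>sa_square\<close>. In the unital case it amounts
  to \<open>\<parallel>t - a\<parallel> \<le> t\<close> for some \<open>t \<ge> \<parallel>a\<parallel>\<close>, a condition that is visibly additive and closed.\<close>

definition sa_square :: "'a::cstar_algebra \<Rightarrow> bool" where
  "sa_square a \<longleftrightarrow> (\<exists>k. star k = k \<and> a = k * k)"

lemma sa_square_self_adjoint: "sa_square a \<Longrightarrow> star a = a"
  by (auto simp: sa_square_def star_mult)

section \<open>The cone of squares of self-adjoint elements in a unital C*-algebra\<close>

lemma star_one: "star (1::'a::{cstar_algebra, real_normed_algebra_1}) = 1"
  by (metis mult.left_neutral mult.right_neutral star_mult star_star)

lemma star_of_real: "star (of_real t :: 'a::{cstar_algebra, real_normed_algebra_1}) = of_real t"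
  by (simp add: of_real_def star_scaleR star_one)

text \<open>Rescaled \<open>self_adjoint_root\<close>: \<open>s = sqrt t (1 - k)\<close>. The last
  estimate is recorded because it is the complement criterion for \<open>s\<close> itself, which
  later shows that the root is again a square.\<close>

lemma root_of_complement:
  fixes a :: "'a::{cstar_algebra, real_normed_algebra_1}"
  assumes sa: "star a = a" and le: "norm a \<le> t"
  obtains s where "star s = s" "s * s = of_real t - a" "\<And>c. c * a = a * c \<Longrightarrow> c * s = s * c"
    "norm (of_real (sqrt t) - s) \<le> sqrt t"
proof (cases "t = 0")
  case True
  then show ?thesis using le by (intro that[of 0]) auto
next
  case False
  then have t: "t > 0" using le norm_ge_zero[of a] by linarith
  have "star (inverse t *\<^sub>R a) = inverse t *\<^sub>R a" "norm (inverse t *\<^sub>R a) \<le> 1"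
    using sa le t by (auto simp: star_scaleR field_simps)
  then obtain k where k: "star k = k" "k + k - k * k = inverse t *\<^sub>R a" "norm k \<le> 1"
    and comm: "\<And>c. c * (inverse t *\<^sub>R a) = (inverse t *\<^sub>R a) * c \<Longrightarrow> c * k = k * c"
    by (rule self_adjoint_root) blast
  let ?s = "sqrt t *\<^sub>R (1 - k)"
  have "?s * ?s = t *\<^sub>R (1 - (k + k - k * k))" using t by (simp add: algebra_simps)
  also have "\<dots> = of_real t - a" using t by (simp add: k algebra_simps of_real_def)
  finally have "?s * ?s = of_real t - a" .
  moreover have "of_real (sqrt t) - ?s = sqrt t *\<^sub>R k" by (simp add: algebra_simps of_real_def)
  then have "norm (of_real (sqrt t) - ?s) \<le> sqrt t" using k(3) t by (simp add: mult_left_le)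
  ultimately show ?thesis
  proof (intro that)
    fix c assume "c * a = a * c"
    then have "c * k = k * c" by (intro comm) simp
    then show "c * ?s = ?s * c" by (simp add: algebra_simps)
  qed (auto simp: star_scaleR star_diff star_one k)
qed

text \<open>\<open>u = x + i y\<close> satisfies \<open>u* u = x^2 + y^2 = t\<close> since
  \<open>x\<close> and \<open>y\<close> commute, so its norm is \<open>sqrt t\<close>; and
  \<open>x\<close> is the real part of \<open>u\<close>. This replaces spectral estimates for
  commuting squares.\<close>

lemma norm_le_of_square_sum:
  fixes x y :: "'a::{cstar_algebra, real_normed_algebra_1}"
  assumes "star x = x" "star y = y" "x * y = y * x" "x * x + y * y = of_real t" "t \<ge> 0"
  shows "norm (x * x) \<le> t"
proof -
  define u where "u = x + \<i> *\<^sub>C y"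
  have su: "star u = x - \<i> *\<^sub>C y" by (simp add: u_def star_add star_scaleC assms)
  have "star u * u = x * x + y * y"
    by (simp add: su) (simp add: u_def ring_distribs mult_scaleC_left mult_scaleC_right scaleC_scaleC
      scaleC_add_right scaleC_diff_right assms(3))
  then have n: "(norm u)\<^sup>2 = t" using cstar_identity[of u] assms(4,5) by simp
  have "u + star u = 2 *\<^sub>R x" by (simp add: su) (simp add: u_def scaleR_2)
  then have "2 * norm x \<le> norm u + norm u" using norm_triangle_ineq[of u "star u"] by simp
  then have "(norm x)\<^sup>2 \<le> t" unfolding n[symmetric] by (intro power_mono) auto
  then show ?thesis using norm_square_self_adjoint[OF assms(1)] by simp
qed

text \<open>Write \<open>a = k^2\<close> and \<open>t - a = s^2\<close>. The root \<open>s\<close>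
  commutes with everything commuting with \<open>a\<close>, in particular with \<open>k\<close>, and
  the two squares add up to the scalar \<open>t\<close>.\<close>

lemma sa_square_norm_complement:
  fixes a :: "'a::{cstar_algebra, real_normed_algebra_1}"
  assumes "sa_square a" "norm a \<le> t"
  shows "norm (of_real t - a) \<le> t"
proof -
  obtain k where k: "star k = k" "a = k * k" using assms(1) by (auto simp: sa_square_def)
  obtain s where s: "star s = s" "s * s = of_real t - a" "\<And>c. c * a = a * c \<Longrightarrow> c * s = s * c"
    using root_of_complement[OF sa_square_self_adjoint[OF assms(1)] assms(2)] by blast
  have "s * k = k * s" by (rule s(3)[symmetric]) (simp add: k mult.assoc)
  moreover have "t \<ge> 0" using assms(2) norm_ge_zero order_trans by blast
  ultimately have "norm (s * s) \<le> t" by (intro norm_le_of_square_sum[of s k]) (auto simp: s k)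
  then show ?thesis by (simp add: s)
qed

text \<open>\<open>a\<close> is the complement of \<open>t - a\<close>, whose norm is at most
  \<open>t\<close> by hypothesis.\<close>

lemma root_if_norm_complement:
  fixes a :: "'a::{cstar_algebra, real_normed_algebra_1}"
  assumes "star a = a" "norm (of_real t - a) \<le> t"
  obtains s where "star s = s" "s * s = a" "\<And>c. c * a = a * c \<Longrightarrow> c * s = s * c"
    "norm (of_real (sqrt t) - s) \<le> sqrt t"
proof (rule root_of_complement[of "of_real t - a" t])
  fix s assume s: "star s = s" "s * s = of_real t - (of_real t - a)"
    "norm (of_real (sqrt t) - s) \<le> sqrt t"
    "\<And>c. c * (of_real t - a) = (of_real t - a) * c \<Longrightarrow> c * s = s * c"
  have "c * (of_real t - a) = (of_real t - a) * c" if "c * a = a * c" for c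
    unfolding left_diff_distrib right_diff_distrib that by (simp add: of_real_def)
  then have "c * s = s * c" if "c * a = a * c" for c using s(4) that by blast
  moreover have "s * s = a" using s(2) by simp
  ultimately show ?thesis using that s(1,3) by blast
next
  show "star (of_real t - a) = of_real t - a" unfolding star_diff star_of_real assms(1) ..
qed (rule assms(2))

lemma sa_square_iff_norm_complement:
  fixes a :: "'a::{cstar_algebra, real_normed_algebra_1}"
  assumes "star a = a" "norm a \<le> t"
  shows "sa_square a \<longleftrightarrow> norm (of_real t - a) \<le> t"
proof
  assume "norm (of_real t - a) \<le> t"
  then show "sa_square a"
    using root_if_norm_complement[OF assms(1)] unfolding sa_square_def by metis
qed (use assms sa_square_norm_complement in blast)

text \<open>The root obtained for \<open>a\<close> satisfies the complement criterion with constant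
  \<open>sqrt (norm a)\<close>, so the previous lemma applies to it a second time and exhibits it as
  a square.\<close>

lemma sa_square_commuting_root:
  fixes a :: "'a::{cstar_algebra, real_normed_algebra_1}"
  assumes "sa_square a"
  obtains s where "star s = s" "s * s = a" "\<And>c. c * a = a * c \<Longrightarrow> c * s = s * c" "sa_square s"
proof -
  obtain s where s: "star s = s" "s * s = a" "\<And>c. c * a = a * c \<Longrightarrow> c * s = s * c"
    "norm (of_real (sqrt (norm a)) - s) \<le> sqrt (norm a)"
    using root_if_norm_complement[OF sa_square_self_adjoint[OF assms] sa_square_norm_complement[OF assms
        order_refl]] by blast
  moreover have "sa_square s" using root_if_norm_complement[OF s(1,4)] unfolding sa_square_def by metis
  ultimately show ?thesis using that by blast
qed

lemma sa_square_add:
  fixes a b :: "'a::{cstar_algebra, real_normed_algebra_1}"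
  assumes "sa_square a" "sa_square b"
  shows "sa_square (a + b)"
proof -
  have "norm ((of_real (norm a) - a) + (of_real (norm b) - b)) \<le> norm a + norm b"
    using sa_square_norm_complement[OF assms(1) order_refl] sa_square_norm_complement[OF assms(2)
        order_refl]
    by (meson add_mono norm_triangle_le)
  also have "(of_real (norm a) - a) + (of_real (norm b) - b) = of_real (norm a + norm b) - (a + b)"
      by simp
  finally show ?thesis
    using sa_square_iff_norm_complement[of "a + b", OF _ norm_triangle_ineq] assms
    by (simp add: star_add sa_square_self_adjoint)
qed

lemma sa_square_closed:
  fixes X :: "nat \<Rightarrow> 'a::{cstar_algebra, real_normed_algebra_1}"
  assumes sq: "\<And>n. sa_square (X n)" and lim: "X \<longlonglongrightarrow> a"
  shows "sa_square a"
proof -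
  \<comment> \<open>The criterion is available for every \<open>t\<close> above the norm, so one
    \<open>t\<close> can serve all terms and the limit.\<close>
  obtain t where t: "\<And>n. norm (X n) \<le> t"
    using convergent_imp_Bseq[of X] lim unfolding convergent_def Bseq_def by blast
  have "norm (of_real t - X n) \<le> t" for n by (rule sa_square_norm_complement[OF sq t])
  then have "norm (of_real t - a) \<le> t"
    by (intro LIMSEQ_le_const2[OF tendsto_norm[OF tendsto_diff[OF tendsto_const lim]]]) auto
  moreover have "norm a \<le> t" by (rule LIMSEQ_le_const2[OF tendsto_norm[OF lim]]) (use t in auto)
  moreover have "star a = a"
    using LIMSEQ_unique[OF tendsto_star[OF lim]] lim by (simp add: sa_square_self_adjoint[OF sq])
  ultimately show ?thesis using sa_square_iff_norm_complement by blast
qed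

text \<open>For \<open>t = norm (a + b)\<close> both \<open>t - (a + b)\<close> and \<open>b\<close>
  are squares, hence so is their sum \<open>t - a = r^2\<close>. A root \<open>k\<close> of
  \<open>a\<close> commutes with \<open>r\<close>, and \<open>k^2 + r^2 = t\<close>.\<close>

lemma sa_square_norm_mono:
  fixes a b :: "'a::{cstar_algebra, real_normed_algebra_1}"
  assumes a: "sa_square a" and b: "sa_square b"
  shows "norm a \<le> norm (a + b)"
proof -
  define t where "t = norm (a + b)"
  obtain s where "star s = s" "s * s = of_real t - (a + b)"
    using root_of_complement[OF sa_square_self_adjoint[OF sa_square_add[OF a b]] eq_refl[OF
        t_def[symmetric]]] by blast
  then have "sa_square (of_real t - (a + b))" unfolding sa_square_def by metis
  from sa_square_add[OF this b] have "sa_square (of_real t - a)" by (simp add: algebra_simps)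
  then obtain r where r: "star r = r" "r * r = of_real t - a" unfolding sa_square_def by metis
  obtain k where k: "star k = k" "k * k = a" "\<And>c. c * a = a * c \<Longrightarrow> c * k = k * c"
    using sa_square_commuting_root[OF a] by blast
  have "a = of_real t - r * r" by (simp add: r)
  have "r * a = a * r"
    unfolding \<open>a = of_real t - r * r\<close> by (simp add: of_real_def algebra_simps)
  then have "k * r = r * k" by (rule k(3)[symmetric])
  moreover have "t \<ge> 0" by (simp add: t_def)
  ultimately have "norm (k * k) \<le> t" by (intro norm_le_of_square_sum[of k r]) (auto simp: k r)
  then show ?thesis by (simp add: k t_def)
qed

lemma sa_square_add_eq_0:
  fixes a b :: "'a::{cstar_algebra, real_normed_algebra_1}"
  assumes "sa_square a" "sa_square b" "a + b = 0"
  shows "a = 0"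
  using sa_square_norm_mono[OF assms(1,2)] assms(3) by simp

lemma sa_square_square: "star k = k \<Longrightarrow> sa_square (k * k)"
  unfolding sa_square_def by blast

lemma sa_square_scaleR:
  fixes a :: "'a::{cstar_algebra, real_normed_algebra_1}"
  assumes "sa_square a" "0 \<le> r"
  shows "sa_square (r *\<^sub>R a)"
proof -
  obtain k where "star k = k" "a = k * k" using assms(1) by (auto simp: sa_square_def)
  then show ?thesis using assms(2) unfolding sa_square_def
    by (intro exI[of _ "sqrt r *\<^sub>R k"]) (simp add: star_scaleR)
qed

text \<open>If \<open>- c\<^sup>*c = k\<^sup>2\<close>, then for \<open>d = c k\<close> both \<open>- d\<^sup>*d\<close> and \<open>- d d\<^sup>*\<close> are squares, whereas
  \<open>d\<^sup>*d + d d\<^sup>*\<close> is twice the sum of the squares of the real and imaginary parts of \<open>d\<close>.\<close>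

lemma eq_0_if_minus_sa_square:
  fixes c :: "'a::{cstar_algebra, real_normed_algebra_1}"
  assumes "sa_square (- (star c * c))"
  shows "c = 0"
proof -
  obtain k where k: "star k = k" "- (star c * c) = k * k" using assms by (auto simp: sa_square_def)
  \<comment> \<open>A spectral proof would compare the spectra of \<open>star c * c\<close> and
    \<open>c * star c\<close>. Passing to \<open>d\<close> instead makes both
    \<open>- (star d * d) = w * w\<close> and \<open>- (d * star d) = v * v\<close> explicit
    squares.\<close>
  define d where "d = c * k"
  define w where "w = k * k"
  define v where "v = c * star c"
  have w: "star c * c = - w" unfolding w_def k(2)[symmetric] by simp
  have "star d * d = k * (star c * c) * k" by (simp add: d_def star_mult k(1) mult.assoc)
  then have 1: "star d * d = - (w * w)" unfolding w by (simp add: w_def mult.assoc)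
  have "d * star d = c * w * star c" by (simp add: d_def star_mult k(1) w_def mult.assoc)
  also have "w = - (star c * c)" by (simp add: w)
  finally have 2: "d * star d = - (v * v)" by (simp add: v_def mult.assoc)
  have sv: "star v = v" and sw: "star w = w" by (auto simp: v_def w_def star_mult star_star k(1))
  define x where "x = d + star d"
  define y where "y = \<i> *\<^sub>C (d - star d)"
  have sx: "star x = x" and sy: "star y = y"
    by (simp_all add: x_def y_def star_add star_diff star_star star_scaleC scaleC_diff_right)
  have "x * x + y * y = (star d * d + d * star d) + (star d * d + d * star d)"
    by (simp add: x_def y_def ring_distribs mult_scaleC_left mult_scaleC_right scaleC_scaleC
        scaleC_add_right scaleC_diff_right)
  \<comment> \<open>By the identities 1 and 2, \<open>x * x + y * y\<close> equals
    \<open>-2 (w^2 + v^2)\<close>. The squares are grouped so that one \<open>w * w\<close> is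
    singled out and vanishes by \<open>sa_square_add_eq_0\<close>.\<close>
  then have "w * w + ((v * v + (w * w + v * v)) + (x * x + y * y)) = 0" by (simp add: 1 2)
  then have "w * w = 0"
    by (rule sa_square_add_eq_0[rotated 2]) (auto intro!: sa_square_add sa_square_square simp: sv sw sx
        sy)
  then have "w = 0" using norm_square_self_adjoint[OF sw] by simp
  then show ?thesis using w cstar_identity[of c] by simp
qed

text \<open>Apply the previous lemma to \<open>c = b (r - h)\<close>, where \<open>h = b\<^sup>*b\<close> and \<open>r = \<bar>h\<bar>\<close>, to get \<open>h = \<bar>h\<bar>\<close>.\<close>

lemma sa_square_star_mult_self:
  fixes b :: "'a::{cstar_algebra, real_normed_algebra_1}"
  shows "sa_square (star b * b)"
proof -
  define h where "h = star b * b"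
  have sh: "star h = h" by (simp add: h_def star_mult star_star)
  obtain r where r: "star r = r" "r * r = h * h" "\<And>c. c * (h * h) = (h * h) * c \<Longrightarrow> c * r =
      r * c" "sa_square r"
    using sa_square_commuting_root[OF sa_square_square[OF sh]] by blast
  obtain q where q: "star q = q" "q * q = r" "\<And>c. c * r = r * c \<Longrightarrow> c * q = q * c"
    using sa_square_commuting_root[OF r(4)] by blast
  have hr: "h * r = r * h" by (rule r(3)) (simp add: mult.assoc)
  have hq: "h * q = q * h" by (rule q(3)) (rule hr)
  have rq: "r * q = q * r" by (simp flip: q(2) add: mult.assoc)
  \<comment> \<open>\<open>m\<close> is twice the negative part of \<open>h\<close>, to be shown
    zero. Since \<open>h m = - r m\<close> and \<open>r = q^2\<close>, one gets
    \<open>m h m = - (q m)^2\<close>; the left side is the inner square of \<open>b m\<close>, so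
    the preceding lemma forces \<open>b m = 0\<close>.\<close>
  define m where "m = r - h"
  have sm: "star m = m" by (simp add: m_def star_diff r sh)
  have mq: "m * q = q * m" by (simp add: m_def algebra_simps hq rq)
  have mm: "m * m = 2 *\<^sub>R (r * m)" by (simp add: m_def algebra_simps hr r(2) scaleR_2)
  have hm: "h * m = - (r * m)" by (simp add: m_def algebra_simps hr r(2))
  have "star (b * m) * (b * m) = m * (h * m)" by (simp add: star_mult sm h_def mult.assoc)
  also have "\<dots> = - ((q * m) * (q * m))" unfolding hm by (simp flip: q(2) mq add: mult.assoc)
  finally have "- (star (b * m) * (b * m)) = (q * m) * (q * m)" by simp
  moreover have sqm: "star (q * m) = q * m" by (simp add: star_mult sm q(1) mq)
  ultimately have "b * m = 0" by (intro eq_0_if_minus_sa_square) (simp add: sa_square_square)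
  then have "(q * m) * (q * m) = 0" using \<open>- (star (b * m) * (b * m)) = (q * m) * (q * m)\<close> by simp
  then have "q * m = 0" using norm_square_self_adjoint[OF sqm] by simp
  then have "r * m = 0" by (simp flip: q(2) add: mult.assoc)
  then have "m = 0" using mm norm_square_self_adjoint[OF sm] by simp
  then show ?thesis using r(4) by (simp add: m_def h_def)
qed

text \<open>If a square in the unitization has scalar part 0, so does its root: the root already
  lies in the ideal \<open>'a\<close>. This transfers the cone of the unital case to
  \<open>'a\<close>.\<close>

lemma cstar_positive_iff_sa_square:
  fixes a :: "'a::cstar_algebra"
  shows "cstar_positive a \<longleftrightarrow> sa_square (Unitize 0 a)"
proof
  assume "cstar_positive a"
  then obtain b where b: "a = star b * b" by (auto simp: cstar_positive_def)
  have "Unitize 0 a = star (Unitize 0 b) * Unitize 0 b"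
    by (simp add: star_unitization_def times_unitization_def b)
  then show "sa_square (Unitize 0 a)" using sa_square_star_mult_self by metis
next
  assume "sa_square (Unitize 0 a)"
  then obtain k where k: "star k = k" "Unitize 0 a = k * k" by (auto simp: sa_square_def)
  then have "uscalar k = 0" by (metis mult_eq_0_iff umult_simps(3) unitization.sel(1))
  then have "a = star (uelem k) * uelem k" using k by (metis add_0 scaleC_zero_left umult_simps(4)
      unitization.sel(2) uscaleC_simps(4))
  then show "cstar_positive a" by (auto simp: cstar_positive_def)
qed

lemma norm_Unitize_0: "norm (Unitize 0 a) = norm (a :: 'a::cstar_algebra)"
proof (rule antisym)
  show "norm (Unitize 0 a) \<le> norm a" using norm_unitization_le[of "Unitize 0 a"] by simp
  have "(norm a)\<^sup>2 = norm (uact (Unitize 0 a) (star a))"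
    using cstar_identity[of "star a"] by (simp add: star_star uact_def)
  also have "\<dots> \<le> norm (Unitize 0 a) * norm a" using norm_uact[of "Unitize 0 a" "star a"] by simp
  finally show "norm a \<le> norm (Unitize 0 a)" by (cases "norm a = 0") (auto simp: power2_eq_square)
qed

lemma Unitize_0_add: "Unitize 0 (a + b) = Unitize 0 a + Unitize 0 b"
  by (simp add: plus_unitization_def)

lemma cstar_positive_0: "cstar_positive 0"
  unfolding cstar_positive_def by (rule exI[of _ 0]) simp

lemma cstar_positive_star_mult_self: "cstar_positive (star b * b)"
  unfolding cstar_positive_def by blast

lemma cstar_positive_add: "cstar_positive a \<Longrightarrow> cstar_positive b \<Longrightarrow> cstar_positive (a + b)"
  unfolding cstar_positive_iff_sa_square Unitize_0_add by (rule sa_square_add)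

lemma cstar_positive_sum: "(\<And>i. i \<in> I \<Longrightarrow> cstar_positive (f i)) \<Longrightarrow> cstar_positive (\<Sum>i\<in>I. f i)"
  by (induction I rule: infinite_finite_induct) (auto simp: cstar_positive_0 cstar_positive_add)

lemma cstar_positive_scaleR: "cstar_positive a \<Longrightarrow> 0 \<le> r \<Longrightarrow> cstar_positive (r *\<^sub>R a)"
  unfolding cstar_positive_def
  by (elim exE) (rule_tac x = "sqrt r *\<^sub>R b" in exI, simp add: star_scaleR)

lemma cstar_positive_closed:
  fixes X :: "nat \<Rightarrow> 'a::cstar_algebra"
  assumes "\<And>n. cstar_positive (X n)" "X \<longlonglongrightarrow> a"
  shows "cstar_positive a"
  unfolding cstar_positive_iff_sa_square
proof (rule sa_square_closed)
  show "sa_square (Unitize 0 (X n))" for n using assms(1) by (simp add: cstar_positive_iff_sa_square)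
  have "norm (Unitize 0 (X n) - Unitize 0 a) = norm (X n - a)" for n
    by (simp add: minus_unitization_def norm_Unitize_0)
  then show "(\<lambda>n. Unitize 0 (X n)) \<longlonglongrightarrow> Unitize 0 a"
    using assms(2) by (subst (asm) tendsto_dist_iff, subst tendsto_dist_iff) (simp add: dist_norm)
qed

lemma cstar_positive_norm_mono:
  "cstar_positive a \<Longrightarrow> cstar_positive b \<Longrightarrow> norm a \<le> norm (a + b)"
  using sa_square_norm_mono[of "Unitize 0 a" "Unitize 0 b"]
  by (simp add: cstar_positive_iff_sa_square norm_Unitize_0 flip: Unitize_0_add)

text \<open>For the root \<open>k\<close> belonging to \<open>a / t\<close>, the inner square of
  \<open>b - k b\<close>, that is of \<open>(1 - k) b\<close> written without a unit, is
  \<open>b* b - b* a b / t\<close>.\<close>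

lemma cstar_positive_conjugate_diff:
  assumes sa: "star a = a" and le: "norm a \<le> t"
  shows "cstar_positive (t *\<^sub>R (star b * b) - star b * a * b)"
proof (cases "t = 0")
  case True
  then show ?thesis using le by (simp add: cstar_positive_0)
next
  case False
  then have t: "t > 0" using le norm_ge_zero[of a] by linarith
  have "star (inverse t *\<^sub>R a) = inverse t *\<^sub>R a" "norm (inverse t *\<^sub>R a) \<le> 1"
    using sa le t by (auto simp: star_scaleR field_simps)
  then obtain k where k: "star k = k" "k + k - k * k = inverse t *\<^sub>R a"
    by (rule self_adjoint_root) blast
  have "star (b - k * b) * (b - k * b) = star b * b - star b * (k + k - k * k) * b"
    by (simp add: star_diff star_mult k(1) algebra_simps)
  also have "\<dots> = star b * b - inverse t *\<^sub>R (star b * a * b)" by (simp add: k(2))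
  finally have "t *\<^sub>R (star (b - k * b) * (b - k * b)) = t *\<^sub>R (star b * b) - star b * a * b"
    using t by (simp add: scaleR_diff_right)
  then show ?thesis
    using cstar_positive_scaleR[OF cstar_positive_star_mult_self, of t "b - k * b"] t by simp
qed

section \<open>Pre-Hilbert modules\<close>

text \<open>Definiteness and completeness are left out so that the algebraic tensor product
  qualifies. \<open>scale_zero\<close> takes the place of the existence of negatives, which it
  yields through \<open>-1\<close>.\<close>

locale pre_hilbert_module =
  fixes E :: "('b::cstar_algebra, 'e) hmod"
  assumes zero_closed [simp]: "hzero E \<in> hcarrier E"
    and add_closed [simp]: "\<lbrakk>x \<in> hcarrier E; y \<in> hcarrier E\<rbrakk> \<Longrightarrow> hadd E x y \<in> hcarrier E"
    and scale_closed [simp]: "x \<in> hcarrier E \<Longrightarrow> hscale E c x \<in> hcarrier E"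
    and act_closed [simp]: "x \<in> hcarrier E \<Longrightarrow> hact E x b \<in> hcarrier E"
    and add_assoc: "\<lbrakk>x \<in> hcarrier E; y \<in> hcarrier E; z \<in> hcarrier E\<rbrakk>
      \<Longrightarrow> hadd E (hadd E x y) z = hadd E x (hadd E y z)"
    and add_comm: "\<lbrakk>x \<in> hcarrier E; y \<in> hcarrier E\<rbrakk> \<Longrightarrow> hadd E x y = hadd E y x"
    and add_zero: "x \<in> hcarrier E \<Longrightarrow> hadd E x (hzero E) = x"
    and scale_zero: "x \<in> hcarrier E \<Longrightarrow> hscale E 0 x = hzero E"
    and scale_add_right: "\<lbrakk>x \<in> hcarrier E; y \<in> hcarrier E\<rbrakk>
      \<Longrightarrow> hscale E c (hadd E x y) = hadd E (hscale E c x) (hscale E c y)"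
    and scale_add_left: "x \<in> hcarrier E
      \<Longrightarrow> hscale E (c + d) x = hadd E (hscale E c x) (hscale E d x)"
    and scale_scale: "x \<in> hcarrier E \<Longrightarrow> hscale E c (hscale E d x) = hscale E (c * d) x"
    and scale_one: "x \<in> hcarrier E \<Longrightarrow> hscale E 1 x = x"
    and act_add_left: "\<lbrakk>x \<in> hcarrier E; y \<in> hcarrier E\<rbrakk>
      \<Longrightarrow> hact E (hadd E x y) b = hadd E (hact E x b) (hact E y b)"
    and act_add_right: "x \<in> hcarrier E
      \<Longrightarrow> hact E x (b + b') = hadd E (hact E x b) (hact E x b')"
    and act_act: "x \<in> hcarrier E \<Longrightarrow> hact E (hact E x b) b' = hact E x (b * b')"
    and act_scale_left: "x \<in> hcarrier E \<Longrightarrow> hact E (hscale E c x) b = hscale E c (hact E x b)"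
    and act_scale_right: "x \<in> hcarrier E \<Longrightarrow> hact E x (c *\<^sub>C b) = hscale E c (hact E x b)"
    and inner_add: "\<lbrakk>x \<in> hcarrier E; y \<in> hcarrier E; z \<in> hcarrier E\<rbrakk>
      \<Longrightarrow> hinner E x (hadd E y z) = hinner E x y + hinner E x z"
    and inner_scale: "\<lbrakk>x \<in> hcarrier E; y \<in> hcarrier E\<rbrakk>
      \<Longrightarrow> hinner E x (hscale E c y) = c *\<^sub>C hinner E x y"
    and inner_act: "\<lbrakk>x \<in> hcarrier E; y \<in> hcarrier E\<rbrakk>
      \<Longrightarrow> hinner E x (hact E y b) = hinner E x y * b"
    and inner_star: "\<lbrakk>x \<in> hcarrier E; y \<in> hcarrier E\<rbrakk> \<Longrightarrow> star (hinner E x y) = hinner E y x"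
    and inner_positive: "x \<in> hcarrier E \<Longrightarrow> cstar_positive (hinner E x x)"
begin

lemma diff_closed [simp]: "x \<in> hcarrier E \<Longrightarrow> y \<in> hcarrier E \<Longrightarrow> hdiff E x y \<in> hcarrier E"
  by (simp add: hdiff_def)

lemma hsum_closed: "(\<And>i. i < n \<Longrightarrow> f i \<in> hcarrier E) \<Longrightarrow> hsum E f n \<in> hcarrier E"
  by (induction n) auto

lemma inner_add_left: "\<lbrakk>x \<in> hcarrier E; y \<in> hcarrier E; z \<in> hcarrier E\<rbrakk>
      \<Longrightarrow> hinner E (hadd E x y) z = hinner E x z + hinner E y z"
  using inner_star[of z "hadd E x y"] by (simp add: inner_add star_add inner_star)

lemma inner_scale_left: "\<lbrakk>x \<in> hcarrier E; y \<in> hcarrier E\<rbrakk>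
      \<Longrightarrow> hinner E (hscale E c x) y = cnj c *\<^sub>C hinner E x y"
  using inner_star[of y "hscale E c x"] by (simp add: inner_scale star_scaleC inner_star)

lemma inner_act_left: "\<lbrakk>x \<in> hcarrier E; y \<in> hcarrier E\<rbrakk>
      \<Longrightarrow> hinner E (hact E x b) y = star b * hinner E x y"
  using inner_star[of y "hact E x b"] by (simp add: inner_act star_mult inner_star)

lemma inner_zero [simp]: "x \<in> hcarrier E \<Longrightarrow> hinner E x (hzero E) = 0"
  using inner_add[of x "hzero E" "hzero E"] by (simp add: add_zero)

lemma inner_zero_left [simp]: "x \<in> hcarrier E \<Longrightarrow> hinner E (hzero E) x = 0"
  using inner_star[of x "hzero E"] by simp

lemma inner_diff: "\<lbrakk>x \<in> hcarrier E; y \<in> hcarrier E; z \<in> hcarrier E\<rbrakk>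
      \<Longrightarrow> hinner E x (hdiff E y z) = hinner E x y - hinner E x z"
  by (simp add: hdiff_def inner_add inner_scale)

lemma inner_diff_left: "\<lbrakk>x \<in> hcarrier E; y \<in> hcarrier E; z \<in> hcarrier E\<rbrakk>
      \<Longrightarrow> hinner E (hdiff E y z) x = hinner E y x - hinner E z x"
  by (simp add: hdiff_def inner_add_left inner_scale_left)

lemmas inner_simps = inner_add inner_scale inner_act inner_diff
  inner_add_left inner_scale_left inner_act_left inner_diff_left

lemma hnorm_nonneg [simp]: "0 \<le> hnorm E x"
  by (simp add: hnorm_def)

lemma hnorm_square: "(hnorm E x)\<^sup>2 = norm (hinner E x x)"
  by (simp add: hnorm_def)

lemma hnorm_zero [simp]: "hnorm E (hzero E) = 0"
  by (simp add: hnorm_def)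

text \<open>Positivity of the inner square of \<open>y - x <x,y> / t\<close>, with
  \<open>cstar_positive_conjugate_diff\<close> controlling the quadratic term. The free parameter
  \<open>t > 0\<close> also covers null vectors \<open>x\<close>, by letting \<open>t\<close> tend
  to 0.\<close>

lemma norm_inner_square_le:
  assumes x: "x \<in> hcarrier E" and y: "y \<in> hcarrier E" and t: "t > 0" "norm (hinner E x x) \<le> t"
  shows "(norm (hinner E x y))\<^sup>2 \<le> t * norm (hinner E y y)"
proof -
  let ?b = "hinner E x y"
  let ?z = "hdiff E y (hact E x (inverse t *\<^sub>R ?b))"
  have [simp]: "hinner E y x = star ?b" using inner_star[OF x y] by simp
  have "hinner E ?z ?z = hinner E y y - inverse t *\<^sub>R (star ?b * ?b)
      - inverse t *\<^sub>R (inverse t *\<^sub>R (t *\<^sub>R (star ?b * ?b) - star ?b * hinner E x x * ?b))"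
    using x y t(1) by (simp add: inner_simps star_scaleR mult.assoc algebra_simps)
  then have eq: "inverse t *\<^sub>R (star ?b * ?b) + (hinner E ?z ?z
      + inverse t *\<^sub>R (inverse t *\<^sub>R (t *\<^sub>R (star ?b * ?b) - star ?b * hinner E x x * ?b))) =
          hinner E y y"
    by simp
  have "norm (inverse t *\<^sub>R (star ?b * ?b)) \<le> norm (hinner E y y)"
    unfolding eq[symmetric] using x y t
    by (intro cstar_positive_norm_mono cstar_positive_add cstar_positive_scaleR
        cstar_positive_star_mult_self
        cstar_positive_conjugate_diff inner_positive inner_star diff_closed act_closed) auto
  then have "inverse t * (norm ?b)\<^sup>2 \<le> norm (hinner E y y)" using t(1) by (simp add: cstar_identity)
  then have "t * (inverse t * (norm ?b)\<^sup>2) \<le> t * norm (hinner E y y)" using t(1)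
      by (intro mult_left_mono) auto
  then show ?thesis using t(1) by (simp flip: mult.assoc)
qed

lemma cauchy_schwarz:
  assumes x: "x \<in> hcarrier E" and y: "y \<in> hcarrier E"
  shows "norm (hinner E x y) \<le> hnorm E x * hnorm E y"
proof -
  let ?N = "norm (hinner E y y)"
  have "(norm (hinner E x y))\<^sup>2 \<le> norm (hinner E x x) * ?N"
  proof (cases "norm (hinner E x x) > 0")
    case True then show ?thesis by (rule norm_inner_square_le[OF x y]) simp
  next
    case False
    then have 0: "norm (hinner E x x) = 0" by simp
    have e: "(norm (hinner E x y))\<^sup>2 \<le> 0 + e" if "e > 0" for e
    proof -
      \<comment> \<open>The value \<open>t = e / (?N + 1)\<close> makes \<open>t * ?N\<close> at
        most \<open>e\<close>, also when \<open>?N = 0\<close>.\<close>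
      have "(norm (hinner E x y))\<^sup>2 \<le> e / (?N + 1) * ?N"
        using that by (intro norm_inner_square_le[OF x y]) (auto simp: 0 intro!: divide_pos_pos
            add_nonneg_pos)
      also have "\<dots> = e * (?N / (?N + 1))" by simp
      also have "\<dots> \<le> e" using that norm_ge_zero[of "hinner E y y"]
        by (intro mult_left_le) (auto simp: divide_le_eq_1 simp del: norm_ge_zero)
      finally show ?thesis by simp
    qed
    have "(norm (hinner E x y))\<^sup>2 \<le> 0" by (rule field_le_epsilon) (rule e)
    then show ?thesis by simp
  qed
  then show ?thesis unfolding hnorm_def by (metis real_le_rsqrt real_sqrt_mult)
qed

lemma hnorm_add:
  assumes x: "x \<in> hcarrier E" and y: "y \<in> hcarrier E"
  shows "hnorm E (hadd E x y) \<le> hnorm E x + hnorm E y"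
proof -
  have "norm (hinner E (hadd E x y) (hadd E x y)) =
      norm ((hinner E x x + hinner E x y) + (hinner E y x + hinner E y y))"
    using x y by (simp add: inner_simps algebra_simps)
  also have "\<dots> \<le> ((hnorm E x)\<^sup>2 + hnorm E x * hnorm E y) + (hnorm E y * hnorm E x + (hnorm E y)\<^sup>2)"
    using cauchy_schwarz[OF x y] cauchy_schwarz[OF y x] by (intro norm_triangle_mono) (auto simp:
        hnorm_square)
  also have "\<dots> = (hnorm E x + hnorm E y)\<^sup>2" by (simp add: power2_eq_square algebra_simps)
  finally show ?thesis unfolding hnorm_square[symmetric] by (rule power2_le_imp_le) simp
qed

lemma hnorm_scale: "x \<in> hcarrier E \<Longrightarrow> hnorm E (hscale E c x) = cmod c * hnorm E x"
  by (simp add: hnorm_def inner_simps scaleC_scaleC norm_scaleC real_sqrt_mult norm_mult flip: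
      power2_eq_square)

lemma hnorm_cong: "hinner E x x = hinner E y y \<Longrightarrow> hnorm E x = hnorm E y"
  by (simp add: hnorm_def)

lemma hnorm_diff_commute: "x \<in> hcarrier E \<Longrightarrow> y \<in> hcarrier E \<Longrightarrow> hnorm E (hdiff E x y) =
    hnorm E (hdiff E y x)"
  by (rule hnorm_cong) (simp add: inner_simps)

lemma hnorm_diff_triangle:
  assumes "x \<in> hcarrier E" "y \<in> hcarrier E" "z \<in> hcarrier E"
  shows "hnorm E (hdiff E x z) \<le> hnorm E (hdiff E x y) + hnorm E (hdiff E y z)"
proof -
  have "hnorm E (hdiff E x z) = hnorm E (hadd E (hdiff E x y) (hdiff E y z))"
    using assms by (intro hnorm_cong) (simp add: inner_simps)
  also have "\<dots> \<le> hnorm E (hdiff E x y) + hnorm E (hdiff E y z)" using assms by (intro hnorm_add) auto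
  finally show ?thesis .
qed

lemma hnorm_diff_self [simp]: "x \<in> hcarrier E \<Longrightarrow> hnorm E (hdiff E x x) = 0"
  by (simp add: hnorm_def inner_simps)

lemma hnorm_le_add_diff:
  assumes "x \<in> hcarrier E" "y \<in> hcarrier E"
  shows "hnorm E x \<le> hnorm E y + hnorm E (hdiff E x y)"
proof -
  have "hnorm E x = hnorm E (hadd E y (hdiff E x y))"
    using assms by (intro hnorm_cong) (simp add: inner_simps)
  also have "\<dots> \<le> hnorm E y + hnorm E (hdiff E x y)" using assms by (intro hnorm_add) auto
  finally show ?thesis .
qed

lemma hnorm_diff_add:
  assumes "x \<in> hcarrier E" "y \<in> hcarrier E" "x' \<in> hcarrier E" "y' \<in> hcarrier E"
  shows "hnorm E (hdiff E (hadd E x y) (hadd E x' y')) \<le> hnorm E (hdiff E x x') + hnorm E (hdiff E y y')"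
proof -
  have "hnorm E (hdiff E (hadd E x y) (hadd E x' y')) = hnorm E (hadd E (hdiff E x x') (hdiff E y y'))"
    using assms by (intro hnorm_cong) (simp add: inner_simps)
  also have "\<dots> \<le> hnorm E (hdiff E x x') + hnorm E (hdiff E y y')" using assms by (intro hnorm_add) auto
  finally show ?thesis .
qed

lemma hnorm_diff_scale:
  assumes "x \<in> hcarrier E" "y \<in> hcarrier E"
  shows "hnorm E (hdiff E (hscale E c x) (hscale E c y)) = cmod c * hnorm E (hdiff E x y)"
proof -
  have "hnorm E (hdiff E (hscale E c x) (hscale E c y)) = hnorm E (hscale E c (hdiff E x y))"
    using assms by (intro hnorm_cong) (simp add: inner_simps scaleC_diff_right)
  then show ?thesis using assms by (simp add: hnorm_scale)
qed

lemma hnorm_act: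
  assumes "x \<in> hcarrier E"
  shows "hnorm E (hact E x b) \<le> hnorm E x * norm b"
proof -
  have "(hnorm E (hact E x b))\<^sup>2 = norm (star b * hinner E x x * b)"
    using assms by (simp add: hnorm_square inner_simps mult.assoc)
  also have "\<dots> \<le> norm b * norm (hinner E x x) * norm b"
    by (rule order_trans[OF norm_mult_ineq]) (auto intro!: mult_right_mono order_trans[OF
        norm_mult_ineq])
  also have "\<dots> = (hnorm E x * norm b)\<^sup>2" by (simp add: power_mult_distrib hnorm_square) (simp add:
      power2_eq_square)
  finally show ?thesis by (rule power2_le_imp_le) simp
qed

lemma hnorm_diff_act:
  assumes "x \<in> hcarrier E" "y \<in> hcarrier E"
  shows "hnorm E (hdiff E (hact E x b) (hact E y b)) \<le> hnorm E (hdiff E x y) * norm b"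
proof -
  have "hnorm E (hdiff E (hact E x b) (hact E y b)) = hnorm E (hact E (hdiff E x y) b)"
    using assms by (intro hnorm_cong) (simp add: inner_simps algebra_simps)
  then show ?thesis using assms by (simp add: hnorm_act)
qed

lemma norm_inner_diff:
  assumes "x \<in> hcarrier E" "y \<in> hcarrier E" "x' \<in> hcarrier E" "y' \<in> hcarrier E"
  shows "norm (hinner E x y - hinner E x' y')
     \<le> hnorm E (hdiff E x x') * hnorm E y + hnorm E x' * hnorm E (hdiff E y y')"
proof -
  have "hinner E x y - hinner E x' y' = hinner E (hdiff E x x') y + hinner E x' (hdiff E y y')"
    using assms by (simp add: inner_simps)
  then show ?thesis using assms by (auto intro!: norm_triangle_mono cauchy_schwarz)
qed

text \<open>Iterating \<open>\<parallel>R\<^sup>n x\<parallel>\<^sup>2 = \<parallel>\<langle>x, R\<^sup>2\<^sup>n x\<rangle>\<parallel> \<le> \<parallel>x\<parallel> \<parallel>R\<^sup>2\<^sup>n x\<parallel>\<close> turns a growth rate of the orbit of \<open>x\<close>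
  into a norm bound, without any functional calculus for \<open>R\<close>.\<close>

lemma symmetric_orbit_bound:
  assumes closed: "\<And>x. x \<in> hcarrier E \<Longrightarrow> R x \<in> hcarrier E"
    and sym: "\<And>x y. x \<in> hcarrier E \<Longrightarrow> y \<in> hcarrier E \<Longrightarrow> hinner E (R x) y = hinner E x (R y)"
    and x: "x \<in> hcarrier E"
    and growth: "\<And>n. hnorm E ((R ^^ n) x) \<le> C * L ^ n" and L: "L \<ge> 0"
  shows "hnorm E (R x) \<le> L * hnorm E x"
proof -
  have pc: "(R ^^ n) y \<in> hcarrier E" if "y \<in> hcarrier E" for n y
    using that by (induction n) (auto intro: closed)
  have psym: "hinner E ((R ^^ n) y) z = hinner E y ((R ^^ n) z)" if "y \<in> hcarrier E" "z \<in> hcarrier E"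
      for n y z
    using that
  proof (induction n arbitrary: z)
    case (Suc n)
    then show ?case by (simp add: sym pc closed) (simp add: funpow_swap1)
  qed simp
  define c where "c n = hnorm E ((R ^^ (2 ^ n)) x)" for n
  have c_nonneg: "c n \<ge> 0" for n by (simp add: c_def)
  have step: "(c n)\<^sup>2 \<le> hnorm E x * c (Suc n)" for n
  proof -
    have "(c n)\<^sup>2 = norm (hinner E x ((R ^^ (2 ^ n)) ((R ^^ (2 ^ n)) x)))"
      by (simp add: c_def hnorm_square psym pc x)
    also have "(R ^^ (2 ^ n)) ((R ^^ (2 ^ n)) x) = (R ^^ (2 ^ Suc n)) x"
      by (simp add: mult_2 funpow_add)
    finally show ?thesis using cauchy_schwarz[OF x pc[OF x]] by (simp add: c_def)
  qed
  show ?thesis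
  proof (rule ccontr)
    assume "\<not> ?thesis"
    then have gt: "c 0 > L * hnorm E x" by (simp add: c_def)
    have pos: "hnorm E x > 0"
    proof (rule ccontr)
      assume "\<not> hnorm E x > 0"
      then have "hnorm E x = 0" using hnorm_nonneg[of x] by linarith
      then show False using step[of 0] gt by simp
    qed
    \<comment> \<open>After this normalization \<open>step\<close> reads
      \<open>d n ^ 2 <= d (Suc n)\<close>, so
      \<open>d 0 ^ (2 ^ n) <= d n <= C / hnorm E x * L ^ (2 ^ n)\<close>. With
      \<open>d 0 > L\<close> this fails for large \<open>n\<close>, whatever \<open>C\<close> is;
      only the rate \<open>L\<close> survives.\<close>
    define d where "d n = c n / hnorm E x" for n
    have dstep: "(d n)\<^sup>2 \<le> d (Suc n)" for n
      using step[of n] pos by (simp add: d_def power2_eq_square field_simps)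
    have d_nonneg: "d n \<ge> 0" for n using pos c_nonneg by (simp add: d_def)
    have dpow: "d 0 ^ (2 ^ n) \<le> d n" for n
    proof (induction n)
      case (Suc n)
      have "d 0 ^ (2 ^ Suc n) = (d 0 ^ (2 ^ n))\<^sup>2" by (simp add: power2_eq_square mult_2 power_add)
      also have "\<dots> \<le> (d n)\<^sup>2" using Suc d_nonneg by (intro power_mono) auto
      also have "\<dots> \<le> d (Suc n)" by (rule dstep)
      finally show ?case .
    qed simp
    have gt': "d 0 > L" using gt pos by (simp add: d_def field_simps)
    then have d0: "d 0 > 0" using L by simp
    have lim: "(\<lambda>n. C / hnorm E x * (L / d 0) ^ (2 ^ n)) \<longlonglongrightarrow> C / hnorm E x * 0"
    proof (intro tendsto_intros)
      have "(\<lambda>n. (L / d 0) ^ n) \<longlonglongrightarrow> 0" using gt' L d0 by (intro LIMSEQ_realpow_zero) auto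
      then have "((\<lambda>n. (L / d 0) ^ n) \<circ> (\<lambda>n. 2 ^ n)) \<longlonglongrightarrow> 0"
        by (rule LIMSEQ_subseq_LIMSEQ) (auto intro: strict_monoI)
      then show "(\<lambda>n. (L / d 0) ^ (2 ^ n)) \<longlonglongrightarrow> 0" by (simp add: comp_def)
    qed
    have "1 \<le> C / hnorm E x * (L / d 0) ^ (2 ^ n)" for n
    proof -
      have "d 0 ^ (2 ^ n) \<le> C * L ^ (2 ^ n) / hnorm E x"
        using order_trans[OF dpow[of n, unfolded d_def[of n] c_def[of n]] divide_right_mono[OF growth[of
            "2 ^ n"]]] by simp
      then show ?thesis using d0 pos by (simp add: power_divide pos_le_divide_eq mult.commute)
    qed
    then have "1 \<le> C / hnorm E x * 0" by (intro LIMSEQ_le_const[OF lim]) auto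
    then show False by simp
  qed
qed

end

lemma hilbert_module_pre:
  assumes "hilbert_module E"
  shows "pre_hilbert_module E"
proof -
  interpret hilbert_module E by fact
  have scale_zero: "hscale E 0 x = hzero E" if x: "x \<in> hcarrier E" for x
  proof -
    let ?z = "hscale E 0 x"
    have zz: "hadd E ?z ?z = ?z" using scale_add_left[OF x, of 0 0] by simp
    obtain w where w: "w \<in> hcarrier E" "hadd E ?z w = hzero E" using add_inverse[OF scale_closed[OF x]]
        by blast
    have "?z = hadd E ?z (hadd E ?z w)" using w x by (simp add: add_zero scale_closed)
    also have "\<dots> = hadd E (hadd E ?z ?z) w" using w x by (simp add: add_assoc scale_closed)
    finally show ?thesis unfolding zz w(2) .
  qed
  show ?thesis
    by unfold_locales
      (assumption | rule zero_closed add_closed scale_closed act_closed add_assoc add_comm add_zero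
        scale_zero scale_add_right scale_add_left scale_scale scale_one act_add_left act_add_right
            act_act
        act_scale_left act_scale_right inner_add inner_scale inner_act inner_star inner_positive)+
qed

lemma hilbert_module_if_pre:
  assumes "pre_hilbert_module E"
    and definite: "\<And>x. x \<in> hcarrier E \<Longrightarrow> hinner E x x = 0 \<Longrightarrow> x = hzero E"
    and complete: "\<And>X. hCauchy E X \<Longrightarrow> \<exists>x\<in>hcarrier E. (\<lambda>n. hnorm E (hdiff E (X n) x)) \<longlonglongrightarrow> 0"
  shows "hilbert_module E"
proof -
  interpret pre_hilbert_module E by fact
  have inv: "\<exists>y\<in>hcarrier E. hadd E x y = hzero E" if "x \<in> hcarrier E" for x
    using scale_add_left[OF that, of 1 "-1"] scale_closed[OF that, of "-1"]
        by (auto simp: scale_zero that scale_one)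
  show ?thesis
    by unfold_locales
      (assumption | rule zero_closed add_closed scale_closed act_closed add_assoc add_comm add_zero inv
        scale_add_right scale_add_left scale_scale scale_one act_add_left act_add_right act_act
        act_scale_left act_scale_right inner_add inner_scale inner_act inner_star inner_positive
        definite complete)+
qed

lemma hilbert_module_eqI:
  assumes "hilbert_module E" "x \<in> hcarrier E" "y \<in> hcarrier E"
    and eq: "\<And>z. z \<in> hcarrier E \<Longrightarrow> hinner E z x = hinner E z y"
  shows "x = y"
proof -
  interpret pre_hilbert_module E by (rule hilbert_module_pre) fact
  have "hinner E (hdiff E x y) (hdiff E x y) = 0" using assms by (simp add: inner_diff)
  then have 0: "hdiff E x y = hzero E" using hilbert_module.inner_definite[OF assms(1)] assms by simp
  have "x = hadd E x (hscale E (-1 + 1) y)" using assms by (simp add: scale_zero add_zero)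
  also have "\<dots> = hadd E (hdiff E x y) y" unfolding hdiff_def
    using assms by (subst scale_add_left) (auto simp: scale_one add_assoc)
  also have "\<dots> = y" unfolding 0 using assms by (subst add_comm) (auto simp: add_zero)
  finally show ?thesis .
qed

section \<open>Completion\<close>

lemma tendsto_0_if_le:
  fixes f g :: "nat \<Rightarrow> real"
  assumes "g \<longlonglongrightarrow> 0" "\<And>n. f n \<le> g n" "\<And>n. 0 \<le> f n"
  shows "f \<longlonglongrightarrow> 0"
  using tendsto_sandwich[OF always_eventually always_eventually tendsto_const assms(1), of f] assms
      by simp

context pre_hilbert_module
begin

lemma hCauchy_closed: "hCauchy E X \<Longrightarrow> X n \<in> hcarrier E"
  by (simp add: hCauchy_def)

lemma hCauchyD:
  assumes "hCauchy E X" "e > 0"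
  obtains N where "\<And>m n. m \<ge> N \<Longrightarrow> n \<ge> N \<Longrightarrow> hnorm E (hdiff E (X m) (X n)) < e"
  using assms unfolding hCauchy_def by meson

lemma hCauchy_const: "x \<in> hcarrier E \<Longrightarrow> hCauchy E (\<lambda>n. x)"
  by (simp add: hCauchy_def)

text \<open>One criterion for binary operations as well as for maps into another module.
  \<open>K\<close> carries no sign condition, which is why \<open>\<bar>K\<bar> + 1\<close> replaces
  it in the proof.\<close>

lemma hCauchy_lipschitz2:
  assumes X: "hCauchy E X" and Y: "hCauchy E Y" and Z: "\<And>n. Z n \<in> hcarrier F"
    and le: "\<And>m n. hnorm F (hdiff F (Z m) (Z n)) \<le> K * (hnorm E (hdiff E (X m) (X n)) + hnorm E (hdiff E
        (Y m) (Y n)))"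
  shows "hCauchy F Z"
  unfolding hCauchy_def
proof (intro conjI allI impI)
  fix e :: real assume "e > 0"
  define d where "d = e / (2 * (\<bar>K\<bar> + 1))"
  have "d > 0" using \<open>e > 0\<close> by (auto simp: d_def)
  obtain M where M: "\<And>m n. m \<ge> M \<Longrightarrow> n \<ge> M \<Longrightarrow> hnorm E (hdiff E (X m) (X n)) < d"
    using hCauchyD[OF X \<open>d > 0\<close>] by blast
  obtain N where N: "\<And>m n. m \<ge> N \<Longrightarrow> n \<ge> N \<Longrightarrow> hnorm E (hdiff E (Y m) (Y n)) < d"
    using hCauchyD[OF Y \<open>d > 0\<close>] by blast
  have "hnorm F (hdiff F (Z m) (Z n)) < e" if "m \<ge> max M N" "n \<ge> max M N" for m n
  proof -
    have s: "hnorm E (hdiff E (X m) (X n)) + hnorm E (hdiff E (Y m) (Y n)) < 2 * d"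
      using M[of m n] N[of m n] that by auto
    have "hnorm F (hdiff F (Z m) (Z n)) \<le> (\<bar>K\<bar> + 1) * (hnorm E (hdiff E (X m) (X n)) + hnorm E (hdiff E
        (Y m) (Y n)))"
      by (rule order_trans[OF le]) (auto intro!: mult_right_mono)
    also have "\<dots> < (\<bar>K\<bar> + 1) * (2 * d)" using s by (intro mult_strict_left_mono) auto
    also have "\<dots> = e"
      using mult.assoc[of 2 "\<bar>K\<bar> + 1" d] by (simp add: d_def add_nonneg_eq_0_iff del:
          distrib_left_numeral)
    finally show ?thesis .
  qed
  then show "\<exists>N. \<forall>m\<ge>N. \<forall>n\<ge>N. hnorm F (hdiff F (Z m) (Z n)) < e" by blast
qed (rule Z)

lemma hCauchy_lipschitz:
  assumes X: "hCauchy E X" and Z: "\<And>n. Z n \<in> hcarrier F"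
    and le: "\<And>m n. hnorm F (hdiff F (Z m) (Z n)) \<le> K * hnorm E (hdiff E (X m) (X n))"
  shows "hCauchy F Z"
  by (rule hCauchy_lipschitz2[OF X X Z, where K = "K / 2"]) (use le in simp)

lemma hCauchy_add: "hCauchy E X \<Longrightarrow> hCauchy E Y \<Longrightarrow> hCauchy E (\<lambda>n. hadd E (X n) (Y n))"
  by (rule hCauchy_lipschitz2[of X Y _ _ 1]) (auto simp: hCauchy_closed intro: hnorm_diff_add)

lemma hCauchy_scale: "hCauchy E X \<Longrightarrow> hCauchy E (\<lambda>n. hscale E c (X n))"
  by (rule hCauchy_lipschitz[where K = "cmod c"]) (auto simp: hnorm_diff_scale hCauchy_closed)

lemma hCauchy_act: "hCauchy E X \<Longrightarrow> hCauchy E (\<lambda>n. hact E (X n) b)"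
  by (rule hCauchy_lipschitz[where K = "norm b"])
    (auto intro: hnorm_diff_act[THEN order_trans] simp: mult.commute hCauchy_closed)

lemma hCauchy_bounded:
  assumes "hCauchy E X"
  obtains B where "\<And>n. hnorm E (X n) \<le> B"
proof -
  obtain N where N: "\<And>m n. m \<ge> N \<Longrightarrow> n \<ge> N \<Longrightarrow> hnorm E (hdiff E (X m) (X n)) < 1"
    using hCauchyD[OF assms zero_less_one] by blast
  have 1: "hnorm E (X n) \<le> hnorm E (X N) + 1" if "n \<ge> N" for n
    using hnorm_le_add_diff[of "X n" "X N"] N[OF that order_refl] hCauchy_closed[OF assms]
    by (smt (verit))
  have 2: "hnorm E (X n) \<le> (\<Sum>i<N. hnorm E (X i))" if "n < N" for n
    using that by (intro member_le_sum) auto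
  have "0 \<le> (\<Sum>i<N. hnorm E (X i))" by (intro sum_nonneg) auto
  then have "hnorm E (X n) \<le> (\<Sum>i<N. hnorm E (X i)) + (hnorm E (X N) + 1)" for n
    using 1[of n] 2[of n] hnorm_nonneg[of "X N"] by (cases "n < N") (simp_all del: hnorm_nonneg)
  then show ?thesis by (rule that)
qed

lemma near_sym:
  assumes "\<And>n. X n \<in> hcarrier E" "\<And>n. Y n \<in> hcarrier E" "(\<lambda>n. hnorm E (hdiff E (X n) (Y n))) \<longlonglongrightarrow> 0"
  shows "(\<lambda>n. hnorm E (hdiff E (Y n) (X n))) \<longlonglongrightarrow> 0"
  using assms(3) by (simp add: hnorm_diff_commute assms(1,2))

lemma near_trans:
  assumes "\<And>n. X n \<in> hcarrier E" "\<And>n. Y n \<in> hcarrier E" "\<And>n. Z n \<in> hcarrier E"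
    "(\<lambda>n. hnorm E (hdiff E (X n) (Y n))) \<longlonglongrightarrow> 0" "(\<lambda>n. hnorm E (hdiff E (Y n) (Z n))) \<longlonglongrightarrow> 0"
  shows "(\<lambda>n. hnorm E (hdiff E (X n) (Z n))) \<longlonglongrightarrow> 0"
  by (rule tendsto_0_if_le[OF tendsto_add_zero[OF assms(4,5)]])
    (auto intro: hnorm_diff_triangle assms)

lemma completion_class_eq_iff:
  assumes "hCauchy E X" "hCauchy E Y"
  shows "completion_class E X = completion_class E Y \<longleftrightarrow> (\<lambda>n. hnorm E (hdiff E (X n) (Y n))) \<longlonglongrightarrow> 0"
proof
  assume "completion_class E X = completion_class E Y"
  moreover have "X \<in> completion_class E X"
    using assms by (simp add: completion_class_def hCauchy_closed)
  ultimately show "(\<lambda>n. hnorm E (hdiff E (X n) (Y n))) \<longlonglongrightarrow> 0" by (simp add: completion_class_def)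
next
  assume "(\<lambda>n. hnorm E (hdiff E (X n) (Y n))) \<longlonglongrightarrow> 0"
  then show "completion_class E X = completion_class E Y"
    unfolding completion_class_def
    using near_trans[of _ X Y] near_trans[of _ Y X] near_sym[of X Y] assms
    by (auto simp: hCauchy_closed)
qed

lemma some_rep_class:
  assumes "hCauchy E X"
  shows "hCauchy E (some_rep (completion_class E X))"
    and "(\<lambda>n. hnorm E (hdiff E (some_rep (completion_class E X) n) (X n))) \<longlonglongrightarrow> 0"
proof -
  have "X \<in> completion_class E X" using assms by (simp add: completion_class_def hCauchy_closed)
  then have "some_rep (completion_class E X) \<in> completion_class E X"
    unfolding some_rep_def by (rule someI[where P = "\<lambda>u. u \<in> completion_class E X"])
  then show "hCauchy E (some_rep (completion_class E X))"
    "(\<lambda>n. hnorm E (hdiff E (some_rep (completion_class E X) n) (X n))) \<longlonglongrightarrow> 0"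
    by (auto simp: completion_class_def)
qed

lemma completion_carrierE:
  assumes "P \<in> hcarrier (completion E)"
  obtains X where "hCauchy E X" "P = completion_class E X"
  using assms by (auto simp: completion_def)

lemma completion_carrierI: "hCauchy E X \<Longrightarrow> completion_class E X \<in> hcarrier (completion E)"
  by (auto simp: completion_def)

lemma completion_add:
  assumes "hCauchy E X" "hCauchy E Y"
  shows "hadd (completion E) (completion_class E X) (completion_class E Y)
    = completion_class E (\<lambda>n. hadd E (X n) (Y n))"
  unfolding completion_def hmod.select_convs
  by (subst completion_class_eq_iff)
    (auto intro!: hCauchy_add some_rep_class assms
      tendsto_0_if_le[OF tendsto_add_zero[OF some_rep_class(2)[OF assms(1)] some_rep_class(2)[OF
          assms(2)]]]
      hnorm_diff_add hCauchy_closed)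

lemma completion_scale:
  assumes "hCauchy E X"
  shows "hscale (completion E) c (completion_class E X) = completion_class E (\<lambda>n. hscale E c (X n))"
  unfolding completion_def hmod.select_convs
  by (subst completion_class_eq_iff)
    (auto intro!: hCauchy_scale some_rep_class assms
      tendsto_mult_right_zero[OF some_rep_class(2)[OF assms]]
      simp: hnorm_diff_scale hCauchy_closed[OF some_rep_class(1)[OF assms]] hCauchy_closed[OF assms])

lemma completion_act:
  assumes "hCauchy E X"
  shows "hact (completion E) (completion_class E X) b = completion_class E (\<lambda>n. hact E (X n) b)"
  unfolding completion_def hmod.select_convs
  by (subst completion_class_eq_iff)
    (auto intro!: hCauchy_act some_rep_class assms
      tendsto_0_if_le[OF tendsto_mult_left_zero[OF some_rep_class(2)[OF assms], of "norm b"]]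
      hnorm_diff_act hCauchy_closed)

lemma completion_diff:
  assumes "hCauchy E X" "hCauchy E Y"
  shows "hdiff (completion E) (completion_class E X) (completion_class E Y)
    = completion_class E (\<lambda>n. hdiff E (X n) (Y n))"
  unfolding hdiff_def by (simp add: assms completion_scale completion_add hCauchy_scale)

lemma completion_zero: "hzero (completion E) = completion_class E (\<lambda>n. hzero E)"
  by (simp add: completion_def)

lemma norm_inner_diff_tendsto_0:
  assumes "hCauchy E X" "hCauchy E Y" "hCauchy E X'" "hCauchy E Y'"
    and nX: "(\<lambda>n. hnorm E (hdiff E (X n) (X' n))) \<longlonglongrightarrow> 0" and nY: "(\<lambda>n. hnorm E (hdiff E (Y n) (Y' n))) \<longlonglongrightarrow> 0"
  shows "(\<lambda>n. hinner E (X n) (Y n) - hinner E (X' n) (Y' n)) \<longlonglongrightarrow> 0"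
proof -
  obtain B where B: "\<And>n. hnorm E (Y n) \<le> B" using hCauchy_bounded[OF assms(2)] by blast
  obtain B' where B': "\<And>n. hnorm E (X' n) \<le> B'" using hCauchy_bounded[OF assms(3)] by blast
  have "norm (hinner E (X n) (Y n) - hinner E (X' n) (Y' n)) \<le>
      hnorm E (hdiff E (X n) (X' n)) * B + B' * hnorm E (hdiff E (Y n) (Y' n))" for n
    by (rule order_trans[OF norm_inner_diff])
      (auto intro!: add_mono mult_mono B B' hCauchy_closed assms order_trans[OF hnorm_nonneg B']
        order_trans[OF hnorm_nonneg B])
  then have "(\<lambda>n. norm (hinner E (X n) (Y n) - hinner E (X' n) (Y' n))) \<longlonglongrightarrow> 0"
    by (rule tendsto_0_if_le[OF tendsto_add_zero[OF tendsto_mult_left_zero[OF nX]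
        tendsto_mult_right_zero[OF nY]]]) simp
  then show ?thesis by (rule tendsto_norm_zero_cancel)
qed

lemma inner_convergent:
  assumes X: "hCauchy E X" and Y: "hCauchy E Y"
  shows "convergent (\<lambda>n. hinner E (X n) (Y n))"
proof (rule Cauchy_convergent, rule metric_CauchyI)
  fix e :: real assume "e > 0"
  obtain B where B: "\<And>n. hnorm E (Y n) \<le> B" using hCauchy_bounded[OF Y] by blast
  obtain B' where B': "\<And>n. hnorm E (X n) \<le> B'" using hCauchy_bounded[OF X] by blast
  have B0: "B \<ge> 0" "B' \<ge> 0" using order_trans[OF hnorm_nonneg B] order_trans[OF hnorm_nonneg B'] by auto
  define d where "d = e / (B + B' + 1)"
  have "d > 0" using \<open>e > 0\<close> B0 by (auto simp: d_def)
  obtain M where M: "\<And>m n. m \<ge> M \<Longrightarrow> n \<ge> M \<Longrightarrow> hnorm E (hdiff E (X m) (X n)) < d"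
    using hCauchyD[OF X \<open>d > 0\<close>] by blast
  obtain N where N: "\<And>m n. m \<ge> N \<Longrightarrow> n \<ge> N \<Longrightarrow> hnorm E (hdiff E (Y m) (Y n)) < d"
    using hCauchyD[OF Y \<open>d > 0\<close>] by blast
  have "dist (hinner E (X m) (Y m)) (hinner E (X n) (Y n)) < e" if "m \<ge> max M N" "n \<ge> max M N" for m n
  proof -
    have "norm (hinner E (X m) (Y m) - hinner E (X n) (Y n))
      \<le> hnorm E (hdiff E (X m) (X n)) * hnorm E (Y m) + hnorm E (X n) * hnorm E (hdiff E (Y m) (Y n))"
      by (intro norm_inner_diff hCauchy_closed X Y)
    also have "\<dots> \<le> d * B + B' * d"
      using M[of m n] N[of m n] that \<open>d > 0\<close> B0 by (intro add_mono mult_mono B B') auto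
    also have "\<dots> < d * (B + B' + 1)" using \<open>d > 0\<close> by (simp add: algebra_simps)
    also have "\<dots> = e" using B0 by (simp add: d_def)
    finally show ?thesis by (simp add: dist_norm)
  qed
  then show "\<exists>M. \<forall>m\<ge>M. \<forall>n\<ge>M. dist (hinner E (X m) (Y m)) (hinner E (X n) (Y n)) < e" by blast
qed

lemma completion_inner:
  assumes X: "hCauchy E X" and Y: "hCauchy E Y"
  shows "(\<lambda>n. hinner E (X n) (Y n)) \<longlonglongrightarrow> hinner (completion E) (completion_class E X) (completion_class E
      Y)"
proof -
  let ?X = "some_rep (completion_class E X)" and ?Y = "some_rep (completion_class E Y)"
  have "(\<lambda>n. hinner E (?X n) (?Y n)) \<longlonglongrightarrow> lim (\<lambda>n. hinner E (?X n) (?Y n))"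
    using inner_convergent[OF some_rep_class(1)[OF X] some_rep_class(1)[OF Y]] by (simp add:
        convergent_LIMSEQ_iff)
  moreover have "(\<lambda>n. hinner E (?X n) (?Y n) - hinner E (X n) (Y n)) \<longlonglongrightarrow> 0"
    by (intro norm_inner_diff_tendsto_0 some_rep_class X Y)
  ultimately have "(\<lambda>n. hinner E (X n) (Y n)) \<longlonglongrightarrow> lim (\<lambda>n. hinner E (?X n) (?Y n))"
    by (rule Lim_transform2)
  then show ?thesis by (simp add: completion_def)
qed

lemma completion_inner_eqI:
  assumes "hCauchy E X" "hCauchy E Y" "(\<lambda>n. hinner E (X n) (Y n)) \<longlonglongrightarrow> c"
  shows "hinner (completion E) (completion_class E X) (completion_class E Y) = c"
  using LIMSEQ_unique[OF completion_inner] assms by blast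

lemma completion_hnorm:
  assumes X: "hCauchy E X"
  shows "(\<lambda>n. hnorm E (X n)) \<longlonglongrightarrow> hnorm (completion E) (completion_class E X)"
  unfolding hnorm_def by (intro tendsto_intros completion_inner X)

lemma pre_hilbert_completion: "pre_hilbert_module (completion E)"
proof
  fix x y z assume "x \<in> hcarrier (completion E)" "y \<in> hcarrier (completion E)" "z \<in> hcarrier (completion
      E)"
  then obtain X Y Z where X: "hCauchy E X" "x = completion_class E X" and Y: "hCauchy E Y" "y =
      completion_class E Y"
    and Z: "hCauchy E Z" "z = completion_class E Z" by (auto elim!: completion_carrierE)
  note [simp] = completion_add completion_scale completion_act completion_zero
    hCauchy_add hCauchy_scale hCauchy_act hCauchy_const X Y Z hCauchy_closed[OF X(1)] hCauchy_closed[OF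
        Y(1)] hCauchy_closed[OF Z(1)]
  show "hadd (completion E) x y \<in> hcarrier (completion E)" by (simp add: completion_carrierI)
  show "hadd (completion E) (hadd (completion E) x y) z = hadd (completion E) x (hadd (completion E) y
      z)"
    by (simp add: add_assoc)
  show "hadd (completion E) x y = hadd (completion E) y x" by (simp add: add_comm)
  show "hscale (completion E) c (hadd (completion E) x y) = hadd (completion E) (hscale (completion E) c
      x) (hscale (completion E) c y)" for c
    by (simp add: scale_add_right)
  show "hact (completion E) (hadd (completion E) x y) b = hadd (completion E) (hact (completion E) x b)
      (hact (completion E) y b)" for b
    by (simp add: act_add_left)
  show "hinner (completion E) x (hadd (completion E) y z) = hinner (completion E) x y + hinner
      (completion E) x z"
    by (auto intro!: completion_inner_eqI tendsto_add completion_inner simp: inner_add)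
  show "hinner (completion E) x (hscale (completion E) c y) = c *\<^sub>C hinner (completion E) x y" for c
    by (auto intro!: completion_inner_eqI tendsto_scaleC completion_inner simp: inner_scale)
  show "hinner (completion E) x (hact (completion E) y b) = hinner (completion E) x y * b" for b
    by (auto intro!: completion_inner_eqI tendsto_mult tendsto_const completion_inner simp: inner_act)
  have "(\<lambda>n. star (hinner E (X n) (Y n))) \<longlonglongrightarrow> star (hinner (completion E) x y)"
    unfolding X(2) Y(2) by (intro tendsto_star completion_inner X Y)
  then show "star (hinner (completion E) x y) = hinner (completion E) y x"
    unfolding X(2) Y(2) by (intro completion_inner_eqI[symmetric] X Y) (simp add: inner_star)
next
  fix x assume "x \<in> hcarrier (completion E)"
  then obtain X where X: "hCauchy E X" "x = completion_class E X" by (auto elim!: completion_carrierE)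
  note [simp] = completion_add completion_scale completion_act completion_zero
    hCauchy_add hCauchy_scale hCauchy_act hCauchy_const X hCauchy_closed[OF X(1)]
  show "hscale (completion E) c x \<in> hcarrier (completion E)" "hact (completion E) x b \<in> hcarrier
      (completion E)" for c b
    by (simp_all add: completion_carrierI)
  show "hadd (completion E) x (hzero (completion E)) = x" by (simp add: add_zero)
  show "hscale (completion E) 0 x = hzero (completion E)" by (simp add: scale_zero)
  show "hscale (completion E) (c + d) x = hadd (completion E) (hscale (completion E) c x) (hscale
      (completion E) d x)" for c d
    by (simp add: scale_add_left)
  show "hscale (completion E) c (hscale (completion E) d x) = hscale (completion E) (c * d) x" for c d
    by (simp add: scale_scale)
  show "hscale (completion E) 1 x = x" by (simp add: scale_one)
  show "hact (completion E) x (b + b') = hadd (completion E) (hact (completion E) x b) (hact (completion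
      E) x b')" for b b'
    by (simp add: act_add_right)
  show "hact (completion E) (hact (completion E) x b) b' = hact (completion E) x (b * b')" for b b'
    by (simp add: act_act)
  show "hact (completion E) (hscale (completion E) c x) b = hscale (completion E) c (hact (completion E)
      x b)" for b c
    by (simp add: act_scale_left)
  show "hact (completion E) x (c *\<^sub>C b) = hscale (completion E) c (hact (completion E) x b)" for b c
    by (simp add: act_scale_right)
  show "cstar_positive (hinner (completion E) x x)"
    unfolding X(2) by (rule cstar_positive_closed[OF _ completion_inner[OF X(1) X(1)]]) (simp add:
        inner_positive)
qed (simp add: completion_zero completion_carrierI hCauchy_const)

lemma completion_approx:
  assumes X: "hCauchy E X"
  shows "(\<lambda>k. hnorm (completion E) (hdiff (completion E) (completion_class E X) (completion_class E (\<lambda>n.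
      X k)))) \<longlonglongrightarrow> 0"
proof (rule LIMSEQ_I)
  fix r :: real assume "r > 0"
  then obtain N where N: "\<And>m n. m \<ge> N \<Longrightarrow> n \<ge> N \<Longrightarrow> hnorm E (hdiff E (X m) (X n)) < r / 2"
    using hCauchyD[OF X, of "r / 2"] by auto
  have le: "hnorm (completion E) (hdiff (completion E) (completion_class E X) (completion_class E (\<lambda>n. X
      k))) \<le> r / 2"
    if "k \<ge> N" for k
  proof -
    have C: "hCauchy E (\<lambda>n. hdiff E (X n) (X k))"
      unfolding hdiff_def by (intro hCauchy_add hCauchy_const X scale_closed hCauchy_closed)
    have "hnorm (completion E) (completion_class E (\<lambda>n. hdiff E (X n) (X k))) \<le> r / 2"
      by (rule LIMSEQ_le_const2[OF completion_hnorm[OF C]]) (use N that in \<open>auto intro: less_imp_le\<close>)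
    then show ?thesis
      using X by (simp add: completion_diff hCauchy_const hCauchy_closed)
  qed
  have "norm (hnorm (completion E) (hdiff (completion E) (completion_class E X) (completion_class E (\<lambda>n.
      X k))) - 0) < r"
    if "k \<ge> N" for k
    using le[OF that] \<open>r > 0\<close> pre_hilbert_module.hnorm_nonneg[OF pre_hilbert_completion] by simp
  then show "\<exists>N. \<forall>k\<ge>N. norm (hnorm (completion E) (hdiff (completion E) (completion_class E X)
      (completion_class E (\<lambda>n. X k))) - 0) < r"
    by blast
qed

lemma completion_const_isometric:
  assumes "x \<in> hcarrier E" "y \<in> hcarrier E"
  shows "hinner (completion E) (completion_class E (\<lambda>n. x)) (completion_class E (\<lambda>n. y)) = hinner E x y"
  by (rule completion_inner_eqI) (auto simp: assms hCauchy_const)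

lemma hilbert_completion: "hilbert_module (completion E)"
proof (rule hilbert_module_if_pre[OF pre_hilbert_completion])
  interpret C: pre_hilbert_module "completion E" by (rule pre_hilbert_completion)
  fix x assume "x \<in> hcarrier (completion E)" and 0: "hinner (completion E) x x = 0"
  then obtain X where X: "hCauchy E X" "x = completion_class E X" by (auto elim!: completion_carrierE)
  have "(\<lambda>n. hnorm E (X n)) \<longlonglongrightarrow> 0"
    using completion_hnorm[OF X(1)] 0 by (simp add: X(2) hnorm_def)
  moreover have "hnorm E (hdiff E (X n) (hzero E)) = hnorm E (X n)" for n
    by (rule hnorm_cong) (simp add: hCauchy_closed X inner_simps)
  ultimately show "x = hzero (completion E)"
    unfolding X(2) completion_zero by (subst completion_class_eq_iff) (auto simp: X hCauchy_const)
next
  interpret C: pre_hilbert_module "completion E" by (rule pre_hilbert_completion)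
  fix P assume P: "hCauchy (completion E) P"
  let ?i = "\<lambda>x. completion_class E (\<lambda>n. x)"
  have i: "?i x \<in> hcarrier (completion E)" if "x \<in> hcarrier E" for x
    by (intro completion_carrierI hCauchy_const that)
  \<comment> \<open>Diagonal choice: each \<open>P k\<close> is replaced by a constant class within
    \<open>1 / (k + 1)\<close>. The resulting sequence in \<open>E\<close> is Cauchy, and its own
    class is the limit of \<open>P\<close>.\<close>
  have "\<exists>x\<in>hcarrier E. hnorm (completion E) (hdiff (completion E) (P k) (?i x)) < inverse (Suc k)" for k
  proof -
    obtain X where X: "hCauchy E X" "P k = completion_class E X"
      using C.hCauchy_closed[OF P] by (auto elim!: completion_carrierE)
    have "0 < inverse (real (Suc k))" by simp
    from order_tendstoD(2)[OF completion_approx[OF X(1)] this] obtain j where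
      "hnorm (completion E) (hdiff (completion E) (completion_class E X) (completion_class E (\<lambda>n. X j)))
          < inverse (Suc k)"
      unfolding eventually_sequentially by blast
    then show ?thesis using X hCauchy_closed[OF X(1)] by auto
  qed
  then obtain m where m: "\<And>k. m k \<in> hcarrier E"
      "\<And>k. hnorm (completion E) (hdiff (completion E) (P k) (?i (m k))) < inverse (Suc k)"
    by metis
  have Ptend: "(\<lambda>k. hnorm (completion E) (hdiff (completion E) (P k) (?i (m k)))) \<longlonglongrightarrow> 0"
    by (rule tendsto_0_if_le[OF LIMSEQ_inverse_real_of_nat less_imp_le[OF m(2)]]) simp
  have diff: "hnorm E (hdiff E x y) = hnorm (completion E) (hdiff (completion E) (?i x) (?i y))"
    if "x \<in> hcarrier E" "y \<in> hcarrier E" for x y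
    using that by (simp add: completion_diff hCauchy_const) (simp add:
        hnorm_def completion_const_isometric)
  have "hCauchy E m"
    unfolding hCauchy_def
  proof (intro conjI allI impI)
    fix e :: real assume "e > 0"
    then obtain N1 where N1: "\<And>k l. k \<ge> N1 \<Longrightarrow> l \<ge> N1 \<Longrightarrow> hnorm (completion E) (hdiff (completion E) (P k) (P
        l)) < e / 3"
      using C.hCauchyD[OF P, of "e / 3"] by auto
    obtain N2 where N2: "\<And>k. k \<ge> N2 \<Longrightarrow> hnorm (completion E) (hdiff (completion E) (P k) (?i (m k))) < e /
        3"
      using order_tendstoD(2)[OF Ptend, of "e / 3"] \<open>e > 0\<close> unfolding eventually_sequentially by auto
    have "hnorm E (hdiff E (m k) (m l)) < e" if kl: "k \<ge> max N1 N2" "l \<ge> max N1 N2" for k l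
    proof -
      have "hnorm E (hdiff E (m k) (m l)) \<le> hnorm (completion E) (hdiff (completion E) (?i (m k)) (P k))
         + hnorm (completion E) (hdiff (completion E) (P k) (?i (m l)))"
        unfolding diff[OF m(1) m(1)] by (intro C.hnorm_diff_triangle i m C.hCauchy_closed[OF P])
      also have "hnorm (completion E) (hdiff (completion E) (P k) (?i (m l))) \<le>
         hnorm (completion E) (hdiff (completion E) (P k) (P l)) + hnorm (completion E) (hdiff
             (completion E) (P l) (?i (m l)))"
        by (intro C.hnorm_diff_triangle i m C.hCauchy_closed[OF P])
      also have "hnorm (completion E) (hdiff (completion E) (?i (m k)) (P k)) =
          hnorm (completion E) (hdiff (completion E) (P k) (?i (m k)))"
        by (intro C.hnorm_diff_commute i m C.hCauchy_closed[OF P])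
      finally show ?thesis using N1[of k l] N2[of k] N2[of l] kl by auto
    qed
    then show "\<exists>N. \<forall>k\<ge>N. \<forall>l\<ge>N. hnorm E (hdiff E (m k) (m l)) < e" by blast
  qed (rule m)
  have "(\<lambda>k. hnorm (completion E) (hdiff (completion E) (P k) (completion_class E m))) \<longlonglongrightarrow> 0"
  proof (rule C.near_trans[OF _ _ _ Ptend])
    show "(\<lambda>k. hnorm (completion E) (hdiff (completion E) (?i (m k)) (completion_class E m))) \<longlonglongrightarrow> 0"
      by (rule C.near_sym[OF _ _ completion_approx[OF \<open>hCauchy E m\<close>]])
        (auto intro: i m completion_carrierI \<open>hCauchy E m\<close>)
  qed (auto intro: i m completion_carrierI \<open>hCauchy E m\<close> C.hCauchy_closed[OF P])
  then show "\<exists>x\<in>hcarrier (completion E). (\<lambda>n. hnorm (completion E) (hdiff (completion E) (P n) x)) \<longlonglongrightarrow> 0"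
    using completion_carrierI[OF \<open>hCauchy E m\<close>] by blast
qed

end

section \<open>Adjointable maps\<close>

lemma is_adjointD:
  assumes "is_adjoint E\<^sub>1 E\<^sub>2 T S"
  shows "x \<in> hcarrier E\<^sub>1 \<Longrightarrow> T x \<in> hcarrier E\<^sub>2" "y \<in> hcarrier E\<^sub>2 \<Longrightarrow> S y \<in> hcarrier E\<^sub>1"
    "x \<in> hcarrier E\<^sub>1 \<Longrightarrow> y \<in> hcarrier E\<^sub>2 \<Longrightarrow> hinner E\<^sub>2 (T x) y = hinner E\<^sub>1 x (S y)"
  using assms by (auto simp: is_adjoint_def)

lemma is_adjoint_restrict:
  assumes "\<And>x. x \<in> hcarrier E\<^sub>1 \<Longrightarrow> T x \<in> hcarrier E\<^sub>2" "\<And>y. y \<in> hcarrier E\<^sub>2 \<Longrightarrow> S y \<in> hcarrier E\<^sub>1"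
    "\<And>x y. x \<in> hcarrier E\<^sub>1 \<Longrightarrow> y \<in> hcarrier E\<^sub>2 \<Longrightarrow> hinner E\<^sub>2 (T x) y = hinner E\<^sub>1 x (S y)"
  shows "is_adjoint E\<^sub>1 E\<^sub>2 (restrict T (hcarrier E\<^sub>1)) (restrict S (hcarrier E\<^sub>2))"
  using assms by (auto simp: is_adjoint_def)

lemma is_adjoint_unique:
  assumes "hilbert_module E\<^sub>1" "is_adjoint E\<^sub>1 E\<^sub>2 T S" "is_adjoint E\<^sub>1 E\<^sub>2 T S'"
  shows "S = S'"
proof (rule extensionalityI[of _ "hcarrier E\<^sub>2"])
  fix y assume y: "y \<in> hcarrier E\<^sub>2"
  show "S y = S' y"
    using is_adjointD[OF assms(2)] is_adjointD[OF assms(3)] y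
        by (intro hilbert_module_eqI[OF assms(1)]) metis+
qed (use assms in \<open>auto simp: is_adjoint_def PiE_def\<close>)

lemma is_adjoint_swap:
  assumes "pre_hilbert_module E\<^sub>1" "pre_hilbert_module E\<^sub>2" "is_adjoint E\<^sub>1 E\<^sub>2 T S"
  shows "is_adjoint E\<^sub>2 E\<^sub>1 S T"
proof -
  interpret E1: pre_hilbert_module E\<^sub>1 by fact
  interpret E2: pre_hilbert_module E\<^sub>2 by fact
  have "hinner E\<^sub>1 (S y) x = hinner E\<^sub>2 y (T x)" if "x \<in> hcarrier E\<^sub>1" "y \<in> hcarrier E\<^sub>2" for x y
    using is_adjointD[OF assms(3)] that by (metis E1.inner_star E2.inner_star)
  then show ?thesis using assms(3) by (auto simp: is_adjoint_def)
qed

lemma adjoint_map_eq: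
  assumes "hilbert_module E\<^sub>1" "is_adjoint E\<^sub>1 E\<^sub>2 T S"
  shows "adjoint_map E\<^sub>1 E\<^sub>2 T = S"
  unfolding adjoint_map_def using assms is_adjoint_unique[OF assms(1)] by blast

lemma is_adjoint_adjoint_map:
  assumes "hilbert_module E\<^sub>1" "T \<in> adjointable E\<^sub>1 E\<^sub>2"
  shows "is_adjoint E\<^sub>1 E\<^sub>2 T (adjoint_map E\<^sub>1 E\<^sub>2 T)"
  using assms adjoint_map_eq[OF assms(1)] by (force simp: adjointable_def)

lemma is_adjoint_compose:
  assumes "is_adjoint E\<^sub>1 E\<^sub>2 T S" "is_adjoint E\<^sub>2 E\<^sub>3 T' S'"
  shows "is_adjoint E\<^sub>1 E\<^sub>3 (compose (hcarrier E\<^sub>1) T' T) (compose (hcarrier E\<^sub>3) S S')"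
  unfolding compose_def using is_adjointD[OF assms(1)] is_adjointD[OF assms(2)]
  by (intro is_adjoint_restrict) auto

lemma adjointable_compose:
  "T \<in> adjointable E\<^sub>1 E\<^sub>2 \<Longrightarrow> T' \<in> adjointable E\<^sub>2 E\<^sub>3 \<Longrightarrow> compose (hcarrier E\<^sub>1) T' T \<in> adjointable E\<^sub>1
      E\<^sub>3"
  unfolding adjointable_def using is_adjoint_compose by blast

lemma adjointable_id: "restrict id (hcarrier E) \<in> adjointable E E"
  unfolding adjointable_def using is_adjoint_restrict[of E id E id] by auto

lemma adjointable_closed: "T \<in> adjointable E\<^sub>1 E\<^sub>2 \<Longrightarrow> x \<in> hcarrier E\<^sub>1 \<Longrightarrow> T x \<in> hcarrier E\<^sub>2"
  by (auto simp: adjointable_def is_adjoint_def)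

lemma adjointable_extensional: "T \<in> adjointable E\<^sub>1 E\<^sub>2 \<Longrightarrow> T \<in> extensional (hcarrier E\<^sub>1)"
  by (auto simp: adjointable_def is_adjoint_def PiE_def)

context
  fixes E\<^sub>1 :: "('b::cstar_algebra, 'e) hmod" and E\<^sub>2 :: "('b, 'f) hmod" and T
  assumes E1: "pre_hilbert_module E\<^sub>1" and E2: "hilbert_module E\<^sub>2" and T: "T \<in> adjointable E\<^sub>1 E\<^sub>2"
begin

interpretation E1: pre_hilbert_module E\<^sub>1 by (rule E1)
interpretation E2: pre_hilbert_module E\<^sub>2 by (rule hilbert_module_pre) (rule E2)

text \<open>Linearity is no part of \<open>is_adjoint\<close>. It is derived by moving
  \<open>T\<close> off the second argument and testing against all vectors, which uses definiteness
  of the target only.\<close>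

lemma adjointable_inner_right:
  obtains S where "\<And>z. z \<in> hcarrier E\<^sub>2 \<Longrightarrow> S z \<in> hcarrier E\<^sub>1"
    "\<And>z w. z \<in> hcarrier E\<^sub>2 \<Longrightarrow> w \<in> hcarrier E\<^sub>1 \<Longrightarrow> hinner E\<^sub>2 z (T w) = hinner E\<^sub>1 (S z) w"
proof -
  obtain S where S: "is_adjoint E\<^sub>1 E\<^sub>2 T S" using T by (auto simp: adjointable_def)
  note d = is_adjointD[OF is_adjoint_swap[OF E1 E2.pre_hilbert_module_axioms S]]
  show ?thesis by (rule that[of S]) (use d in auto)
qed

lemma adjointable_add:
  assumes "x \<in> hcarrier E\<^sub>1" "y \<in> hcarrier E\<^sub>1"
  shows "T (hadd E\<^sub>1 x y) = hadd E\<^sub>2 (T x) (T y)"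
  by (rule adjointable_inner_right, rule hilbert_module_eqI[OF E2])
    (use assms adjointable_closed[OF T] in \<open>simp_all add: E1.inner_simps E2.inner_simps\<close>)

lemma adjointable_scale:
  assumes "x \<in> hcarrier E\<^sub>1"
  shows "T (hscale E\<^sub>1 c x) = hscale E\<^sub>2 c (T x)"
  by (rule adjointable_inner_right, rule hilbert_module_eqI[OF E2])
    (use assms adjointable_closed[OF T] in \<open>simp_all add: E1.inner_simps E2.inner_simps\<close>)

lemma adjointable_act:
  assumes "x \<in> hcarrier E\<^sub>1"
  shows "T (hact E\<^sub>1 x b) = hact E\<^sub>2 (T x) b"
  by (rule adjointable_inner_right, rule hilbert_module_eqI[OF E2])
    (use assms adjointable_closed[OF T] in \<open>simp_all add: E1.inner_simps E2.inner_simps\<close>)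

lemma adjointable_diff:
  assumes "x \<in> hcarrier E\<^sub>1" "y \<in> hcarrier E\<^sub>1"
  shows "T (hdiff E\<^sub>1 x y) = hdiff E\<^sub>2 (T x) (T y)"
  using assms by (simp add: hdiff_def adjointable_add adjointable_scale)

end

lemmas adjointable_linear = adjointable_add adjointable_scale adjointable_act adjointable_diff

text \<open>The square of the norm of \<open>T x\<close> is the norm of \<open><x, S T x>\<close>,
  at most \<open>hnorm x * K * hnorm (T x)\<close>. Stated for bare maps between pre-Hilbert modules
  so that it also applies on the algebraic tensor product.\<close>

lemma adjoint_bound:
  assumes E1: "pre_hilbert_module E\<^sub>1" and E2: "pre_hilbert_module E\<^sub>2"
    and closed: "\<And>x. x \<in> hcarrier E\<^sub>1 \<Longrightarrow> T x \<in> hcarrier E\<^sub>2" "\<And>y. y \<in> hcarrier E\<^sub>2 \<Longrightarrow> S y \<in> hcarrier E\<^sub>1"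
    and adj: "\<And>x y. x \<in> hcarrier E\<^sub>1 \<Longrightarrow> y \<in> hcarrier E\<^sub>2 \<Longrightarrow> hinner E\<^sub>2 (T x) y = hinner E\<^sub>1 x (S y)"
    and bd: "\<And>y. y \<in> hcarrier E\<^sub>2 \<Longrightarrow> hnorm E\<^sub>1 (S y) \<le> K * hnorm E\<^sub>2 y" and K: "K \<ge> 0"
    and x: "x \<in> hcarrier E\<^sub>1"
  shows "hnorm E\<^sub>2 (T x) \<le> K * hnorm E\<^sub>1 x"
proof (cases "hnorm E\<^sub>2 (T x) = 0")
  case False
  interpret E1: pre_hilbert_module E\<^sub>1 by fact
  interpret E2: pre_hilbert_module E\<^sub>2 by fact
  have "(hnorm E\<^sub>2 (T x))\<^sup>2 = norm (hinner E\<^sub>1 x (S (T x)))"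
    using closed x by (simp add: E2.hnorm_square adj)
  also have "\<dots> \<le> hnorm E\<^sub>1 x * (K * hnorm E\<^sub>2 (T x))"
    using closed x E1.cauchy_schwarz[of x "S (T x)"] bd[of "T x"]
    by (meson E1.hnorm_nonneg mult_left_mono order_trans)
  finally show ?thesis using False E2.hnorm_nonneg[of "T x"]
    by (simp add: power2_eq_square mult_ac del: E2.hnorm_nonneg)
next
  case True
  then show ?thesis using K pre_hilbert_module.hnorm_nonneg[OF E1] by simp
qed

text \<open>A gliding hump: if \<open>\<parallel>S y\<^sub>n\<parallel> > 4\<^sup>n\<close> with \<open>\<parallel>y\<^sub>n\<parallel> \<le> 1\<close>, signs can be chosen in
  \<open>x = \<Sum> \<plusminus>3\<^sup>-\<^sup>n S y\<^sub>n / \<parallel>S y\<^sub>n\<parallel>\<close> so that \<open>\<parallel>\<langle>S y\<^sub>n, x\<rangle>\<parallel> = \<parallel>\<langle>y\<^sub>n, T x\<rangle>\<parallel>\<close> is unbounded.\<close>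

lemma adjoint_bounded:
  assumes E1: "hilbert_module E\<^sub>1" and E2: "pre_hilbert_module E\<^sub>2" and adj: "is_adjoint E\<^sub>1 E\<^sub>2 T S"
  shows "\<exists>K. \<forall>y\<in>hcarrier E\<^sub>2. hnorm E\<^sub>1 (S y) \<le> K * hnorm E\<^sub>2 y"
proof (rule ccontr)
  assume "\<not> ?thesis"
  then have unb: "\<exists>y\<in>hcarrier E\<^sub>2. hnorm E\<^sub>1 (S y) > K * hnorm E\<^sub>2 y" for K by (auto simp: not_le)
  interpret E1: pre_hilbert_module E\<^sub>1 by (rule hilbert_module_pre) fact
  interpret E2: pre_hilbert_module E\<^sub>2 by fact
  note d = is_adjointD[OF adj] is_adjointD(3)[OF is_adjoint_swap[OF E1.pre_hilbert_module_axioms E2 adj]]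
  have Sscale: "hnorm E\<^sub>1 (S (hscale E\<^sub>2 c y)) = cmod c * hnorm E\<^sub>1 (S y)" if y: "y \<in> hcarrier E\<^sub>2"
      for c y
  proof -
    have "S \<in> adjointable E\<^sub>2 E\<^sub>1"
      using is_adjoint_swap[OF E1.pre_hilbert_module_axioms E2 adj] by (auto simp: adjointable_def)
    from adjointable_linear(2)[OF E2 E1 this y] show ?thesis using y by (simp add: E1.hnorm_scale d(2))
  qed
  have "\<exists>y\<in>hcarrier E\<^sub>2. hnorm E\<^sub>2 y \<le> 1 \<and> hnorm E\<^sub>1 (S y) > K" if K: "K \<ge> 0" for K :: real
  proof -
    obtain y where y: "y \<in> hcarrier E\<^sub>2" "hnorm E\<^sub>1 (S y) > K * hnorm E\<^sub>2 y" using unb by blast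
    show ?thesis
    proof (cases "hnorm E\<^sub>2 y = 0")
      \<comment> \<open>A null vector of the pre-Hilbert module might still have a nonzero image.
        Its multiples stay null, and one of them has an image of norm exactly
        \<open>K + 1\<close>.\<close>
      case True
      then have p: "hnorm E\<^sub>1 (S y) > 0" using y by simp
      show ?thesis
        using y p K True by (intro bexI[of _ "hscale E\<^sub>2 (of_real ((K + 1) / hnorm E\<^sub>1 (S y))) y"])
          (auto simp: Sscale E2.hnorm_scale norm_of_real abs_of_nonneg simp del:
              of_real_divide of_real_add)
    next
      case False
      then have p: "hnorm E\<^sub>2 y > 0" using E2.hnorm_nonneg[of y] by linarith
      show ?thesis
        using y p by (intro bexI[of _ "hscale E\<^sub>2 (of_real (1 / hnorm E\<^sub>2 y)) y"])
          (auto simp: Sscale E2.hnorm_scale pos_less_divide_eq norm_divide)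
    qed
  qed
  then have "\<exists>y\<in>hcarrier E\<^sub>2. hnorm E\<^sub>2 y \<le> 1 \<and> hnorm E\<^sub>1 (S y) > 4 ^ n" for n :: nat by simp
  then obtain y where y: "\<And>n. y n \<in> hcarrier E\<^sub>2" "\<And>n. hnorm E\<^sub>2 (y n) \<le>
      1" "\<And>n. hnorm E\<^sub>1 (S (y n)) > 4 ^ n"
    by metis
  define s where "s n = S (y n)" for n
  define N where "N n = hnorm E\<^sub>1 (s n)" for n
  define t :: "nat \<Rightarrow> real" where "t n = (1/3) ^ n" for n
  define xi where "xi n = hscale E\<^sub>1 (of_real (t n / N n)) (s n)" for n
  have N: "N n > 4 ^ n" for n using y(3) by (simp add: N_def s_def)
  have N0: "N n > 0" for n using N[of n] by (rule less_trans[rotated]) simp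
  have t0: "t n > 0" for n by (simp add: t_def)
  have s[simp]: "s n \<in> hcarrier E\<^sub>1" for n using d y by (simp add: s_def)
  have xi[simp]: "xi n \<in> hcarrier E\<^sub>1" for n by (simp add: xi_def)
  have norm_xi: "hnorm E\<^sub>1 (xi n) = t n" for n
    using N0[of n] t0[of n] by (simp add: xi_def E1.hnorm_scale norm_divide flip: N_def)
  have sxi: "norm (hinner E\<^sub>1 (s n) (xi n)) = t n * N n" for n
    using N0[of n] t0[of n]
    by (simp add: xi_def E1.inner_simps norm_scaleC norm_divide power2_eq_square flip: E1.hnorm_square
        N_def)
  define g where "g n x = (if norm (hinner E\<^sub>1 (s n) (hadd E\<^sub>1 x (xi n))) \<ge> t n * N n
      then hadd E\<^sub>1 x (xi n) else hdiff E\<^sub>1 x (xi n))" for n x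
  have g: "g n x \<in> hcarrier E\<^sub>1" "hnorm E\<^sub>1 (hdiff E\<^sub>1 (g n x) x) = t n"
      "norm (hinner E\<^sub>1 (s n) (g n x)) \<ge> t n * N n" if x: "x \<in> hcarrier E\<^sub>1" for n x
  proof -
    show "g n x \<in> hcarrier E\<^sub>1" using x by (simp add: g_def)
    have "hnorm E\<^sub>1 (hdiff E\<^sub>1 (g n x) x) = hnorm E\<^sub>1 (xi n)"
      using x by (intro E1.hnorm_cong) (simp add: g_def E1.inner_simps)
    then show "hnorm E\<^sub>1 (hdiff E\<^sub>1 (g n x) x) = t n" by (simp add: norm_xi)
    \<comment> \<open>The inner products of the two candidates with \<open>s n\<close> differ by an
      element of norm \<open>2 * (t n * N n)\<close>, so one of them has norm at least
      \<open>t n * N n\<close>; this is the choice of sign.\<close>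
    have "hinner E\<^sub>1 (s n) (hadd E\<^sub>1 x (xi n)) - hinner E\<^sub>1 (s n) (hdiff E\<^sub>1 x (xi n)) =
        2 *\<^sub>R hinner E\<^sub>1 (s n) (xi n)"
      using x by (simp add: E1.inner_simps scaleR_2)
    then have "2 * (t n * N n) \<le> norm (hinner E\<^sub>1 (s n) (hadd E\<^sub>1 x (xi n))) + norm (hinner E\<^sub>1 (s n)
        (hdiff E\<^sub>1 x (xi n)))"
      by (metis norm_triangle_ineq4 norm_scaleR sxi abs_numeral)
    then show "norm (hinner E\<^sub>1 (s n) (g n x)) \<ge> t n * N n" by (auto simp: g_def)
  qed
  define X where "X = rec_nat (hzero E\<^sub>1) g"
  have XS: "X (Suc n) = g n (X n)" for n by (simp add: X_def)
  have X[simp]: "X n \<in> hcarrier E\<^sub>1" for n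
    by (induction n) (simp_all add: XS g, simp add: X_def)
  have Xdist: "hnorm E\<^sub>1 (hdiff E\<^sub>1 (X (n + m)) (X n)) \<le> (3/2) * (t n - t (n + m))" for n m
  proof (induction m)
    case (Suc m)
    have "hnorm E\<^sub>1 (hdiff E\<^sub>1 (X (n + Suc m)) (X n)) \<le>
       hnorm E\<^sub>1 (hdiff E\<^sub>1 (X (Suc (n + m))) (X (n + m))) + hnorm E\<^sub>1 (hdiff E\<^sub>1 (X (n + m)) (X n))"
      using E1.hnorm_diff_triangle[of "X (Suc (n + m))" "X (n + m)" "X n"] by simp
    also have "hnorm E\<^sub>1 (hdiff E\<^sub>1 (X (Suc (n + m))) (X (n + m))) = t (n + m)" by (simp add: XS g)
    finally show ?case using Suc by (simp add: t_def)
  qed simp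
  then have Xd: "hnorm E\<^sub>1 (hdiff E\<^sub>1 (X (n + m)) (X n)) \<le> (3/2) * t n" for n m
    using t0[of "n + m"] by (intro order_trans[OF Xdist]) simp
  have tlim: "t \<longlonglongrightarrow> 0" unfolding t_def[abs_def] by (rule LIMSEQ_realpow_zero) auto
  have "hCauchy E\<^sub>1 X"
    unfolding hCauchy_def
  proof (intro conjI allI impI)
    fix e :: real assume "e > 0"
    then obtain M where M: "\<And>n. n \<ge> M \<Longrightarrow> t n < e / 3"
      using order_tendstoD(2)[OF tlim, of "e / 3"] unfolding eventually_sequentially by auto
    have "hnorm E\<^sub>1 (hdiff E\<^sub>1 (X m) (X n)) < e" if "m \<ge> M" "n \<ge> M" for m n
    proof -
      have "hnorm E\<^sub>1 (hdiff E\<^sub>1 (X m) (X n)) \<le> hnorm E\<^sub>1 (hdiff E\<^sub>1 (X m) (X M)) + hnorm E\<^sub>1 (hdiff E\<^sub>1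
          (X n) (X M))"
        using E1.hnorm_diff_triangle[of "X m" "X M" "X n"] E1.hnorm_diff_commute[of "X n" "X M"] by simp
      also have "\<dots> \<le> (3/2) * t M + (3/2) * t M"
        using Xd[of M "m - M"] Xd[of M "n - M"] that by (intro add_mono) auto
      finally show ?thesis using M[of M] by simp
    qed
    then show "\<exists>N. \<forall>m\<ge>N. \<forall>n\<ge>N. hnorm E\<^sub>1 (hdiff E\<^sub>1 (X m) (X n)) < e" by blast
  qed simp
  then obtain x where x: "x \<in> hcarrier E\<^sub>1" and lim: "(\<lambda>n. hnorm E\<^sub>1 (hdiff E\<^sub>1 (X n) x)) \<longlonglongrightarrow> 0"
    using hilbert_module.complete[OF E1] by blast
  have dx: "hnorm E\<^sub>1 (hdiff E\<^sub>1 x (X n)) \<le> (3/2) * t n" for n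
  proof -
    have "hnorm E\<^sub>1 (hdiff E\<^sub>1 x (X n)) \<le> hnorm E\<^sub>1 (hdiff E\<^sub>1 (X (m + n)) x) + (3/2) * t n" for m
      using E1.hnorm_diff_triangle[OF x, of "X (m + n)" "X n"] E1.hnorm_diff_commute[OF x X, of "m + n"]
          Xd[of n m]
      by (simp add: add.commute)
    moreover have "(\<lambda>m. hnorm E\<^sub>1 (hdiff E\<^sub>1 (X (m + n)) x) + (3/2) * t n) \<longlonglongrightarrow> 0 + (3/2) * t n"
      by (intro tendsto_add tendsto_const LIMSEQ_ignore_initial_segment lim)
    ultimately show ?thesis using LIMSEQ_le_const by force
  qed
  \<comment> \<open>The corrections after step \<open>n\<close> move \<open>x\<close> by at most
    \<open>(3/2) * t (Suc n) = t n / 2\<close>, where \<open>3/2\<close> is the sum of the geometric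
    series of ratio \<open>1/3\<close>. Hence half of \<open>t n * N n\<close> survives, and
    \<open>N n > 4 ^ n\<close> outgrows the weights \<open>t n\<close>.\<close>
  have bound: "(4/3) ^ n \<le> 2 * hnorm E\<^sub>2 (T x)" for n
  proof -
    have "t n * N n \<le> norm (hinner E\<^sub>1 (s n) (X (Suc n)))" unfolding XS by (rule g) simp
    also have "\<dots> = norm (hinner E\<^sub>1 (s n) x - hinner E\<^sub>1 (s n) (hdiff E\<^sub>1 x (X (Suc n))))"
      using x by (simp add: E1.inner_simps)
    also have "\<dots> \<le> norm (hinner E\<^sub>1 (s n) x) + norm (hinner E\<^sub>1 (s n) (hdiff E\<^sub>1 x (X (Suc n))))"
      by (rule norm_triangle_ineq4)
    also have "norm (hinner E\<^sub>1 (s n) (hdiff E\<^sub>1 x (X (Suc n)))) \<le> N n * ((3/2) * t (Suc n))"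
      using x dx[of "Suc n"] N0[of n]
      by (intro order_trans[OF E1.cauchy_schwarz]) (auto simp flip: N_def intro!: mult_left_mono)
    also have "N n * ((3/2) * t (Suc n)) = t n * N n / 2" by (simp add: t_def)
    also have "hinner E\<^sub>1 (s n) x = hinner E\<^sub>2 (y n) (T x)" using x y by (simp add: s_def d(4))
    also have "norm \<dots> \<le> 1 * hnorm E\<^sub>2 (T x)"
      using x y d(1) by (intro order_trans[OF E2.cauchy_schwarz] mult_right_mono) auto
    finally have "t n * N n \<le> 2 * hnorm E\<^sub>2 (T x)" by simp
    moreover have "t n * 4 ^ n \<le> t n * N n" using N[of n] t0[of n] by (intro mult_left_mono) auto
    moreover have "t n * 4 ^ n = (4/3) ^ n" by (simp add: t_def flip: power_mult_distrib)
    ultimately show ?thesis by simp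
  qed
  obtain n where "(4/3) ^ n > 2 * hnorm E\<^sub>2 (T x)" using real_arch_pow[of "4/3" "2 * hnorm E\<^sub>2 (T x)"]
      by auto
  with bound[of n] show False by simp
qed

text \<open>The hump argument bounds the adjoint, whose values lie in the complete module
  \<open>E\<^sub>1\<close>; \<open>adjoint_bound\<close> carries the constant back to
  \<open>T\<close>.\<close>

lemma adjointable_bounded:
  assumes E1: "hilbert_module E\<^sub>1" and E2: "pre_hilbert_module E\<^sub>2" and T: "T \<in> adjointable E\<^sub>1 E\<^sub>2"
  obtains K where "K \<ge> 0" "\<And>x. x \<in> hcarrier E\<^sub>1 \<Longrightarrow> hnorm E\<^sub>2 (T x) \<le> K * hnorm E\<^sub>1 x"
proof -
  interpret E1: pre_hilbert_module E\<^sub>1 by (rule hilbert_module_pre) fact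
  interpret E2: pre_hilbert_module E\<^sub>2 by fact
  obtain S where S: "is_adjoint E\<^sub>1 E\<^sub>2 T S" using T by (auto simp: adjointable_def)
  obtain K where K: "\<And>y. y \<in> hcarrier E\<^sub>2 \<Longrightarrow> hnorm E\<^sub>1 (S y) \<le> K * hnorm E\<^sub>2 y"
    using adjoint_bounded[OF E1 E2 S] by blast
  have K': "hnorm E\<^sub>1 (S y) \<le> \<bar>K\<bar> * hnorm E\<^sub>2 y" if "y \<in> hcarrier E\<^sub>2" for y
    by (rule order_trans[OF K[OF that]]) (auto intro: mult_right_mono)
  show ?thesis
    by (rule that[of "\<bar>K\<bar>"], simp,
      rule adjoint_bound[OF E1.pre_hilbert_module_axioms E2 _ _ _ K']) (use is_adjointD[OF S] in auto)
qed

section \<open>Representations and positivity of Gram matrices\<close>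

locale star_representation =
  fixes F :: "('c::cstar_algebra, 'f) hmod" and \<pi> :: "'b::cstar_algebra \<Rightarrow> 'f \<Rightarrow> 'f"
  assumes hilbert: "hilbert_module F" and hom: "star_hom_into_adjointable F \<pi>"

sublocale star_representation \<subseteq> F: pre_hilbert_module F
  by (rule hilbert_module_pre) (rule hilbert)

context star_representation
begin

lemma \<pi>_adjointable: "\<pi> b \<in> adjointable F F"
  using hom by (simp add: star_hom_into_adjointable_def linear_into_adjointable_def)

lemma \<pi>_closed [simp]: "y \<in> hcarrier F \<Longrightarrow> \<pi> b y \<in> hcarrier F"
  using adjointable_closed[OF \<pi>_adjointable] .

lemma \<pi>_add: "y \<in> hcarrier F \<Longrightarrow> \<pi> (a + b) y = hadd F (\<pi> a y) (\<pi> b y)"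
  and \<pi>_scale: "y \<in> hcarrier F \<Longrightarrow> \<pi> (c *\<^sub>C a) y = hscale F c (\<pi> a y)"
  using hom by (auto simp: star_hom_into_adjointable_def linear_into_adjointable_def)

lemma \<pi>_mult: "y \<in> hcarrier F \<Longrightarrow> \<pi> (a * b) y = \<pi> a (\<pi> b y)"
  using hom by (simp add: star_hom_into_adjointable_def compose_def)

lemmas \<pi>_linear = adjointable_linear[OF F.pre_hilbert_module_axioms hilbert \<pi>_adjointable]

lemma \<pi>_star:
  assumes "x \<in> hcarrier F" "y \<in> hcarrier F"
  shows "hinner F (\<pi> b x) y = hinner F x (\<pi> (star b) y)"
proof -
  have "is_adjoint F F (\<pi> b) (\<pi> (star b))"
    using is_adjoint_adjoint_map[OF hilbert \<pi>_adjointable, of b] hom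
    by (simp add: star_hom_into_adjointable_def)
  then show ?thesis using assms is_adjointD(3) by fast
qed

lemma \<pi>_inner_simps:
  assumes "x \<in> hcarrier F" "y \<in> hcarrier F"
  shows "hinner F x (\<pi> (a + b) y) = hinner F x (\<pi> a y) + hinner F x (\<pi> b y)"
    and "hinner F x (\<pi> (c *\<^sub>C a) y) = c *\<^sub>C hinner F x (\<pi> a y)"
    and "hinner F x (\<pi> (a - b) y) = hinner F x (\<pi> a y) - hinner F x (\<pi> b y)"
    and "hinner F x (\<pi> 0 y) = 0"
    and "hinner F x (\<pi> (r *\<^sub>R a) y) = r *\<^sub>R hinner F x (\<pi> a y)"
proof -
  show 1: "hinner F x (\<pi> (a + b) y) = hinner F x (\<pi> a y) + hinner F x (\<pi> b y)" for a b
    using assms by (simp add: \<pi>_add F.inner_simps)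
  show 2: "hinner F x (\<pi> (c *\<^sub>C a) y) = c *\<^sub>C hinner F x (\<pi> a y)" for c a
    using assms by (simp add: \<pi>_scale F.inner_simps)
  show "hinner F x (\<pi> (a - b) y) = hinner F x (\<pi> a y) - hinner F x (\<pi> b y)"
    using 1[of "a - b" b] by simp
  show "hinner F x (\<pi> 0 y) = 0" using 2[of 0 0] by simp
  show "hinner F x (\<pi> (r *\<^sub>R a) y) = r *\<^sub>R hinner F x (\<pi> a y)" by (simp add: scaleR_scaleC 2)
qed

text \<open>For \<open>c = b / norm b\<close> and the root \<open>k\<close> belonging to
  \<open>star c * c\<close>, the inner squares of \<open>\<pi> c y\<close> and of
  \<open>y - \<pi> k y\<close> add up to that of \<open>y\<close>. The identity operator on
  \<open>F\<close> thus stands in for a unit of \<open>'b\<close>.\<close>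

lemma \<pi>_contractive:
  assumes y: "y \<in> hcarrier F"
  shows "hnorm F (\<pi> b y) \<le> norm b * hnorm F y"
proof (cases "b = 0")
  case True
  then show ?thesis using \<pi>_inner_simps(4)[of "\<pi> 0 y" y] y by (simp add: hnorm_def)
next
  case False
  define c where "c = inverse (norm b) *\<^sub>R b"
  have "norm c = 1" using False by (simp add: c_def)
  then have "star (star c * c) = star c * c" "norm (star c * c) \<le> 1"
    by (simp_all add: star_mult star_star cstar_identity)
  then obtain k where k: "star k = k" "k + k - k * k = star c * c"
    by (rule self_adjoint_root) blast
  have eq: "hinner F y (\<pi> (k + k - k * k) y) = hinner F (\<pi> c y) (\<pi> c y)"
    unfolding k(2) using y by (simp add: \<pi>_star \<pi>_mult)
  have "hinner F (hdiff F y (\<pi> k y)) (hdiff F y (\<pi> k y)) = hinner F y y - hinner F (\<pi> c y) (\<pi> c y)"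
    unfolding eq[symmetric] using y k(1) by (simp add: F.inner_simps \<pi>_inner_simps \<pi>_star \<pi>_mult)
  then have "hinner F y y = hinner F (\<pi> c y) (\<pi> c y) + hinner F (hdiff F y (\<pi> k y)) (hdiff F y (\<pi> k y))"
    by simp
  then have "norm (hinner F (\<pi> c y) (\<pi> c y)) \<le> norm (hinner F y y)"
    using y by (auto intro!: cstar_positive_norm_mono F.inner_positive)
  then have le: "hnorm F (\<pi> c y) \<le> hnorm F y" by (simp add: hnorm_def)
  have "\<pi> b y = hscale F (of_real (norm b)) (\<pi> c y)"
    using y False by (simp add: c_def scaleC_scaleC scaleR_scaleC flip: \<pi>_scale)
  then show ?thesis using y le by (simp add: F.hnorm_scale mult_left_mono)
qed

lemma norm_inner_\<pi>:
  assumes "x \<in> hcarrier F" "y \<in> hcarrier F"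
  shows "norm (hinner F x (\<pi> b y)) \<le> hnorm F x * norm b * hnorm F y"
  using F.cauchy_schwarz[of x "\<pi> b y"] mult_left_mono[OF \<pi>_contractive[OF assms(2)] F.hnorm_nonneg, of x
      b] assms
  by (simp add: mult.assoc)

text \<open>\<open>hsum\<close> runs over initial segments of the naturals only. For an arbitrary
  finite index set it suffices to know the sum vector through its inner products.\<close>

lemma inner_sum_exists:
  assumes "finite I" "\<And>i. i \<in> I \<Longrightarrow> f i \<in> hcarrier F"
  shows "\<exists>w\<in>hcarrier F. \<forall>v\<in>hcarrier F. hinner F v w = (\<Sum>i\<in>I. hinner F v (f i))"
  using assms
proof (induction I rule: finite_induct)
  case empty then show ?case by (intro bexI[of _ "hzero F"]) auto
next
  case (insert a I)
  then obtain w where "w \<in> hcarrier F" "\<forall>v\<in>hcarrier F. hinner F v w = (\<Sum>i\<in>I. hinner F v (f i))" by auto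
  then show ?case using insert by (intro bexI[of _ "hadd F (f a) w"]) (auto simp: F.inner_simps)
qed

text \<open>With \<open>w\<close> the sum of all \<open>\<pi> (g i) (y i)\<close>, the double sum is
  the inner square of \<open>w\<close>.\<close>

lemma gram_rank_one_positive:
  assumes "finite I" and y: "\<And>i. i \<in> I \<Longrightarrow> y i \<in> hcarrier F"
  shows "cstar_positive (\<Sum>i\<in>I. \<Sum>j\<in>I. hinner F (y i) (\<pi> (star (g i) * g j) (y j)))"
proof -
  obtain w where w: "w \<in> hcarrier F" "\<And>v. v \<in> hcarrier F \<Longrightarrow> hinner F v w =
      (\<Sum>i\<in>I. hinner F v (\<pi> (g i) (y i)))"
    using inner_sum_exists[OF assms(1), of "\<lambda>i. \<pi> (g i) (y i)"] y by auto
  have "(\<Sum>j\<in>I. hinner F (y i) (\<pi> (star (g i) * g j) (y j))) = hinner F (\<pi> (g i) (y i)) w" if "i \<in> I"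
      for i
    using that y by (simp add: w \<pi>_mult \<pi>_star)
  also have "hinner F (\<pi> (g i) (y i)) w = star (hinner F w (\<pi> (g i) (y i)))" if "i \<in> I" for i
    using that y w(1) by (simp add: F.inner_star)
  finally have "(\<Sum>i\<in>I. \<Sum>j\<in>I. hinner F (y i) (\<pi> (star (g i) * g j) (y j))) = star (hinner F w w)"
    using w by (simp add: star_sum)
  then show ?thesis using w(1) by (simp add: F.inner_star F.inner_positive)
qed

end

text \<open>For a number \<open>h\<close> in \<open>[0,1]\<close>, \<open>1 - (1 - h)^n\<close> is
  the sum of \<open>(1 - h)^j h\<close> over \<open>j < n\<close>, hence at least
  \<open>n (1 - h)^n h\<close>. The same telescoping is carried out in the cone of squares.\<close>

lemma norm_mult_complement_power:
  fixes H :: "'a::{cstar_algebra, real_normed_algebra_1}"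
  assumes H: "sa_square H" "norm H \<le> 1"
  shows "real n * norm ((1 - H) ^ n * H) \<le> 1"
proof -
  obtain s where s: "star s = s" "s * s = 1 - H" "\<And>c. c * H = H * c \<Longrightarrow> c * s = s * c"
    using root_of_complement[OF sa_square_self_adjoint[OF H(1)] H(2)] unfolding of_real_1 by blast
  obtain k where k: "star k = k" "k * k = H" "\<And>c. c * H = H * c \<Longrightarrow> c * k = k * c"
    using sa_square_commuting_root[OF H(1)] by blast
  have Hs: "H * s = s * H" by (rule s(3)) simp
  have sk: "s * k = k * s" by (rule k(3)) (simp add: Hs)
  have pow: "(1 - H) ^ n = s ^ n * s ^ n" for n
    unfolding s(2)[symmetric] power2_eq_square[symmetric] power_mult[symmetric] mult_2 power_add ..
  have star_pow: "star (s ^ n) = s ^ n" for n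
    by (induction n) (auto simp: star_one star_mult s(1) power_commutes)
  have comm: "s ^ n * k = k * s ^ n" "s ^ n * H = H * s ^ n" for n
    using power_commuting_commutes[OF sk] power_commuting_commutes[OF Hs[symmetric]] by auto
  have e: "(1 - H) ^ n * H = (k * s ^ n) * (k * s ^ n)" for n
  proof -
    have "(k * s ^ n) * (k * s ^ n) = k * (s ^ n * k) * s ^ n" by (simp add: mult.assoc)
    also have "\<dots> = H * (1 - H) ^ n" unfolding comm(1) pow by (simp add: mult.assoc flip: k(2))
    also have "\<dots> = (1 - H) ^ n * H" by (rule power_commuting_commutes[symmetric]) (simp add:
        algebra_simps)
    finally show ?thesis by simp
  qed
  have sq_e: "sa_square ((1 - H) ^ n * H)" for n
    unfolding e by (rule sa_square_square) (simp add: star_mult star_pow k(1) comm)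
  have sq_pow: "sa_square ((1 - H) ^ n)" for n
    unfolding pow by (rule sa_square_square) (simp add: star_pow)
  have "sa_square (1 - (1 - H) ^ n - real n *\<^sub>R ((1 - H) ^ n * H))" for n
  proof (induction n)
    case 0 then show ?case using sa_square_square[of 0] by simp
  next
    case (Suc n)
    have p: "(1 - H) ^ Suc n = (1 - H) ^ n - (1 - H) ^ n * H" by (simp only:
        power_Suc2 right_diff_distrib mult_1_right)
    \<comment> \<open>Passing from \<open>n\<close> to \<open>Suc n\<close> adds
      \<open>Suc n\<close> times \<open>(1 - H)^n H^2\<close>, which is the square of
      \<open>s^n H\<close>.\<close>
    have "1 - (1 - H) ^ Suc n - real (Suc n) *\<^sub>R ((1 - H) ^ Suc n * H)
      = (1 - (1 - H) ^ n - real n *\<^sub>R ((1 - H) ^ n * H)) + real (Suc n) *\<^sub>R ((1 - H) ^ n * H * H)"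
      unfolding p by (simp add: algebra_simps)
    also have "(1 - H) ^ n * H * H = (s ^ n * H) * (s ^ n * H)"
    proof -
      have "(s ^ n * H) * (s ^ n * H) = s ^ n * (H * s ^ n) * H" by (simp only: mult.assoc)
      also have "\<dots> = (1 - H) ^ n * H * H" unfolding comm(2)[symmetric] pow by (simp only: mult.assoc)
      finally show ?thesis ..
    qed
    finally show ?case
      using sa_square_self_adjoint[OF H(1)]
      by (simp only:) (intro sa_square_add Suc.IH sa_square_scaleR sa_square_square, auto simp: star_mult
          star_pow comm)
  qed
  \<comment> \<open>The argument of the norm on the right is 1, split into three squares.\<close>
  then have "norm (real n *\<^sub>R ((1 - H) ^ n * H)) \<le>
      norm (real n *\<^sub>R ((1 - H) ^ n * H) + ((1 - (1 - H) ^ n - real n *\<^sub>R ((1 - H) ^ n * H)) + (1 - H) ^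
          n))"
    by (intro sa_square_norm_mono sa_square_add sa_square_scaleR sq_e sq_pow) auto
  then show ?thesis by simp
qed

text \<open>With \<open>z = x\<^sub>a\<close>, \<open>\<parallel>z\<parallel> \<le> 1\<close> and \<open>p = 1 - z \<langle>z, \<cdot>\<rangle>\<close> one has \<open>p\<^sup>2 = 1 - z \<langle>z, \<cdot>\<rangle> - z' \<langle>z', \<cdot>\<rangle>\<close> where
  \<open>z' = z (1 - \<langle>z, z\<rangle>)\<^sup>1\<^sup>/\<^sup>2\<close>. Replacing every \<open>x\<^sub>i\<close> by \<open>p x\<^sub>i\<close> thus only decreases the Gram form, and
  \<open>p\<^sup>n x\<^sub>a \<rightarrow> 0\<close>, so that the vector \<open>x\<^sub>a\<close> can be eliminated.\<close>

locale deflation = pre_hilbert_module E for E :: "('b::cstar_algebra, 'e) hmod" +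
  fixes z :: 'e
  assumes z [simp]: "z \<in> hcarrier E" and z_le: "hnorm E z \<le> 1"
begin

definition p :: "'e \<Rightarrow> 'e" where "p v = hdiff E v (hact E z (hinner E z v))"

lemma p_closed [simp]: "v \<in> hcarrier E \<Longrightarrow> p v \<in> hcarrier E"
  by (simp add: p_def)

lemma pow_closed [simp]: "v \<in> hcarrier E \<Longrightarrow> (p ^^ n) v \<in> hcarrier E"
  by (induction n) auto

lemma p_symmetric: "v \<in> hcarrier E \<Longrightarrow> w \<in> hcarrier E \<Longrightarrow> hinner E (p v) w = hinner E v (p w)"
  by (simp add: p_def inner_simps inner_star)

lemma pow_symmetric: "v \<in> hcarrier E \<Longrightarrow> w \<in> hcarrier E \<Longrightarrow> hinner E ((p ^^ n) v) w =
    hinner E v ((p ^^ n) w)"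
proof (induction n arbitrary: w)
  case (Suc n)
  then show ?case by (simp add: p_symmetric) (simp add: funpow_swap1)
qed simp

lemma norm_inner_z_le: "norm (hinner E z z) \<le> 1"
  using z_le hnorm_square[of z] by (simp add: power_le_one flip: hnorm_square)

lemma inner_p_decomposition:
  obtains z' where "z' \<in> hcarrier E" "\<And>v w. v \<in> hcarrier E \<Longrightarrow> w \<in> hcarrier E \<Longrightarrow>
    hinner E v w = hinner E (p v) (p w) + star (hinner E z v) * hinner E z w + star (hinner E z' v) *
        hinner E z' w"
proof -
  have "star (hinner E z z) = hinner E z z" by (simp add: inner_star)
  then obtain k where k: "star k = k" "k + k - k * k = hinner E z z"
    using self_adjoint_root[OF _ norm_inner_z_le] by metis
  \<comment> \<open>The witness is \<open>z (1 - k)\<close> written without a unit, where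
    \<open>1 - k\<close> is a root of \<open>1 - <z,z>\<close>.\<close>
  show ?thesis
  proof (rule that[of "hdiff E z (hact E z k)"])
    fix v w assume v: "v \<in> hcarrier E" and w: "w \<in> hcarrier E"
    have "star (hinner E (hdiff E z (hact E z k)) v) * hinner E (hdiff E z (hact E z k)) w
       = hinner E v z * hinner E z w - hinner E v z * (k + k - k * k) * hinner E z w"
      using v w by (simp add: inner_simps star_diff star_mult inner_star k(1) algebra_simps)
    moreover have "hinner E (p v) (p w) = hinner E v w - hinner E v z * hinner E z w - hinner E v z *
        hinner E z w
       + hinner E v z * hinner E z z * hinner E z w"
      using v w by (simp add: p_def inner_simps inner_star algebra_simps)
    ultimately show "hinner E v w = hinner E (p v) (p w) + star (hinner E z v) * hinner E z w
       + star (hinner E (hdiff E z (hact E z k)) v) * hinner E (hdiff E z (hact E z k)) w"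
      using v w by (simp add: k(2) inner_star)
  qed simp
qed

lemma hnorm_p: "v \<in> hcarrier E \<Longrightarrow> hnorm E (p v) \<le> hnorm E v"
proof -
  assume v: "v \<in> hcarrier E"
  obtain z' where z': "z' \<in> hcarrier E" "\<And>v w. v \<in> hcarrier E \<Longrightarrow> w \<in> hcarrier E \<Longrightarrow>
    hinner E v w = hinner E (p v) (p w) + star (hinner E z v) * hinner E z w + star (hinner E z' v) *
        hinner E z' w"
    using inner_p_decomposition by blast
  have "norm (hinner E (p v) (p v)) \<le> norm (hinner E (p v) (p v) +
      (star (hinner E z v) * hinner E z v + star (hinner E z' v) * hinner E z' v))"
    using v by (intro cstar_positive_norm_mono cstar_positive_add cstar_positive_star_mult_self
        inner_positive) auto
  also have "\<dots> = norm (hinner E v v)" using z'(2)[OF v v] by (simp add: add.assoc)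
  finally show ?thesis by (simp add: hnorm_def)
qed

lemma hnorm_pow: "v \<in> hcarrier E \<Longrightarrow> hnorm E ((p ^^ n) v) \<le> hnorm E v"
  by (induction n) (auto intro: order_trans[OF hnorm_p])

text \<open>In the unitization \<open><z, p^n z> = (1 - H)^n H\<close> for \<open>H = <z,z>\<close>.
  By symmetry of \<open>p\<close>, the square of the norm of \<open>p^n z\<close> is the norm of
  \<open><z, p^(2n) z>\<close>, at most \<open>1 / (2n)\<close> for positive
  \<open>n\<close>.\<close>

lemma pow_z_tendsto_0: "(\<lambda>n. hnorm E ((p ^^ n) z)) \<longlonglongrightarrow> 0"
proof -
  let ?H = "Unitize 0 (hinner E z z)"
  have c: "Unitize 0 (hinner E z ((p ^^ n) z)) = (1 - ?H) ^ n * ?H" for n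
  proof (induction n)
    case (Suc n)
    have "hinner E z ((p ^^ Suc n) z) = hinner E z ((p ^^ n) z) - hinner E z z * hinner E z ((p ^^ n) z)"
      by (simp add: p_def inner_simps)
    then have "Unitize 0 (hinner E z ((p ^^ Suc n) z)) = (1 - ?H) * Unitize 0 (hinner E z ((p ^^ n) z))"
      by (simp add: minus_unitization_def times_unitization_def one_unitization_def)
    then show ?case by (simp add: Suc mult.assoc)
  qed simp
  have sq: "sa_square ?H" using inner_positive[OF z] by (simp add: cstar_positive_iff_sa_square)
  have le2: "real (n + n) * (hnorm E ((p ^^ n) z))\<^sup>2 \<le> 1" for n
  proof -
    have "(hnorm E ((p ^^ n) z))\<^sup>2 = norm (Unitize 0 (hinner E z ((p ^^ (n + n)) z)))"
      by (simp add: hnorm_square pow_symmetric funpow_add norm_Unitize_0)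
    also have "real (n + n) * \<dots> \<le> 1" unfolding c
      by (rule norm_mult_complement_power[OF sq]) (simp add: norm_Unitize_0 norm_inner_z_le)
    finally show ?thesis .
  qed
  have le: "(hnorm E ((p ^^ Suc n) z))\<^sup>2 \<le> inverse (real (Suc n))" for n
  proof -
    have "real (Suc n) * (hnorm E ((p ^^ Suc n) z))\<^sup>2 \<le> 1"
      by (rule order_trans[OF mult_right_mono le2]) auto
    then show ?thesis by (simp add: field_simps del: funpow.simps)
  qed
  have "(\<lambda>n. sqrt ((hnorm E ((p ^^ Suc n) z))\<^sup>2)) \<longlonglongrightarrow> sqrt 0"
    by (intro tendsto_real_sqrt tendsto_0_if_le[OF LIMSEQ_inverse_real_of_nat le]) simp
  then have "(\<lambda>n. hnorm E ((p ^^ Suc n) z)) \<longlonglongrightarrow> 0" by (simp del: funpow.simps)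
  then show ?thesis by (rule LIMSEQ_imp_Suc)
qed

end

context star_representation
begin

abbreviation gram :: "('b, 'e) hmod \<Rightarrow> 'i set \<Rightarrow> ('i \<Rightarrow> 'e) \<Rightarrow> ('i \<Rightarrow> 'f) \<Rightarrow> 'c" where
  "gram E I x y \<equiv> (\<Sum>i\<in>I. \<Sum>j\<in>I. hinner F (y i) (\<pi> (hinner E (x i) (x j)) (y j)))"

text \<open>This is positivity of the matrix of all \<open><x_i, x_j>\<close> after applying \<pi>,
  tested on the \<open>y_i\<close>. The induction keeps \<open>x\<close> arbitrary because its
  hypothesis is used for the deflated vectors \<open>p^n x_i\<close>, not for the \<open>x_i\<close>
  themselves.\<close>

lemma gram_positive:
  assumes E: "pre_hilbert_module E" and I: "finite I"
    and "\<And>i. i \<in> I \<Longrightarrow> x i \<in> hcarrier E" "\<And>i. i \<in> I \<Longrightarrow> y i \<in> hcarrier F"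
  shows "cstar_positive (gram E I x y)"
  using I assms(3,4)
proof (induction I arbitrary: x rule: finite_induct)
  case empty
  then show ?case by (simp add: cstar_positive_0)
next
  case (insert a I)
  interpret E: pre_hilbert_module E by fact
  have main: "cstar_positive (gram E (insert a I) x y)"
    if x: "\<And>i. i \<in> insert a I \<Longrightarrow> x i \<in> hcarrier E" and le: "hnorm E (x a) \<le> 1" for x
  proof -
    interpret deflation E "x a" by unfold_locales (use x le in auto)
    have step: "cstar_positive (gram E (insert a I) v y - gram E (insert a I) (\<lambda>i. p (v i)) y)"
      if v: "\<And>i. i \<in> insert a I \<Longrightarrow> v i \<in> hcarrier E" for v
    proof -
      obtain z' where z': "z' \<in> hcarrier E" "\<And>v w. v \<in> hcarrier E \<Longrightarrow> w \<in> hcarrier E \<Longrightarrow>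
        hinner E v w = hinner E (p v) (p w) + star (hinner E (x a) v) * hinner E (x a) w + star (hinner E
            z' v) * hinner E z' w"
        using inner_p_decomposition by blast
      have "hinner F (y i) (\<pi> (hinner E (v i) (v j)) (y j)) =
          hinner F (y i) (\<pi> (hinner E (p (v i)) (p (v j))) (y j))
          + hinner F (y i) (\<pi> (star (hinner E (x a) (v i)) * hinner E (x a) (v j)) (y j))
          + hinner F (y i) (\<pi> (star (hinner E z' (v i)) * hinner E z' (v j)) (y j))"
        if "i \<in> insert a I" "j \<in> insert a I" for i j
        using z'(2)[OF v[OF that(1)] v[OF that(2)]] that insert.prems(2) by (simp add: \<pi>_inner_simps)
      then have "gram E (insert a I) v y = gram E (insert a I) (\<lambda>i. p (v i)) y
          + (\<Sum>i\<in>insert a I. \<Sum>j\<in>insert a I. hinner F (y i) (\<pi> (star (hinner E (x a) (v i)) * hinner E (x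
              a) (v j)) (y j)))
          + (\<Sum>i\<in>insert a I. \<Sum>j\<in>insert a I. hinner F (y i) (\<pi> (star (hinner E z' (v i)) * hinner E z' (v
              j)) (y j)))"
        by (simp only: sum.distrib cong: sum.cong)
      moreover have "finite (insert a I)" using insert.hyps by simp
      ultimately show ?thesis
        using gram_rank_one_positive[of "insert a I" y "\<lambda>i. hinner E (x a) (v i)"]
          gram_rank_one_positive[of "insert a I" y "\<lambda>i. hinner E z' (v i)"] insert.prems(2)
        by (simp only: add_diff_eq add_diff_cancel_left' add.assoc cstar_positive_add)
    qed
    have pn: "cstar_positive (gram E (insert a I) x y - gram E (insert a I) (\<lambda>i. (p ^^ n) (x i)) y)"
        for n
    proof (induction n)
      case (Suc n)
      show ?case
        using cstar_positive_add[OF Suc step[of "\<lambda>i. (p ^^ n) (x i)"]] x by simp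
    qed (simp add: cstar_positive_0)
    \<comment> \<open>The part of the deflated form that involves the index \<open>a\<close>. Each
      of its terms contains \<open>p^n x_a\<close>, while the other factors stay bounded since
      \<open>p\<close> is contractive; hence it tends to 0.\<close>
    define err where "err n = gram E (insert a I) (\<lambda>i. (p ^^ n) (x i)) y - gram E I (\<lambda>i. (p ^^ n) (x i))
        y" for n
    define C where "C = hnorm F (y a) * hnorm E (x a) * hnorm F (y a)
       + ((\<Sum>j\<in>I. hnorm F (y a) * hnorm E (x j) * hnorm F (y j)) + (\<Sum>i\<in>I. hnorm F (y i) * hnorm E (x i) *
           hnorm F (y a)))"
    have b1: "norm (hinner F (y i) (\<pi> (hinner E ((p ^^ n) (x a)) ((p ^^ n) (x j))) (y j')))
        \<le> hnorm E ((p ^^ n) (x a)) * (hnorm F (y i) * hnorm E (x j) * hnorm F (y j'))"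
      if "i \<in> insert a I" "j \<in> insert a I" "j' \<in> insert a I" for i j j' n
    proof -
      have "norm (hinner E ((p ^^ n) (x a)) ((p ^^ n) (x j))) \<le> hnorm E ((p ^^ n) (x a)) * hnorm E (x j)"
        using that x by (intro order_trans[OF E.cauchy_schwarz] mult_left_mono hnorm_pow) auto
      then have "hnorm F (y i) * norm (hinner E ((p ^^ n) (x a)) ((p ^^ n) (x j))) * hnorm F (y j') \<le>
        hnorm F (y i) * (hnorm E ((p ^^ n) (x a)) * hnorm E (x j)) * hnorm F (y j')"
        by (intro mult_left_mono mult_right_mono) auto
      then show ?thesis
        using norm_inner_\<pi>[of "y i" "y j'" "hinner E ((p ^^ n) (x a)) ((p ^^ n) (x j))"] insert.prems(2)
            that
        by (simp add: mult_ac)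
    qed
    have b2: "norm (hinner F (y i) (\<pi> (hinner E ((p ^^ n) (x i)) ((p ^^ n) (x a))) (y a)))
        \<le> hnorm E ((p ^^ n) (x a)) * (hnorm F (y i) * hnorm E (x i) * hnorm F (y a))" if i: "i \<in> I"
            for i n
    proof -
      have "norm (hinner E ((p ^^ n) (x i)) ((p ^^ n) (x a))) =
          norm (hinner E ((p ^^ n) (x a)) ((p ^^ n) (x i)))"
        using x i by (subst E.inner_star[symmetric]) auto
      also have "\<dots> \<le> hnorm E ((p ^^ n) (x a)) * hnorm E (x i)"
        using i x by (intro order_trans[OF E.cauchy_schwarz] mult_left_mono hnorm_pow) auto
      finally have "hnorm F (y i) * norm (hinner E ((p ^^ n) (x i)) ((p ^^ n) (x a))) * hnorm F (y a) \<le>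
        hnorm F (y i) * (hnorm E ((p ^^ n) (x a)) * hnorm E (x i)) * hnorm F (y a)"
        by (intro mult_left_mono mult_right_mono) auto
      then show ?thesis
        using norm_inner_\<pi>[of "y i" "y a" "hinner E ((p ^^ n) (x i)) ((p ^^ n) (x a))"] insert.prems(2) i
        by (simp add: mult_ac)
    qed
    have err_eq: "err n = hinner F (y a) (\<pi> (hinner E ((p ^^ n) (x a)) ((p ^^ n) (x a))) (y a))
        + ((\<Sum>j\<in>I. hinner F (y a) (\<pi> (hinner E ((p ^^ n) (x a)) ((p ^^ n) (x j))) (y j)))
        + (\<Sum>i\<in>I. hinner F (y i) (\<pi> (hinner E ((p ^^ n) (x i)) ((p ^^ n) (x a))) (y a))))" for n
      using insert.hyps by (simp add: err_def sum.distrib algebra_simps)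
    have "norm (err n) \<le> hnorm E ((p ^^ n) (x a)) * C" for n
      unfolding err_eq C_def distrib_left sum_distrib_left
      by (intro norm_triangle_mono sum_norm_le b1 b2) auto
    then have "(\<lambda>n. norm (err n)) \<longlonglongrightarrow> 0"
      by (rule tendsto_0_if_le[OF tendsto_mult_left_zero[OF pow_z_tendsto_0]]) simp
    then have "err \<longlonglongrightarrow> 0" by (rule tendsto_norm_zero_cancel)
    then have "(\<lambda>n. gram E (insert a I) x y - err n) \<longlonglongrightarrow> gram E (insert a I) x y - 0"
      by (intro tendsto_diff tendsto_const)
    \<comment> \<open>The decrease of the form under \<open>p^n\<close>, positive by
      \<open>pn\<close>, plus the deflated form over \<open>I\<close>, positive by the induction
      hypothesis. As \<open>err\<close> vanishes in the limit, closedness of the cone finishes the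
      argument.\<close>
    moreover have "cstar_positive (gram E (insert a I) x y - err n)" for n
    proof -
      have "gram E (insert a I) x y - err n = (gram E (insert a I) x y - gram E (insert a I) (\<lambda>i. (p ^^
          n) (x i)) y)
          + gram E I (\<lambda>i. (p ^^ n) (x i)) y" unfolding err_def
              by (rule diff_diff_eq2[THEN trans]) (rule diff_add_eq[symmetric])
      then show ?thesis
        using x insert.prems(2) by (simp only:) (intro cstar_positive_add pn insert.IH pow_closed, auto)
    qed
    ultimately show ?thesis using cstar_positive_closed by fastforce
  qed
  \<comment> \<open>Scaling all vectors by \<open>r\<close> multiplies the form by
    \<open>r * r\<close> and brings \<open>x a\<close> into the unit ball required for the
    deflation; the \<open>+ 1\<close> admits a null vector.\<close>
  define r where "r = inverse (hnorm E (x a) + 1)"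
  have r: "r > 0" using E.hnorm_nonneg[of "x a"] by (auto simp: r_def simp del: E.hnorm_nonneg)
  have "hnorm E (hscale E (of_real r) (x a)) \<le> 1"
    using insert.prems(1)[of a] r E.hnorm_nonneg[of "x a"]
    by (simp add: E.hnorm_scale) (simp add: r_def field_simps)
  then have "cstar_positive (gram E (insert a I) (\<lambda>i. hscale E (of_real r) (x i)) y)"
    using insert.prems(1) by (intro main) auto
  moreover have "gram E (insert a I) (\<lambda>i. hscale E (of_real r) (x i)) y
      = (\<Sum>i\<in>insert a I. \<Sum>j\<in>insert a I. (r * r) *\<^sub>R hinner F (y i) (\<pi> (hinner E (x i) (x j)) (y j)))"
    using insert.prems
    by (intro sum.cong refl) (simp add: E.inner_simps \<pi>_inner_simps scaleC_scaleC scaleR_scaleC)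
  then have "gram E (insert a I) (\<lambda>i. hscale E (of_real r) (x i)) y =
      (r * r) *\<^sub>R gram E (insert a I) x y"
    by (simp only: scaleR_sum_right)
  ultimately have "cstar_positive (inverse (r * r) *\<^sub>R ((r * r) *\<^sub>R gram E (insert a I) x y))"
    using r by (intro cstar_positive_scaleR[of "(r * r) *\<^sub>R gram E (insert a I) x y"]) simp_all
  moreover have "inverse (r * r) *\<^sub>R ((r * r) *\<^sub>R gram E (insert a I) x y) = gram E (insert a I) x y"
  proof -
    have "inverse (r * r) * (r * r) = 1" using r by (intro left_inverse) auto
    then show ?thesis by (simp only: scaleR_scaleR scaleR_one)
  qed
  ultimately show ?case by (simp only:)
qed

end

section \<open>The balanced tensor product\<close>

lemma keys_formal_scale: "Poly_Mapping.keys (formal_scale c u) \<subseteq> Poly_Mapping.keys u"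
  by (auto simp: in_keys_iff lookup_formal_scale)

lemma formal_scale_single: "formal_scale c (Poly_Mapping.single p a) = Poly_Mapping.single p (c * a)"
  by (rule poly_mapping_eqI) (simp add: lookup_formal_scale lookup_single when_def)

lemma formal_sum_single: "(\<Sum>p\<in>Poly_Mapping.keys u. Poly_Mapping.single p (Poly_Mapping.lookup u p)) = u"
proof (rule poly_mapping_eqI)
  fix q
  show "Poly_Mapping.lookup (\<Sum>p\<in>Poly_Mapping.keys u. Poly_Mapping.single p (Poly_Mapping.lookup u p)) q =
      Poly_Mapping.lookup u q"
    by (cases "q \<in> Poly_Mapping.keys u") (auto simp: lookup_sum lookup_single when_def in_keys_iff)
qed

lemma subspace_formal_carrier: "formal.subspace (formal_carrier E F)"
proof (rule formal.subspaceI)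
  show "u + v \<in> formal_carrier E F" if "u \<in> formal_carrier E F" "v \<in> formal_carrier E F" for u v
    using that keys_add[of u v] by (auto simp: formal_carrier_def)
  show "formal_scale c u \<in> formal_carrier E F" if "u \<in> formal_carrier E F" for c u
    using that keys_formal_scale[of c u] by (auto simp: formal_carrier_def)
qed (simp add: formal_carrier_def)

lemma formal_tensor_in_carrier:
  "x \<in> hcarrier E \<Longrightarrow> y \<in> hcarrier F \<Longrightarrow> formal_tensor x y \<in> formal_carrier E F"
  by (simp add: formal_carrier_def)

lemma formal_carrier_subset:
  assumes "formal.subspace S" "\<And>x y. x \<in> hcarrier E \<Longrightarrow> y \<in> hcarrier F \<Longrightarrow> formal_tensor x y \<in> S"
  shows "formal_carrier E F \<subseteq> S"
proof
  fix u assume u: "u \<in> formal_carrier E F"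
  have "(\<Sum>p\<in>Poly_Mapping.keys u. formal_scale (Poly_Mapping.lookup u p) (formal_tensor (fst p) (snd p)))
      \<in> S"
    using u by (intro formal.subspace_sum formal.subspace_scale assms) (auto simp: formal_carrier_def)
  then show "u \<in> S" by (simp add: formal_scale_single formal_sum_single)
qed

lemma formal_carrier_induct [consumes 1, case_names zero add scale tensor]:
  assumes "u \<in> formal_carrier E F" "P 0" "\<And>u v. P u \<Longrightarrow> P v \<Longrightarrow> P (u + v)" "\<And>c u. P u \<Longrightarrow> P (formal_scale c u)"
    "\<And>x y. x \<in> hcarrier E \<Longrightarrow> y \<in> hcarrier F \<Longrightarrow> P (formal_tensor x y)"
  shows "P u"
proof -
  have "formal_carrier E F \<subseteq> {u. P u}"
    by (rule formal_carrier_subset) (auto intro: assms formal.subspaceI)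
  then show ?thesis using assms(1) by auto
qed

text \<open>The linear map induced by a map of basis vectors. It covers both the right action and
  \<open>T \<otimes> I\<close>, so that linearity is proved once.\<close>

definition formal_lift :: "('e \<times> 'f \<Rightarrow> 'g \<times> 'h) \<Rightarrow> ('e, 'f) formal \<Rightarrow> ('g, 'h) formal" where
  "formal_lift h u = (\<Sum>p\<in>Poly_Mapping.keys u. Poly_Mapping.single (h p) (Poly_Mapping.lookup u p))"

text \<open>The support of a sum may be smaller than the union of the supports. Additivity therefore
  compares all sums over a common finite superset; \<open>formal_inner_superset\<close> has the same
  purpose.\<close>

lemma formal_lift_superset:
  assumes "finite S" "Poly_Mapping.keys u \<subseteq> S"
  shows "formal_lift h u = (\<Sum>p\<in>S. Poly_Mapping.single (h p) (Poly_Mapping.lookup u p))"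
  unfolding formal_lift_def using assms by (intro sum.mono_neutral_left) (auto simp: in_keys_iff)

lemma formal_lift_add: "formal_lift h (u + v) = formal_lift h u + formal_lift h v"
proof -
  let ?S = "Poly_Mapping.keys u \<union> Poly_Mapping.keys v"
  show ?thesis
    by (simp add: formal_lift_superset[of ?S] keys_add lookup_add single_add sum.distrib)
qed

lemma formal_lift_scale: "formal_lift h (formal_scale c u) = formal_scale c (formal_lift h u)"
  by (simp add: formal_lift_superset[OF _ keys_formal_scale])
     (simp add: formal_lift_def formal.scale_sum_right formal_scale_single lookup_formal_scale)

lemma formal_lift_tensor: "formal_lift h (formal_tensor x y) = Poly_Mapping.single (h (x, y)) 1"
  by (simp add: formal_lift_def)

lemma formal_lift_0 [simp]: "formal_lift h 0 = 0"
  by (simp add: formal_lift_def)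

lemma formal_lift_diff: "formal_lift h (u - v) = formal_lift h u - formal_lift h v"
  using formal_lift_add[of h "u - v" v] by (simp add: eq_diff_eq)

lemma formal_act_eq_lift: "formal_act F u c = formal_lift (\<lambda>p. (fst p, hact F (snd p) c)) u"
  by (simp add: formal_act_def formal_lift_def)

lemma formal_inner_superset:
  assumes "finite S" "Poly_Mapping.keys u \<subseteq> S" "finite T" "Poly_Mapping.keys v \<subseteq> T"
  shows "formal_inner E F \<pi> u v = (\<Sum>p\<in>S. \<Sum>q\<in>T.
        (cnj (Poly_Mapping.lookup u p) * Poly_Mapping.lookup v q) *\<^sub>C
        hinner F (snd p) (\<pi> (hinner E (fst p) (fst q)) (snd q)))"
proof -
  have "formal_inner E F \<pi> u v = (\<Sum>p\<in>Poly_Mapping.keys u. \<Sum>q\<in>T.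
        (cnj (Poly_Mapping.lookup u p) * Poly_Mapping.lookup v q) *\<^sub>C
        hinner F (snd p) (\<pi> (hinner E (fst p) (fst q)) (snd q)))"
    unfolding formal_inner_def using assms
    by (intro sum.cong refl sum.mono_neutral_left) (auto simp: in_keys_iff)
  also have "\<dots> = (\<Sum>p\<in>S. \<Sum>q\<in>T.
        (cnj (Poly_Mapping.lookup u p) * Poly_Mapping.lookup v q) *\<^sub>C
        hinner F (snd p) (\<pi> (hinner E (fst p) (fst q)) (snd q)))"
    using assms by (intro sum.mono_neutral_left) (auto simp: in_keys_iff)
  finally show ?thesis .
qed

lemma formal_inner_add_right: "formal_inner E F \<pi> u (v + w) =
    formal_inner E F \<pi> u v + formal_inner E F \<pi> u w"
proof -
  let ?T = "Poly_Mapping.keys v \<union> Poly_Mapping.keys w"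
  show ?thesis
    by (simp add: formal_inner_superset[of "Poly_Mapping.keys u" u ?T] keys_add lookup_add
        distrib_left scaleC_add_left sum.distrib)
qed

lemma formal_inner_add_left: "formal_inner E F \<pi> (v + w) u = formal_inner E F \<pi> v u + formal_inner E F \<pi>
    w u"
proof -
  let ?T = "Poly_Mapping.keys v \<union> Poly_Mapping.keys w"
  show ?thesis
    by (simp add: formal_inner_superset[of ?T _ "Poly_Mapping.keys u" u] keys_add lookup_add
        distrib_right scaleC_add_left sum.distrib)
qed

lemma formal_inner_scale_right: "formal_inner E F \<pi> u (formal_scale c v) = c *\<^sub>C formal_inner E F \<pi> u v"
  by (simp add: formal_inner_superset[OF _ order_refl _ keys_formal_scale])
     (simp add: formal_inner_def scaleC_sum_right scaleC_scaleC lookup_formal_scale mult_ac)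

lemma formal_inner_scale_left: "formal_inner E F \<pi> (formal_scale c v) u =
    cnj c *\<^sub>C formal_inner E F \<pi> v u"
  by (simp add: formal_inner_superset[OF _ keys_formal_scale _ order_refl])
     (simp add: formal_inner_def scaleC_sum_right scaleC_scaleC lookup_formal_scale mult_ac)

lemma formal_inner_0 [simp]: "formal_inner E F \<pi> u 0 = 0" "formal_inner E F \<pi> 0 u = 0"
  by (simp_all add: formal_inner_def)

lemma formal_inner_diff_right: "formal_inner E F \<pi> u (v - w) =
    formal_inner E F \<pi> u v - formal_inner E F \<pi> u w"
  using formal_inner_add_right[of E F \<pi> u "v - w" w] by (simp add: eq_diff_eq)

lemma formal_inner_diff_left: "formal_inner E F \<pi> (v - w) u =
    formal_inner E F \<pi> v u - formal_inner E F \<pi> w u"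
  using formal_inner_add_left[of E F \<pi> "v - w" w u] by (simp add: eq_diff_eq)

lemma formal_inner_tensor:
  "formal_inner E F \<pi> (formal_tensor x y) (formal_tensor x' y') = hinner F y (\<pi> (hinner E x x') y')"
  by (simp add: formal_inner_def)

locale balanced = star_representation F \<pi> + E: pre_hilbert_module E
  for E :: "('b::cstar_algebra, 'e) hmod" and F :: "('c::cstar_algebra, 'f) hmod" and \<pi> :: "'b \<Rightarrow> 'f \<Rightarrow> 'f"
begin

abbreviation "relation_span \<equiv> formal.span (tensor_relations E F \<pi>)"

lemma tensor_relations_cases:
  assumes "r \<in> tensor_relations E F \<pi>"
    and "\<And>x x' y. x \<in> hcarrier E \<Longrightarrow> x' \<in> hcarrier E \<Longrightarrow> y \<in> hcarrier F \<Longrightarrow>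
      P (formal_tensor (hadd E x x') y - formal_tensor x y - formal_tensor x' y)"
    and "\<And>x y y'. x \<in> hcarrier E \<Longrightarrow> y \<in> hcarrier F \<Longrightarrow> y' \<in> hcarrier F \<Longrightarrow>
      P (formal_tensor x (hadd F y y') - formal_tensor x y - formal_tensor x y')"
    and "\<And>c x y. x \<in> hcarrier E \<Longrightarrow> y \<in> hcarrier F \<Longrightarrow>
      P (formal_tensor (hscale E c x) y - formal_scale c (formal_tensor x y))"
    and "\<And>c x y. x \<in> hcarrier E \<Longrightarrow> y \<in> hcarrier F \<Longrightarrow>
      P (formal_tensor x (hscale F c y) - formal_scale c (formal_tensor x y))"
    and "\<And>b x y. x \<in> hcarrier E \<Longrightarrow> y \<in> hcarrier F \<Longrightarrow>
      P (formal_tensor (hact E x b) y - formal_tensor x (\<pi> b y))"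
  shows "P r"
  using assms(1) unfolding tensor_relations_def Un_iff mem_Collect_eq
  by (elim disjE exE conjE) (simp_all add: assms(2-))

lemma relation_intros:
  "\<lbrakk>x \<in> hcarrier E; x' \<in> hcarrier E; y \<in> hcarrier F\<rbrakk> \<Longrightarrow>
      formal_tensor (hadd E x x') y - formal_tensor x y - formal_tensor x' y \<in> relation_span"
  "\<lbrakk>x \<in> hcarrier E; y \<in> hcarrier F; y' \<in> hcarrier F\<rbrakk> \<Longrightarrow>
      formal_tensor x (hadd F y y') - formal_tensor x y - formal_tensor x y' \<in> relation_span"
  "\<lbrakk>x \<in> hcarrier E; y \<in> hcarrier F\<rbrakk> \<Longrightarrow>
      formal_tensor (hscale E c x) y - formal_scale c (formal_tensor x y) \<in> relation_span"
  "\<lbrakk>x \<in> hcarrier E; y \<in> hcarrier F\<rbrakk> \<Longrightarrow>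
      formal_tensor x (hscale F c y) - formal_scale c (formal_tensor x y) \<in> relation_span"
  "\<lbrakk>x \<in> hcarrier E; y \<in> hcarrier F\<rbrakk> \<Longrightarrow>
      formal_tensor (hact E x b) y - formal_tensor x (\<pi> b y) \<in> relation_span"
  by (rule formal.span_base; unfold tensor_relations_def; blast)+

lemma relation_span_subset:
  assumes S: "formal.subspace S" and "\<And>r. r \<in> tensor_relations E F \<pi> \<Longrightarrow> r \<in> S"
  shows "relation_span \<subseteq> S"
  by (rule formal.span_minimal[OF _ S]) (use assms(2) in auto)

lemma relation_span_carrier: "relation_span \<subseteq> formal_carrier E F"
proof (rule relation_span_subset[OF subspace_formal_carrier])
  fix r assume "r \<in> tensor_relations E F \<pi>"
  then show "r \<in> formal_carrier E F"
    by (rule tensor_relations_cases)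
      (auto intro!: formal.subspace_diff[OF subspace_formal_carrier] formal.subspace_scale[OF
          subspace_formal_carrier]
        formal_tensor_in_carrier)
qed

lemma formal_inner_star:
  assumes "u \<in> formal_carrier E F" "v \<in> formal_carrier E F"
  shows "star (formal_inner E F \<pi> u v) = formal_inner E F \<pi> v u"
proof -
  have s: "star (hinner F y (\<pi> (hinner E x x') y')) = hinner F y' (\<pi> (hinner E x' x) y)"
    if "x \<in> hcarrier E" "x' \<in> hcarrier E" "y \<in> hcarrier F" "y' \<in> hcarrier F" for x x' y y'
    using that by (simp add: F.inner_star \<pi>_star E.inner_star)
  show ?thesis
    unfolding formal_inner_def star_sum using assms
    by (subst sum.swap) (auto intro!: sum.cong simp: star_scaleC s formal_carrier_def mult.commute
        subset_iff mem_Times_iff)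
qed

lemma formal_inner_relation_right:
  assumes u: "u \<in> formal_carrier E F" and r: "r \<in> relation_span"
  shows "formal_inner E F \<pi> u r = 0"
proof -
  have "r \<in> {r. formal_inner E F \<pi> u r = 0}" if "r \<in> tensor_relations E F \<pi>" for r
    using u
  proof (induction rule: formal_carrier_induct)
    case (tensor x y)
    show ?case using that
      by (rule tensor_relations_cases)
        (use tensor in \<open>simp_all add: formal_inner_diff_right formal_inner_scale_right
            formal_inner_tensor
          E.inner_simps F.inner_simps \<pi>_inner_simps \<pi>_linear \<pi>_mult\<close>)
  qed (auto simp: formal_inner_add_left formal_inner_scale_left)
  then have "relation_span \<subseteq> {r. formal_inner E F \<pi> u r = 0}"
    by (intro relation_span_subset formal.subspaceI)
      (auto simp: formal_inner_add_right formal_inner_scale_right)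
  then show ?thesis using r by blast
qed

lemma formal_inner_relation_left:
  "u \<in> formal_carrier E F \<Longrightarrow> r \<in> relation_span \<Longrightarrow> formal_inner E F \<pi> r u = 0"
  using formal_inner_star[of u r] formal_inner_relation_right[of u r] relation_span_carrier by auto

lemma formal_act_relation:
  assumes r: "r \<in> relation_span"
  shows "formal_act F r c \<in> relation_span"
proof -
  have "relation_span \<subseteq> {r. formal_act F r c \<in> relation_span}"
  proof (rule relation_span_subset)
    fix r assume "r \<in> tensor_relations E F \<pi>"
    then show "r \<in> {r. formal_act F r c \<in> relation_span}"
      by (rule tensor_relations_cases)
        (simp_all add: formal_act_eq_lift formal_lift_diff formal_lift_scale formal_lift_tensor
          F.act_add_left F.act_scale_left relation_intros flip: \<pi>_linear(3))
  qed (auto intro!: formal.subspaceI formal.span_add formal.span_scale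
      simp: formal_act_eq_lift formal_lift_add formal_lift_scale formal.span_zero)
  then show ?thesis using r by auto
qed

lemma tensor_coset_eq_iff: "tensor_coset E F \<pi> u = tensor_coset E F \<pi> v \<longleftrightarrow> u - v \<in> relation_span"
proof
  assume "tensor_coset E F \<pi> u = tensor_coset E F \<pi> v"
  moreover have "u \<in> tensor_coset E F \<pi> u" by (simp add: tensor_coset_def formal.span_zero)
  ultimately show "u - v \<in> relation_span" by (simp add: tensor_coset_def)
next
  assume uv: "u - v \<in> relation_span"
  have "w - u \<in> relation_span \<longleftrightarrow> w - v \<in> relation_span" for w
    using formal.span_add[OF _ uv, of "w - u"] formal.span_diff[OF _ uv, of "w - v"] by auto
  then show "tensor_coset E F \<pi> u = tensor_coset E F \<pi> v" by (simp add: tensor_coset_def)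
qed

lemma some_rep_coset: "some_rep (tensor_coset E F \<pi> u) - u \<in> relation_span"
proof -
  have "u \<in> tensor_coset E F \<pi> u" by (simp add: tensor_coset_def formal.span_zero)
  then have "some_rep (tensor_coset E F \<pi> u) \<in> tensor_coset E F \<pi> u"
    unfolding some_rep_def by (rule someI[where P = "\<lambda>w. w \<in> tensor_coset E F \<pi> u"])
  then show ?thesis by (simp add: tensor_coset_def)
qed

lemma some_rep_coset_carrier:
  assumes "u \<in> formal_carrier E F"
  shows "some_rep (tensor_coset E F \<pi> u) \<in> formal_carrier E F"
  using formal.subspace_add[OF subspace_formal_carrier subsetD[OF relation_span_carrier some_rep_coset[of
      u]] assms]
  by simp

abbreviation "M \<equiv> balanced_tensor E F \<pi>"
abbreviation "coset \<equiv> tensor_coset E F \<pi>"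

lemma balanced_carrier: "hcarrier M = coset ` formal_carrier E F"
  and balanced_zero: "hzero M = coset 0"
  by (simp_all add: balanced_tensor_def)

lemma balanced_add: "hadd M (coset u) (coset v) = coset (u + v)"
  using formal.span_add[OF some_rep_coset[of u] some_rep_coset[of v]]
  by (simp add: balanced_tensor_def tensor_coset_eq_iff algebra_simps)

lemma balanced_scale: "hscale M c (coset u) = coset (formal_scale c u)"
  using formal.span_scale[OF some_rep_coset[of u], of c]
  by (simp add: balanced_tensor_def tensor_coset_eq_iff formal.scale_right_diff_distrib)

lemma balanced_act: "hact M (coset u) c = coset (formal_act F u c)"
  using formal_act_relation[OF some_rep_coset[of u], of c]
  by (simp add: balanced_tensor_def tensor_coset_eq_iff formal_act_eq_lift formal_lift_diff)

lemma balanced_inner: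
  assumes u: "u \<in> formal_carrier E F" and v: "v \<in> formal_carrier E F"
  shows "hinner M (coset u) (coset v) = formal_inner E F \<pi> u v"
proof -
  have "formal_inner E F \<pi> (some_rep (coset u)) (some_rep (coset v)) - formal_inner E F \<pi> u v
    = formal_inner E F \<pi> (some_rep (coset u) - u) (some_rep (coset v)) + formal_inner E F \<pi> u (some_rep
        (coset v) - v)"
    by (simp add: formal_inner_diff_left formal_inner_diff_right)
  then show ?thesis
    using formal_inner_relation_left[OF some_rep_coset_carrier[OF v] some_rep_coset[of u]]
      formal_inner_relation_right[OF u some_rep_coset[of v]]
    by (simp add: balanced_tensor_def)
qed

lemma formal_act_carrier: "u \<in> formal_carrier E F \<Longrightarrow> formal_act F u c \<in> formal_carrier E F"
  by (induction rule: formal_carrier_induct)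
    (auto simp: formal_act_eq_lift formal_lift_add formal_lift_scale formal_lift_tensor
        formal_tensor_in_carrier
      formal.subspace_0[OF subspace_formal_carrier]
      intro: formal.subspace_add[OF subspace_formal_carrier] formal.subspace_scale[OF
          subspace_formal_carrier])

text \<open>Absorbing each coefficient into the second component of its pair turns the form into a
  Gram form indexed by the support of \<open>u\<close>.\<close>

lemma formal_inner_positive:
  assumes "u \<in> formal_carrier E F"
  shows "cstar_positive (formal_inner E F \<pi> u u)"
proof -
  have "formal_inner E F \<pi> u u = gram E (Poly_Mapping.keys u) fst (\<lambda>p. hscale F (Poly_Mapping.lookup u p)
      (snd p))"
    unfolding formal_inner_def using assms
    by (intro sum.cong refl)
      (auto simp: formal_carrier_def F.inner_simps \<pi>_linear scaleC_scaleC subset_iff mem_Times_iff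
          mult.commute)
  also have "cstar_positive \<dots>"
    using assms by (intro gram_positive E.pre_hilbert_module_axioms) (auto simp: formal_carrier_def)
  finally show ?thesis .
qed

lemma formal_inner_act:
  assumes "u \<in> formal_carrier E F" "v \<in> formal_carrier E F"
  shows "formal_inner E F \<pi> u (formal_act F v c) = formal_inner E F \<pi> u v * c"
  using assms(2)
proof (induction rule: formal_carrier_induct)
  case (tensor x y)
  show ?case using assms(1)
    by (induction rule: formal_carrier_induct)
      (use tensor in \<open>simp_all add: formal_act_eq_lift formal_lift_tensor formal_inner_add_left
        formal_inner_scale_left formal_inner_tensor \<pi>_linear F.inner_simps distrib_right
            mult_scaleC_left\<close>)
qed (auto simp: formal_act_eq_lift formal_lift_add formal_lift_scale formal_inner_add_right
    formal_inner_scale_right distrib_right mult_scaleC_left)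

lemma pre_hilbert_balanced: "pre_hilbert_module M"
proof
  note s = subspace_formal_carrier[of E F]
  note cl [simp] = formal.subspace_0[OF s] formal.subspace_add[OF s] formal.subspace_scale[OF s]
      formal_act_carrier
  note [simp] = balanced_carrier balanced_zero balanced_add balanced_scale balanced_act balanced_inner
  show "hzero M \<in> hcarrier M" by simp
  {
    fix x y z assume "x \<in> hcarrier M" "y \<in> hcarrier M" "z \<in> hcarrier M"
    then obtain u v w where [simp]: "x = coset u" "y = coset v" "z = coset w"
      "u \<in> formal_carrier E F" "v \<in> formal_carrier E F" "w \<in> formal_carrier E F" by auto
    show "hadd M (hadd M x y) z = hadd M x (hadd M y z)" by (simp add: add.assoc)
    show "hinner M x (hadd M y z) = hinner M x y + hinner M x z" by (simp add: formal_inner_add_right)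
  }
  {
    fix x y assume "x \<in> hcarrier M" "y \<in> hcarrier M"
    then obtain u v where [simp]: "x = coset u" "y = coset v"
      "u \<in> formal_carrier E F" "v \<in> formal_carrier E F" by auto
    show "hadd M x y \<in> hcarrier M" by simp
    show "hadd M x y = hadd M y x" by (simp add: add.commute)
    show "hscale M c (hadd M x y) = hadd M (hscale M c x) (hscale M c y)" for c
      by (simp add: formal.scale_right_distrib)
    show "hact M (hadd M x y) c = hadd M (hact M x c) (hact M y c)" for c
      by (simp add: formal_act_eq_lift formal_lift_add)
    show "hinner M x (hscale M c y) = c *\<^sub>C hinner M x y" for c by (simp add: formal_inner_scale_right)
    show "hinner M x (hact M y c) = hinner M x y * c" for c by (simp add: formal_inner_act)
    show "star (hinner M x y) = hinner M y x" by (simp add: formal_inner_star)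
  }
  fix x assume "x \<in> hcarrier M"
  then obtain u where [simp]: "x = coset u" and u [simp]: "u \<in> formal_carrier E F" by auto
  show "hscale M c x \<in> hcarrier M" "hact M x b \<in> hcarrier M" for c b by simp_all
  show "hadd M x (hzero M) = x" by simp
  show "hscale M 0 x = hzero M" by simp
  show "hscale M (c + d) x = hadd M (hscale M c x) (hscale M d x)" for c d
    by (simp add: formal.scale_left_distrib)
  show "hscale M c (hscale M d x) = hscale M (c * d) x" for c d by simp
  show "hscale M 1 x = x" by simp
  \<comment> \<open>The action replaces the basis vector \<open>(x, y)\<close> by
    \<open>(x, y c)\<close>. Additivity in the algebra element thus holds only modulo the relations,
    whereas additivity in \<open>u\<close> holds exactly.\<close>
  have "formal_act F u (c + d) - (formal_act F u c + formal_act F u d) \<in> relation_span" for c d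
    using u
  proof (induction rule: formal_carrier_induct)
    case (tensor x y)
    then show ?case
      using relation_intros(2)[of x "hact F y c" "hact F y d"]
      by (simp add: formal_act_eq_lift formal_lift_tensor F.act_add_right algebra_simps)
  next
    case (add u v)
    then show ?case using formal.span_add[OF add]
      by (simp add: formal_act_eq_lift formal_lift_add algebra_simps)
  next
    case (scale k u)
    then show ?case using formal.span_scale[OF scale, of k]
      by (simp add: formal_act_eq_lift formal_lift_scale formal.scale_right_diff_distrib
          formal.scale_right_distrib)
  qed (simp add: formal_act_eq_lift formal.span_zero)
  then show "hact M x (c + d) = hadd M (hact M x c) (hact M x d)" for c d
    by (simp add: tensor_coset_eq_iff)
  have "formal_act F (formal_act F u c) d = formal_act F u (c * d)" for c d
    using u by (induction rule: formal_carrier_induct)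
      (simp_all add: formal_act_eq_lift formal_lift_tensor formal_lift_add formal_lift_scale F.act_act)
  then show "hact M (hact M x c) d = hact M x (c * d)" for c d by simp
  show "hact M (hscale M c x) b = hscale M c (hact M x b)" for b c
    by (simp add: formal_act_eq_lift formal_lift_scale)
  have "formal_act F u (c *\<^sub>C d) - formal_scale c (formal_act F u d) \<in> relation_span" for c d
    using u
  proof (induction rule: formal_carrier_induct)
    case (tensor x y)
    then show ?case
      using relation_intros(4)[of x "hact F y d" c]
      by (simp add: formal_act_eq_lift formal_lift_tensor F.act_scale_right)
  next
    case (add u v)
    then show ?case using formal.span_add[OF add]
      by (simp add: formal_act_eq_lift formal_lift_add formal.scale_right_distrib algebra_simps)
  next
    case (scale k u)
    then show ?case using formal.span_scale[OF scale, of k]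
      by (simp add: formal_act_eq_lift formal_lift_scale formal.scale_right_diff_distrib mult.commute)
  qed (simp add: formal_act_eq_lift formal.span_zero)
  then show "hact M x (c *\<^sub>C b) = hscale M c (hact M x b)" for b c
    by (simp add: tensor_coset_eq_iff)
  show "cstar_positive (hinner M x x)" by (simp add: formal_inner_positive)
qed

end

section \<open>The interior tensor product and its operators\<close>

context balanced
begin

lemma hilbert_interior: "hilbert_module (interior_tensor E F \<pi>)"
  unfolding interior_tensor_def by (rule pre_hilbert_module.hilbert_completion[OF pre_hilbert_balanced])

lemma pre_hilbert_interior: "pre_hilbert_module (interior_tensor E F \<pi>)"
  by (rule hilbert_module_pre[OF hilbert_interior])

interpretation M: pre_hilbert_module M by (rule pre_hilbert_balanced)
interpretation I: pre_hilbert_module "interior_tensor E F \<pi>" by (rule pre_hilbert_interior)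

definition \<iota> :: "('e, 'f) formal \<Rightarrow> ('e, 'f) interior" where
  "\<iota> u = completion_class M (\<lambda>n. coset u)"

lemma hCauchy_coset: "u \<in> formal_carrier E F \<Longrightarrow> hCauchy M (\<lambda>n. coset u)"
  by (rule M.hCauchy_const) (simp add: balanced_carrier)

lemma \<iota>_closed [simp]: "u \<in> formal_carrier E F \<Longrightarrow> \<iota> u \<in> hcarrier (interior_tensor E F \<pi>)"
  unfolding \<iota>_def interior_tensor_def by (intro M.completion_carrierI hCauchy_coset)

lemma \<iota>_inner:
  assumes "u \<in> formal_carrier E F" "v \<in> formal_carrier E F"
  shows "hinner (interior_tensor E F \<pi>) (\<iota> u) (\<iota> v) = formal_inner E F \<pi> u v"
  unfolding \<iota>_def interior_tensor_def using assms
  by (subst M.completion_const_isometric) (auto simp: balanced_inner balanced_carrier)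

lemma \<iota>_add:
  "u \<in> formal_carrier E F \<Longrightarrow> v \<in> formal_carrier E F \<Longrightarrow> \<iota> (u + v) =
      hadd (interior_tensor E F \<pi>) (\<iota> u) (\<iota> v)"
  unfolding \<iota>_def interior_tensor_def by (simp add: M.completion_add hCauchy_coset balanced_add)

lemma \<iota>_scale: "u \<in> formal_carrier E F \<Longrightarrow> \<iota> (formal_scale c u) = hscale (interior_tensor E F \<pi>) c (\<iota> u)"
  unfolding \<iota>_def interior_tensor_def by (simp add: M.completion_scale hCauchy_coset balanced_scale)

lemma simple_tensor_eq: "simple_tensor E F \<pi> x y = \<iota> (formal_tensor x y)"
  by (simp add: simple_tensor_def \<iota>_def)

lemma simple_tensor_closed:
  "x \<in> hcarrier E \<Longrightarrow> y \<in> hcarrier F \<Longrightarrow> simple_tensor E F \<pi> x y \<in> hcarrier (interior_tensor E F \<pi>)"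
  by (simp add: simple_tensor_eq formal_tensor_in_carrier)

lemma hnorm_tensor_le:
  assumes x: "x \<in> hcarrier E" and y: "y \<in> hcarrier F"
  shows "hnorm M (coset (formal_tensor x y)) \<le> hnorm E x * hnorm F y"
proof (rule power2_le_imp_le)
  have "(hnorm M (coset (formal_tensor x y)))\<^sup>2 = norm (hinner F y (\<pi> (hinner E x x) y))"
    using assms by (simp add: M.hnorm_square balanced_inner formal_tensor_in_carrier formal_inner_tensor)
  also have "\<dots> \<le> hnorm F y * norm (hinner E x x) * hnorm F y" by (rule norm_inner_\<pi>[OF y y])
  also have "\<dots> = (hnorm E x * hnorm F y)\<^sup>2" unfolding E.hnorm_square[symmetric] by (simp add:
      power2_eq_square)
  finally show "(hnorm M (coset (formal_tensor x y)))\<^sup>2 \<le> (hnorm E x * hnorm F y)\<^sup>2" .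
qed simp

lemma hnorm_simple_tensor_le:
  assumes "x \<in> hcarrier E" "y \<in> hcarrier F"
  shows "hnorm (interior_tensor E F \<pi>) (simple_tensor E F \<pi> x y) \<le> hnorm E x * hnorm F y"
  using hnorm_tensor_le[OF assms] assms
  by (simp add: simple_tensor_eq hnorm_def \<iota>_inner balanced_inner formal_tensor_in_carrier)

lemma hnorm_simple_tensor_diff_le:
  assumes x: "x \<in> hcarrier E" "x' \<in> hcarrier E" and y: "y \<in> hcarrier F"
  shows "hnorm (interior_tensor E F \<pi>) (hdiff (interior_tensor E F \<pi>) (simple_tensor E F \<pi> x y)
      (simple_tensor E F \<pi> x' y))
    \<le> hnorm E (hdiff E x x') * hnorm F y"
proof -
  have "hnorm (interior_tensor E F \<pi>) (hdiff (interior_tensor E F \<pi>) (simple_tensor E F \<pi> x y)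
      (simple_tensor E F \<pi> x' y))
    = hnorm (interior_tensor E F \<pi>) (simple_tensor E F \<pi> (hdiff E x x') y)"
    using assms by (intro I.hnorm_cong)
      (simp add: simple_tensor_eq I.inner_diff I.inner_diff_left \<iota>_inner formal_tensor_in_carrier
          formal_inner_tensor
        E.inner_diff E.inner_diff_left \<pi>_inner_simps)
  then show ?thesis using hnorm_simple_tensor_le[of "hdiff E x x'" y] assms by simp
qed

lemma interior_approx:
  assumes z: "z \<in> hcarrier (interior_tensor E F \<pi>)" and e: "e > 0"
  obtains u where "u \<in> formal_carrier E F" "hnorm (interior_tensor E F \<pi>) (hdiff (interior_tensor E F \<pi>)
      z (\<iota> u)) < e"
proof -
  obtain X where X: "hCauchy M X" "z = completion_class M X"
    using z unfolding interior_tensor_def by (elim M.completion_carrierE)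
  obtain k where k: "hnorm (completion M) (hdiff (completion M) (completion_class M X) (completion_class
      M (\<lambda>n. X k))) < e"
    using order_tendstoD(2)[OF M.completion_approx[OF X(1)] e] unfolding eventually_sequentially by blast
  obtain u where "u \<in> formal_carrier E F" "X k = coset u"
    using M.hCauchy_closed[OF X(1), of k] by (auto simp: balanced_carrier)
  then show ?thesis using k by (intro that[of u]) (auto simp: \<iota>_def interior_tensor_def X(2))
qed

text \<open>The difference \<open>d\<close> is orthogonal to every finite sum of simple tensors.
  Choosing such a sum \<open>w\<close> with \<open>d - w\<close> shorter than \<open>d\<close>, the
  identity \<open><d,d> = <d, d - w>\<close> contradicts Cauchy-Schwarz unless \<open>d\<close> has
  norm 0.\<close>

lemma eq_if_inner_simple_tensors_eq:
  assumes v: "v \<in> hcarrier (interior_tensor E F \<pi>)" and w: "w \<in> hcarrier (interior_tensor E F \<pi>)"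
    and eq: "\<And>x y. x \<in> hcarrier E \<Longrightarrow> y \<in> hcarrier F \<Longrightarrow>
      hinner (interior_tensor E F \<pi>) v (simple_tensor E F \<pi> x y) =
          hinner (interior_tensor E F \<pi>) w (simple_tensor E F \<pi> x y)"
  shows "v = w"
proof -
  let ?I = "interior_tensor E F \<pi>"
  let ?d = "hdiff ?I v w"
  have "u \<in> {u \<in> formal_carrier E F. hinner ?I ?d (\<iota> u) = 0}" if "u \<in> formal_carrier E F" for u
    using that
  proof (induction rule: formal_carrier_induct)
    case zero
    have "\<iota> 0 = hzero ?I" by (simp add: \<iota>_def interior_tensor_def M.completion_zero balanced_zero)
    then show ?case using v w by (simp add: formal.subspace_0[OF subspace_formal_carrier])
  next
    case (tensor x y)
    then show ?case using eq[of x y] v w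
      by (simp add: simple_tensor_eq formal_tensor_in_carrier I.inner_simps)
  qed (use v w in \<open>auto simp: \<iota>_add \<iota>_scale I.inner_add I.inner_scale formal.subspace_add[OF
      subspace_formal_carrier]
      formal.subspace_scale[OF subspace_formal_carrier]\<close>)
  then have 0: "hinner ?I ?d (\<iota> u) = 0" if "u \<in> formal_carrier E F" for u using that by blast
  have "hnorm ?I ?d = 0"
  proof (rule ccontr)
    assume "hnorm ?I ?d \<noteq> 0"
    then have pos: "hnorm ?I ?d > 0" using I.hnorm_nonneg[of ?d] by linarith
    have dI: "?d \<in> hcarrier ?I" using v w by simp
    obtain u where u: "u \<in> formal_carrier E F" "hnorm ?I (hdiff ?I ?d (\<iota> u)) < hnorm ?I ?d"
      using interior_approx[OF dI pos] .
    have "(hnorm ?I ?d)\<^sup>2 = norm (hinner ?I ?d (hdiff ?I ?d (\<iota> u)))"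
      using dI u 0[OF u(1)] by (simp add: I.hnorm_square I.inner_diff)
    also have "\<dots> \<le> hnorm ?I ?d * hnorm ?I (hdiff ?I ?d (\<iota> u))"
      using v w u(1) by (intro I.cauchy_schwarz I.diff_closed \<iota>_closed)
    also have "\<dots> < hnorm ?I ?d * hnorm ?I ?d" using u(2) pos by (rule mult_strict_left_mono)
    finally show False by (simp add: power2_eq_square)
  qed
  then have "norm (hinner ?I z ?d) \<le> 0" if "z \<in> hcarrier ?I" for z
    using I.cauchy_schwarz[of z ?d] that v w by simp
  then show ?thesis
    using v w by (intro hilbert_module_eqI[OF hilbert_interior]) (auto simp: I.inner_diff)
qed

end

text \<open>Both maps act termwise on Cauchy sequences; the adjoint relation and the bound survive
  because inner products and norms in the completion are limits.\<close>

lemma completion_extension: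
  assumes M1: "pre_hilbert_module M\<^sub>1" and M2: "pre_hilbert_module M\<^sub>2"
    and closed: "\<And>x. x \<in> hcarrier M\<^sub>1 \<Longrightarrow> t x \<in> hcarrier M\<^sub>2" "\<And>y. y \<in> hcarrier M\<^sub>2 \<Longrightarrow> s y \<in> hcarrier M\<^sub>1"
    and adj: "\<And>x y. x \<in> hcarrier M\<^sub>1 \<Longrightarrow> y \<in> hcarrier M\<^sub>2 \<Longrightarrow> hinner M\<^sub>2 (t x) y = hinner M\<^sub>1 x (s y)"
    and bt: "\<And>x. x \<in> hcarrier M\<^sub>1 \<Longrightarrow> hnorm M\<^sub>2 (t x) \<le> K * hnorm M\<^sub>1 x"
    and bs: "\<And>y. y \<in> hcarrier M\<^sub>2 \<Longrightarrow> hnorm M\<^sub>1 (s y) \<le> K * hnorm M\<^sub>2 y"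
  obtains h where "h \<in> adjointable (completion M\<^sub>1) (completion M\<^sub>2)"
    "\<And>X. hCauchy M\<^sub>1 X \<Longrightarrow> h (completion_class M\<^sub>1 X) = completion_class M\<^sub>2 (\<lambda>n. t (X n))"
    "\<And>z. z \<in> hcarrier (completion M\<^sub>1) \<Longrightarrow> hnorm (completion M\<^sub>2) (h z) \<le> K * hnorm (completion M\<^sub>1) z"
proof -
  \<comment> \<open>Stated for arbitrary modules and maps so as to serve \<open>t\<close> and, with
    the roles exchanged, \<open>s\<close>.\<close>
  have ext: "(\<forall>X. hCauchy M\<^sub>1 X \<longrightarrow> hCauchy M\<^sub>2 (\<lambda>n. t (X n)) \<and>
      completion_class M\<^sub>2 (\<lambda>n. t (some_rep (completion_class M\<^sub>1 X) n)) =
          completion_class M\<^sub>2 (\<lambda>n. t (X n)))"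
    if M1: "pre_hilbert_module M\<^sub>1" and M2: "pre_hilbert_module M\<^sub>2"
      and closed: "\<And>x. x \<in> hcarrier M\<^sub>1 \<Longrightarrow> t x \<in> hcarrier M\<^sub>2" "\<And>y. y \<in> hcarrier M\<^sub>2 \<Longrightarrow> s y \<in> hcarrier M\<^sub>1"
      and adj: "\<And>x y. x \<in> hcarrier M\<^sub>1 \<Longrightarrow> y \<in> hcarrier M\<^sub>2 \<Longrightarrow> hinner M\<^sub>2 (t x) y = hinner M\<^sub>1 x (s y)"
      and bt: "\<And>x. x \<in> hcarrier M\<^sub>1 \<Longrightarrow> hnorm M\<^sub>2 (t x) \<le> K * hnorm M\<^sub>1 x"
    for M\<^sub>1 :: "('a, 'p) hmod" and M\<^sub>2 :: "('a, 'q) hmod" and t s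
  proof -
    interpret M1: pre_hilbert_module M\<^sub>1 by (rule M1)
    interpret M2: pre_hilbert_module M\<^sub>2 by (rule M2)
    have lip: "hnorm M\<^sub>2 (hdiff M\<^sub>2 (t x) (t y)) \<le> K * hnorm M\<^sub>1 (hdiff M\<^sub>1 x y)"
      if "x \<in> hcarrier M\<^sub>1" "y \<in> hcarrier M\<^sub>1" for x y
    proof -
      \<comment> \<open>No linearity of \<open>t\<close> is assumed. The adjoint relation gives it
        weakly, which is enough to identify the norm of the difference.\<close>
      have "hinner M\<^sub>2 (hdiff M\<^sub>2 (t x) (t y)) z = hinner M\<^sub>2 (t (hdiff M\<^sub>1 x y)) z"
          if "z \<in> hcarrier M\<^sub>2" for z
        using that \<open>x \<in> _\<close> \<open>y \<in> _\<close> by (simp add: M2.inner_diff_left M1.inner_diff_left closed adj)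
      then have "hinner M\<^sub>2 (hdiff M\<^sub>2 (t x) (t y)) (hdiff M\<^sub>2 (t x) (t y)) =
          hinner M\<^sub>2 (t (hdiff M\<^sub>1 x y)) (t (hdiff M\<^sub>1 x y))"
        using that by (metis M1.diff_closed M2.diff_closed M2.inner_star closed(1))
      then have "hnorm M\<^sub>2 (hdiff M\<^sub>2 (t x) (t y)) = hnorm M\<^sub>2 (t (hdiff M\<^sub>1 x y))"
          by (rule M2.hnorm_cong)
      then show ?thesis using that by (simp add: bt)
    qed
    have Cauchy: "hCauchy M\<^sub>2 (\<lambda>n. t (X n))" if "hCauchy M\<^sub>1 X" for X
      by (rule M1.hCauchy_lipschitz[OF that]) (auto intro: closed lip M1.hCauchy_closed[OF that])
    have "completion_class M\<^sub>2 (\<lambda>n. t (some_rep (completion_class M\<^sub>1 X) n)) =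
        completion_class M\<^sub>2 (\<lambda>n. t (X n))"
      if X: "hCauchy M\<^sub>1 X" for X
      using M1.some_rep_class[OF X] X
      by (subst M2.completion_class_eq_iff)
        (auto intro!: Cauchy tendsto_0_if_le[OF tendsto_mult_right_zero[OF M1.some_rep_class(2)[OF X]],
            of _ K]
           lip M1.hCauchy_closed)
    then show ?thesis using Cauchy by blast
  qed
  interpret M1: pre_hilbert_module M\<^sub>1 by fact
  interpret M2: pre_hilbert_module M\<^sub>2 by fact
  have adj': "hinner M\<^sub>1 (s y) x = hinner M\<^sub>2 y (t x)" if "x \<in> hcarrier M\<^sub>1" "y \<in> hcarrier M\<^sub>2" for x y
    using adj that by (metis M1.inner_star M2.inner_star closed)
  note T = ext[OF M1 M2 closed adj bt, rule_format] and S = ext[OF M2 M1 closed(2) closed(1) adj' bs,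
      rule_format]
  define h where "h z = completion_class M\<^sub>2 (\<lambda>n. t (some_rep z n))" for z
  define g where "g z = completion_class M\<^sub>1 (\<lambda>n. s (some_rep z n))" for z
  have h: "h (completion_class M\<^sub>1 X) = completion_class M\<^sub>2 (\<lambda>n. t (X n))" if "hCauchy M\<^sub>1 X" for X
    using T that by (simp add: h_def)
  have g: "g (completion_class M\<^sub>2 X) = completion_class M\<^sub>1 (\<lambda>n. s (X n))" if "hCauchy M\<^sub>2 X" for X
    using S that by (simp add: g_def)
  have "is_adjoint (completion M\<^sub>1) (completion M\<^sub>2) (restrict h (hcarrier (completion M\<^sub>1))) (restrict g
      (hcarrier (completion M\<^sub>2)))"
  proof (rule is_adjoint_restrict)
    fix z w assume "z \<in> hcarrier (completion M\<^sub>1)" "w \<in> hcarrier (completion M\<^sub>2)"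
    then obtain X Y where X: "hCauchy M\<^sub>1 X" "z = completion_class M\<^sub>1 X" and Y: "hCauchy M\<^sub>2 Y" "w =
        completion_class M\<^sub>2 Y"
      by (meson M1.completion_carrierE M2.completion_carrierE)
    have "(\<lambda>n. hinner M\<^sub>2 (t (X n)) (Y n)) = (\<lambda>n. hinner M\<^sub>1 (X n) (s (Y n)))"
      using X Y by (simp add: adj M1.hCauchy_closed M2.hCauchy_closed)
    then show "hinner (completion M\<^sub>2) (h z) w = hinner (completion M\<^sub>1) z (g w)"
      using X Y T S M1.completion_inner[of X "\<lambda>n. s (Y n)"] by (simp add: h g M2.completion_inner_eqI)
  qed (auto elim!: M1.completion_carrierE M2.completion_carrierE simp: h g
      intro!: M1.completion_carrierI M2.completion_carrierI T[THEN conjunct1] S[THEN conjunct1])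
  then have "restrict h (hcarrier (completion M\<^sub>1)) \<in> adjointable (completion M\<^sub>1) (completion M\<^sub>2)"
    by (auto simp: adjointable_def)
  moreover have "hnorm (completion M\<^sub>2) (h z) \<le> K * hnorm (completion M\<^sub>1) z" if z:
      "z \<in> hcarrier (completion M\<^sub>1)" for z
  proof -
    obtain X where X: "hCauchy M\<^sub>1 X" "z = completion_class M\<^sub>1 X" using z
        by (rule M1.completion_carrierE)
    show ?thesis unfolding X(2) h[OF X(1)]
      using X by (intro LIMSEQ_le[OF M2.completion_hnorm tendsto_mult[OF tendsto_const
          M1.completion_hnorm]])
        (auto intro!: T[THEN conjunct1] bt M1.hCauchy_closed)
  qed
  ultimately show ?thesis
    by (intro that[of "restrict h (hcarrier (completion M\<^sub>1))"]) (auto simp: h M1.completion_carrierI)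
qed

section \<open>The operators \<open>T \<otimes> I\<close>: existence, norm bound and
  uniqueness\<close>

context star_representation
begin

abbreviation lift :: "('p \<Rightarrow> 'q) \<Rightarrow> ('p, 'f) formal \<Rightarrow> ('q, 'f) formal" where
  "lift T \<equiv> formal_lift (\<lambda>p. (T (fst p), snd p))"

lemma lift_carrier:
  assumes "\<And>x. x \<in> hcarrier E\<^sub>1 \<Longrightarrow> T x \<in> hcarrier E\<^sub>2" "u \<in> formal_carrier E\<^sub>1 F"
  shows "lift T u \<in> formal_carrier E\<^sub>2 F"
  using assms(2)
  by (induction rule: formal_carrier_induct)
    (auto simp: formal_lift_add formal_lift_scale formal_lift_tensor formal_tensor_in_carrier assms(1)
      formal.subspace_0[OF subspace_formal_carrier]
      intro: formal.subspace_add[OF subspace_formal_carrier] formal.subspace_scale[OF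
          subspace_formal_carrier])

lemma lift_relation_span:
  assumes E1: "pre_hilbert_module E\<^sub>1" and E2: "hilbert_module E\<^sub>2" and T: "T \<in> adjointable E\<^sub>1 E\<^sub>2"
    and r: "r \<in> formal.span (tensor_relations E\<^sub>1 F \<pi>)"
  shows "lift T r \<in> formal.span (tensor_relations E\<^sub>2 F \<pi>)"
proof -
  interpret E1: pre_hilbert_module E\<^sub>1 by (rule E1)
  interpret E2: pre_hilbert_module E\<^sub>2 by (rule hilbert_module_pre[OF E2])
  interpret B1: balanced E\<^sub>1 F \<pi> by unfold_locales
  interpret B2: balanced E\<^sub>2 F \<pi> by unfold_locales
  have "B1.relation_span \<subseteq> {r. lift T r \<in> B2.relation_span}"
  proof (rule B1.relation_span_subset)
    fix r assume "r \<in> tensor_relations E\<^sub>1 F \<pi>"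
    then show "r \<in> {r. lift T r \<in> B2.relation_span}"
      by (rule B1.tensor_relations_cases)
        (simp_all add: formal_lift_diff formal_lift_scale formal_lift_tensor adjointable_linear[OF E1 E2
            T]
          B2.relation_intros adjointable_closed[OF T])
  qed (auto intro!: formal.subspaceI formal.span_add formal.span_scale
      simp: formal_lift_add formal_lift_scale formal.span_zero)
  then show ?thesis using r by auto
qed

lemma lift_inner:
  assumes adj: "is_adjoint E\<^sub>1 E\<^sub>2 T S" and u: "u \<in> formal_carrier E\<^sub>1 F" and v:
      "v \<in> formal_carrier E\<^sub>2 F"
  shows "formal_inner E\<^sub>2 F \<pi> (lift T u) v = formal_inner E\<^sub>1 F \<pi> u (lift S v)"
  using u
proof (induction rule: formal_carrier_induct)
  case (tensor x y)
  show ?case using v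
    by (induction rule: formal_carrier_induct)
      (use tensor is_adjointD(3)[OF adj] in \<open>simp_all add: formal_lift_tensor formal_lift_add
          formal_lift_scale
        formal_inner_add_right formal_inner_scale_right formal_inner_tensor\<close>)
qed (simp_all add: formal_lift_add formal_lift_scale formal_inner_add_left formal_inner_scale_left)

text \<open>On the algebraic tensor product \<open>\<parallel>T \<otimes> I\<parallel> \<le> \<parallel>T\<parallel>\<close> follows from the orbit bound for
  \<open>T\<^sup>*T \<otimes> I\<close>, since orbits of finite sums of simple tensors grow at most like \<open>\<parallel>T\<^sup>*T\<parallel>\<^sup>n\<close>.\<close>

lemma tensor_extension_exists:
  fixes E\<^sub>1 E\<^sub>2 :: "('b, 'e) hmod"
  assumes E1: "hilbert_module E\<^sub>1" and E2: "hilbert_module E\<^sub>2" and T: "T \<in> adjointable E\<^sub>1 E\<^sub>2"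
    and K: "K \<ge> 0" and bound: "\<And>x. x \<in> hcarrier E\<^sub>1 \<Longrightarrow> hnorm E\<^sub>2 (T x) \<le> K * hnorm E\<^sub>1 x"
  obtains h where "is_tensor_extension E\<^sub>1 E\<^sub>2 F \<pi> T h"
    "\<And>z. z \<in> hcarrier (interior_tensor E\<^sub>1 F \<pi>) \<Longrightarrow>
      hnorm (interior_tensor E\<^sub>2 F \<pi>) (h z) \<le> K * hnorm (interior_tensor E\<^sub>1 F \<pi>) z"
proof -
  interpret E1: pre_hilbert_module E\<^sub>1 by (rule hilbert_module_pre[OF E1])
  interpret E2: pre_hilbert_module E\<^sub>2 by (rule hilbert_module_pre[OF E2])
  interpret B1: balanced E\<^sub>1 F \<pi> by unfold_locales
  interpret B2: balanced E\<^sub>2 F \<pi> by unfold_locales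
  interpret M1: pre_hilbert_module B1.M by (rule B1.pre_hilbert_balanced)
  interpret M2: pre_hilbert_module B2.M by (rule B2.pre_hilbert_balanced)
  note pre1 = E1.pre_hilbert_module_axioms and pre2 = E2.pre_hilbert_module_axioms
  obtain S where TS: "is_adjoint E\<^sub>1 E\<^sub>2 T S" using T by (auto simp: adjointable_def)
  have ST: "is_adjoint E\<^sub>2 E\<^sub>1 S T" by (rule is_adjoint_swap[OF pre1 pre2 TS])
  then have S: "S \<in> adjointable E\<^sub>2 E\<^sub>1" by (auto simp: adjointable_def)
  note [simp] = adjointable_closed[OF T] adjointable_closed[OF S] lift_carrier[of E\<^sub>1 T E\<^sub>2]
      lift_carrier[of E\<^sub>2 S E\<^sub>1]
  have Sbound: "hnorm E\<^sub>1 (S y) \<le> K * hnorm E\<^sub>2 y" if "y \<in> hcarrier E\<^sub>2" for y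
    by (rule adjoint_bound[OF pre2 pre1 _ _ _ bound K that]) (use is_adjointD[OF ST] in auto)
  define \<tau> where "\<tau> P = B2.coset (lift T (some_rep P))" for P
  define \<sigma> where "\<sigma> P = B1.coset (lift S (some_rep P))" for P
  have \<tau>: "\<tau> (B1.coset u) = B2.coset (lift T u)" for u
    using lift_relation_span[OF pre1 E2 T B1.some_rep_coset[of u]]
    by (simp add: \<tau>_def B2.tensor_coset_eq_iff formal_lift_diff)
  have \<sigma>: "\<sigma> (B2.coset u) = B1.coset (lift S u)" for u
    using lift_relation_span[OF pre2 E1 S B2.some_rep_coset[of u]]
    by (simp add: \<sigma>_def B1.tensor_coset_eq_iff formal_lift_diff)
  have closed: "\<tau> P \<in> hcarrier B2.M" "\<sigma> Q \<in> hcarrier B1.M" if "P \<in> hcarrier B1.M" "Q \<in> hcarrier B2.M"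
      for P Q
    using that by (auto simp: B1.balanced_carrier B2.balanced_carrier \<tau> \<sigma>)
  have closed1: "\<tau> P \<in> hcarrier B2.M" if "P \<in> hcarrier B1.M" for P
    using that by (auto simp: B1.balanced_carrier B2.balanced_carrier \<tau>)
  have closed2: "\<sigma> Q \<in> hcarrier B1.M" if "Q \<in> hcarrier B2.M" for Q
    using that by (auto simp: B1.balanced_carrier B2.balanced_carrier \<sigma>)
  have adj: "hinner B2.M (\<tau> P) Q = hinner B1.M P (\<sigma> Q)" if "P \<in> hcarrier B1.M" "Q \<in> hcarrier B2.M"
      for P Q
    using that by (auto simp: B1.balanced_carrier B2.balanced_carrier \<tau> \<sigma> B1.balanced_inner
        B2.balanced_inner lift_inner[OF TS])
  have adj': "hinner B1.M (\<sigma> Q) P = hinner B2.M Q (\<tau> P)" if "P \<in> hcarrier B1.M" "Q \<in> hcarrier B2.M"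
      for P Q
    using adj[OF that] closed[OF that] that by (metis M1.inner_star M2.inner_star)
  define R where "R P = \<sigma> (\<tau> P)" for P
  define q where "q u = lift S (lift T u)" for u
  have R: "(R ^^ n) (B1.coset u) = B1.coset ((q ^^ n) u)" for n u
    by (induction n) (auto simp: R_def q_def \<tau> \<sigma>)
  have q_carrier: "(q ^^ n) u \<in> formal_carrier E\<^sub>1 F" if "u \<in> formal_carrier E\<^sub>1 F" for n u
    using that by (induction n) (auto simp: q_def)
  have q_add: "(q ^^ n) (u + v) = (q ^^ n) u + (q ^^ n) v" for n u v
    by (induction n) (auto simp: q_def formal_lift_add)
  have q_scale: "(q ^^ n) (formal_scale c u) = formal_scale c ((q ^^ n) u)" for n c u
    by (induction n) (auto simp: q_def formal_lift_scale)
  have q_0: "(q ^^ n) 0 = 0" for n by (induction n) (auto simp: q_def)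
  define st where "st x = S (T x)" for x
  have st: "st x = S (T x)" for x by (simp add: st_def)
  have q_tensor: "(q ^^ n) (formal_tensor x y) = formal_tensor ((st ^^ n) x) y" for n x y
    by (induction n) (auto simp: q_def st formal_lift_tensor)
  have orbit: "(st ^^ n) x \<in> hcarrier E\<^sub>1 \<and> hnorm E\<^sub>1 ((st ^^ n) x) \<le> (K * K) ^ n * hnorm E\<^sub>1 x"
    if x: "x \<in> hcarrier E\<^sub>1" for n x
  proof (induction n)
    case (Suc n)
    let ?w = "(st ^^ n) x"
    have "hnorm E\<^sub>1 (S (T ?w)) \<le> K * (K * hnorm E\<^sub>1 ?w)"
      using Suc K by (intro order_trans[OF Sbound] mult_left_mono bound) auto
    also have "\<dots> \<le> K * (K * ((K * K) ^ n * hnorm E\<^sub>1 x))"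
      using Suc K by (intro mult_left_mono) auto
    finally show ?case using Suc by (simp add: mult_ac st[of "(st ^^ n) x"])
  qed (use x in simp)
  \<comment> \<open>\<open>C\<close> depends on how \<open>u\<close> is written as a sum of
    elementary tensors, on each of which \<open>R^n\<close> acts through the first component only.
    This is harmless, since the orbit bound retains the rate \<open>K * K\<close> alone.\<close>
  have growth: "\<exists>C. \<forall>n. hnorm B1.M ((R ^^ n) (B1.coset u)) \<le> C * (K * K) ^ n"
      if "u \<in> formal_carrier E\<^sub>1 F" for u
  proof -
    have "u \<in> {u \<in> formal_carrier E\<^sub>1 F. \<exists>C. \<forall>n. hnorm B1.M ((R ^^ n) (B1.coset u)) \<le> C * (K * K) ^ n}"
      using that
    proof (induction rule: formal_carrier_induct)
      case zero
      have "hnorm B1.M (B1.coset 0) = 0" using M1.hnorm_zero by (simp add: B1.balanced_zero)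
      then show ?case by (auto simp: R q_0 formal.subspace_0[OF subspace_formal_carrier] intro!: exI[of _
          0])
    next
      case (add u v)
      then obtain C D where C: "\<And>n. hnorm B1.M (B1.coset ((q ^^ n) u)) \<le> C * (K * K) ^ n"
        and D: "\<And>n. hnorm B1.M (B1.coset ((q ^^ n) v)) \<le> D * (K * K) ^ n" by (auto simp: R)
      have "hnorm B1.M ((R ^^ n) (B1.coset (u + v))) \<le> (C + D) * (K * K) ^ n" for n
        using M1.hnorm_add[of "B1.coset ((q ^^ n) u)" "B1.coset ((q ^^ n) v)"] C[of n] D[of n] add
        by (simp add: R q_add q_carrier B1.balanced_add B1.balanced_carrier distrib_right)
      then show ?case using add by (auto intro: formal.subspace_add[OF subspace_formal_carrier])
    next
      case (scale c u)
      then obtain C where C: "\<And>n. hnorm B1.M (B1.coset ((q ^^ n) u)) \<le> C * (K * K) ^ n" by (auto simp: R)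
      have "hnorm B1.M ((R ^^ n) (B1.coset (formal_scale c u))) \<le> (cmod c * C) * (K * K) ^ n" for n
        using M1.hnorm_scale[of "B1.coset ((q ^^ n) u)" c] mult_left_mono[OF C[of n], of "cmod c"] scale
        by (simp add: R q_scale q_carrier B1.balanced_scale B1.balanced_carrier mult.assoc)
      then show ?case using scale by (auto intro: formal.subspace_scale[OF subspace_formal_carrier])
    next
      case (tensor x y)
      have "hnorm B1.M ((R ^^ n) (B1.coset (formal_tensor x y))) \<le>
          (hnorm E\<^sub>1 x * hnorm F y) * (K * K) ^ n" for n
      proof -
        have "hnorm B1.M ((R ^^ n) (B1.coset (formal_tensor x y))) \<le> hnorm E\<^sub>1 ((st ^^ n) x) * hnorm F y"
          unfolding R q_tensor using orbit[of x n] tensor by (intro B1.hnorm_tensor_le) auto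
        also have "\<dots> \<le> ((K * K) ^ n * hnorm E\<^sub>1 x) * hnorm F y"
          using orbit[of x n] tensor by (intro mult_right_mono) auto
        finally show ?thesis by (simp add: mult_ac)
      qed
      then show ?case using tensor by (auto simp: formal_tensor_in_carrier)
    qed
    then show ?thesis by blast
  qed
  have bt: "hnorm B2.M (\<tau> P) \<le> K * hnorm B1.M P" if P: "P \<in> hcarrier B1.M" for P
  proof (rule power2_le_imp_le)
    obtain u where u: "P = B1.coset u" "u \<in> formal_carrier E\<^sub>1 F" using P
        by (auto simp: B1.balanced_carrier)
    obtain C where C: "\<And>n. hnorm B1.M ((R ^^ n) P) \<le> C * (K * K) ^ n" using growth[OF u(2)] u(1) by blast
    have RP: "hnorm B1.M (R P) \<le> (K * K) * hnorm B1.M P"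
      by (rule M1.symmetric_orbit_bound[OF _ _ P C]) (auto simp: R_def closed1 closed2 adj adj')
    have "(hnorm B2.M (\<tau> P))\<^sup>2 = norm (hinner B1.M P (R P))"
      using P by (simp add: M2.hnorm_square adj closed1 R_def)
    also have "\<dots> \<le> hnorm B1.M P * hnorm B1.M (R P)"
      using P by (intro M1.cauchy_schwarz) (auto simp: R_def closed1 closed2)
    also have "\<dots> \<le> hnorm B1.M P * ((K * K) * hnorm B1.M P)" using RP by (rule mult_left_mono) simp
    finally show "(hnorm B2.M (\<tau> P))\<^sup>2 \<le> (K * hnorm B1.M P)\<^sup>2" by (simp add: power2_eq_square mult_ac)
  qed (use K in simp)
  have bs: "hnorm B1.M (\<sigma> Q) \<le> K * hnorm B2.M Q" if "Q \<in> hcarrier B2.M" for Q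
    by (rule adjoint_bound[OF M2.pre_hilbert_module_axioms M1.pre_hilbert_module_axioms closed2 closed1
        adj' bt K that])
  obtain h where h: "h \<in> adjointable (completion B1.M) (completion B2.M)"
    "\<And>X. hCauchy B1.M X \<Longrightarrow> h (completion_class B1.M X) = completion_class B2.M (\<lambda>n. \<tau> (X n))"
    "\<And>z. z \<in> hcarrier (completion B1.M) \<Longrightarrow> hnorm (completion B2.M) (h z) \<le> K * hnorm (completion B1.M) z"
    using completion_extension[OF M1.pre_hilbert_module_axioms M2.pre_hilbert_module_axioms closed1
        closed2 adj bt bs]
    by blast
  have "h (simple_tensor E\<^sub>1 F \<pi> x f) = simple_tensor E\<^sub>2 F \<pi> (T x) f"
      if "x \<in> hcarrier E\<^sub>1" "f \<in> hcarrier F" for x f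
    using that by (simp add: simple_tensor_def h(2) B1.hCauchy_coset formal_tensor_in_carrier \<tau>
        formal_lift_tensor)
  then show ?thesis using h by (intro that[of h]) (auto simp: is_tensor_extension_def
      interior_tensor_def)
qed

text \<open>The adjoints are compared first: pairing their values with simple tensors involves
  \<open>h\<close> and \<open>k\<close> only on simple tensors, where they agree. Equal adjoints
  then give \<open>h = k\<close>, without a density argument for \<open>h\<close> and
  \<open>k\<close> themselves.\<close>

lemma tensor_extension_unique:
  assumes E1: "hilbert_module E\<^sub>1" and E2: "hilbert_module E\<^sub>2"
    and h: "is_tensor_extension E\<^sub>1 E\<^sub>2 F \<pi> T h" and k: "is_tensor_extension E\<^sub>1 E\<^sub>2 F \<pi> T k"
  shows "h = k"
proof -
  interpret E1: pre_hilbert_module E\<^sub>1 by (rule hilbert_module_pre[OF E1])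
  interpret E2: pre_hilbert_module E\<^sub>2 by (rule hilbert_module_pre[OF E2])
  interpret B1: balanced E\<^sub>1 F \<pi> by unfold_locales
  interpret B2: balanced E\<^sub>2 F \<pi> by unfold_locales
  let ?I1 = "interior_tensor E\<^sub>1 F \<pi>" and ?I2 = "interior_tensor E\<^sub>2 F \<pi>"
  interpret I1: pre_hilbert_module ?I1 by (rule B1.pre_hilbert_interior)
  obtain h' k' where h': "is_adjoint ?I1 ?I2 h h'" and k': "is_adjoint ?I1 ?I2 k k'"
    using h k by (auto simp: is_tensor_extension_def adjointable_def)
  have "h' = k'"
  proof (rule extensionalityI[of _ "hcarrier ?I2"])
    fix w assume w: "w \<in> hcarrier ?I2"
    have eq: "hinner ?I1 (simple_tensor E\<^sub>1 F \<pi> x f) (h' w) =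
        hinner ?I1 (simple_tensor E\<^sub>1 F \<pi> x f) (k' w)"
      if "x \<in> hcarrier E\<^sub>1" "f \<in> hcarrier F" for x f
      using h k that w B1.simple_tensor_closed[OF that]
      by (simp add: is_tensor_extension_def flip: is_adjointD(3)[OF h'] is_adjointD(3)[OF k'])
    have cl: "h' w \<in> hcarrier ?I1" "k' w \<in> hcarrier ?I1"
      using is_adjointD(2)[OF h' w] is_adjointD(2)[OF k' w] .
    show "h' w = k' w"
      using cl
    proof (rule B1.eq_if_inner_simple_tensors_eq)
      fix x f assume xf: "x \<in> hcarrier E\<^sub>1" "f \<in> hcarrier F"
      show "hinner ?I1 (h' w) (simple_tensor E\<^sub>1 F \<pi> x f) = hinner ?I1 (k' w) (simple_tensor E\<^sub>1 F \<pi> x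
          f)"
        using arg_cong[OF eq[OF xf], of star] cl B1.simple_tensor_closed[OF xf] by (simp add:
            I1.inner_star)
    qed
  qed (use h' k' in \<open>auto simp: is_adjoint_def PiE_def\<close>)
  then show ?thesis
    using is_adjoint_unique[OF B2.hilbert_interior] is_adjoint_swap[OF B1.pre_hilbert_interior
        B2.pre_hilbert_interior] h' k'
    by blast
qed

lemma tensor_extension_ex1:
  assumes E1: "hilbert_module E\<^sub>1" and E2: "hilbert_module E\<^sub>2" and T: "T \<in> adjointable E\<^sub>1 E\<^sub>2"
  shows "\<exists>!h. is_tensor_extension E\<^sub>1 E\<^sub>2 F \<pi> T h"
proof -
  obtain K where "K \<ge> 0" "\<And>x. x \<in> hcarrier E\<^sub>1 \<Longrightarrow> hnorm E\<^sub>2 (T x) \<le> K * hnorm E\<^sub>1 x"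
    using adjointable_bounded[OF E1 hilbert_module_pre[OF E2] T] by blast
  from tensor_extension_exists[OF E1 E2 T this] show ?thesis
    using tensor_extension_unique[OF E1 E2] by metis
qed

lemma tensor_extension_eqI:
  assumes "hilbert_module E\<^sub>1" "hilbert_module E\<^sub>2" "is_tensor_extension E\<^sub>1 E\<^sub>2 F \<pi> T h"
  shows "tensor_extension E\<^sub>1 E\<^sub>2 F \<pi> T = h"
  unfolding tensor_extension_def using assms tensor_extension_unique by blast

lemma is_tensor_extension_tensor_extension:
  assumes "hilbert_module E\<^sub>1" "hilbert_module E\<^sub>2" "T \<in> adjointable E\<^sub>1 E\<^sub>2"
  shows "is_tensor_extension E\<^sub>1 E\<^sub>2 F \<pi> T (tensor_extension E\<^sub>1 E\<^sub>2 F \<pi> T)"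
  unfolding tensor_extension_def by (rule theI'[OF tensor_extension_ex1[OF assms]])

lemma hnorm_tensor_extension:
  assumes "hilbert_module E\<^sub>1" "hilbert_module E\<^sub>2" "T \<in> adjointable E\<^sub>1 E\<^sub>2"
    "K \<ge> 0" "\<And>x. x \<in> hcarrier E\<^sub>1 \<Longrightarrow> hnorm E\<^sub>2 (T x) \<le> K * hnorm E\<^sub>1 x"
    "z \<in> hcarrier (interior_tensor E\<^sub>1 F \<pi>)"
  shows "hnorm (interior_tensor E\<^sub>2 F \<pi>) (tensor_extension E\<^sub>1 E\<^sub>2 F \<pi> T z) \<le>
      K * hnorm (interior_tensor E\<^sub>1 F \<pi>) z"
  using tensor_extension_exists[OF assms(1-5)] tensor_extension_eqI[OF assms(1,2)] assms(6) by metis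

end

section \<open>Completely positive maps\<close>

lemma completely_positive_linear:
  assumes "completely_positive E \<phi>"
  shows "\<phi> a \<in> adjointable E E" "x \<in> hcarrier E \<Longrightarrow> \<phi> (a + a') x = hadd E (\<phi> a x) (\<phi> a' x)"
    "x \<in> hcarrier E \<Longrightarrow> \<phi> (c *\<^sub>C a) x = hscale E c (\<phi> a x)"
  using assms by (auto simp: completely_positive_def linear_into_adjointable_def)

text \<open>The one-by-one case of complete positivity. \<open>Y\<close> serves as a root of
  \<open>\<phi> a\<close> up to its adjoint \<open>Z\<close> and later yields self-adjointness and
  norm bounds.\<close>

lemma completely_positive_factor:
  assumes E: "hilbert_module E" and cp: "completely_positive E \<phi>" and a: "cstar_positive a"
  obtains Y Z where "is_adjoint E E Y Z" "\<And>x. x \<in> hcarrier E \<Longrightarrow> \<phi> a x = Z (Y x)"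
proof -
  interpret pre_hilbert_module E by (rule hilbert_module_pre[OF E])
  obtain b where "a = star b * b" using a by (auto simp: cstar_positive_def)
  then have "cstar_mat_positive 1 (\<lambda>i j. a)" unfolding cstar_mat_positive_def
      by (intro exI[of _ "\<lambda>i j. b"]) simp
  then have "op_mat_positive E 1 (\<lambda>i j. \<phi> a)" using cp by (simp add: completely_positive_def)
  then obtain Y where Y: "Y 0 0 \<in> adjointable E E"
      "\<And>x. x \<in> hcarrier E \<Longrightarrow> \<phi> a x = hadd E (hzero E) (adjoint_map E E (Y 0 0) (Y 0 0 x))"
    unfolding op_mat_positive_def by auto
  have adj: "is_adjoint E E (Y 0 0) (adjoint_map E E (Y 0 0))"
      by (rule is_adjoint_adjoint_map[OF E Y(1)])
  show ?thesis
  proof (rule that[OF adj])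
    fix x assume x: "x \<in> hcarrier E"
    have "adjoint_map E E (Y 0 0) (Y 0 0 x) \<in> hcarrier E" using is_adjointD[OF adj] x by blast
    then show "\<phi> a x = adjoint_map E E (Y 0 0) (Y 0 0 x)" using Y(2)[OF x] by (simp add:
        add_comm[of "hzero E"] add_zero)
  qed
qed

lemma completely_positive_self_adjoint:
  assumes E: "hilbert_module E" and cp: "completely_positive E \<phi>" and a: "cstar_positive a"
  shows "is_adjoint E E (\<phi> a) (\<phi> a)"
proof -
  obtain Y Z where YZ: "is_adjoint E E Y Z" "\<And>x. x \<in> hcarrier E \<Longrightarrow> \<phi> a x = Z (Y x)"
    using completely_positive_factor[OF assms] by blast
  have ZY: "is_adjoint E E Z Y"
    by (rule is_adjoint_swap[OF hilbert_module_pre[OF E] hilbert_module_pre[OF E] YZ(1)])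
  have "\<phi> a \<in> hcarrier E \<rightarrow>\<^sub>E hcarrier E"
    using completely_positive_linear(1)[OF cp, of a] by (auto simp: adjointable_def is_adjoint_def)
  then show ?thesis
    using is_adjointD[OF YZ(1)] is_adjointD[OF ZY] by (simp add: is_adjoint_def YZ(2))
qed

lemma completely_positive_inner_positive:
  assumes E: "hilbert_module E" and cp: "completely_positive E \<phi>" and a: "cstar_positive a" and x:
      "x \<in> hcarrier E"
  shows "cstar_positive (hinner E x (\<phi> a x))"
proof -
  interpret pre_hilbert_module E by (rule hilbert_module_pre[OF E])
  obtain Y Z where YZ: "is_adjoint E E Y Z" "\<And>x. x \<in> hcarrier E \<Longrightarrow> \<phi> a x = Z (Y x)"
    using completely_positive_factor[OF E cp a] by blast
  have "hinner E x (\<phi> a x) = hinner E (Y x) (Y x)" using is_adjointD[OF YZ(1)] x YZ(2) by simp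
  then show ?thesis using is_adjointD(1)[OF YZ(1) x] by (simp add: inner_positive)
qed

text \<open>If \<open>\<parallel>\<langle>x\<^sub>n, \<phi>(u\<^sub>n) x\<^sub>n\<rangle>\<parallel> > 4\<^sup>n \<parallel>x\<^sub>n\<parallel>\<^sup>2\<close> for positive contractions \<open>u\<^sub>n\<close>, then \<open>\<phi>(a)\<close> is unbounded
  for \<open>a = \<Sum> 2\<^sup>-\<^sup>n u\<^sub>n \<ge> 2\<^sup>-\<^sup>n u\<^sub>n\<close>.\<close>

lemma completely_positive_form_bounded:
  assumes E: "hilbert_module E" and cp: "completely_positive E \<phi>"
  shows "\<exists>K. \<forall>u x. cstar_positive u \<longrightarrow> norm u \<le> 1 \<longrightarrow> x \<in> hcarrier E \<longrightarrow>
    norm (hinner E x (\<phi> u x)) \<le> K * (hnorm E x)\<^sup>2"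
proof (rule ccontr)
  assume "\<not> ?thesis"
  then have "\<exists>u x. cstar_positive u \<and> norm u \<le> 1 \<and> x \<in> hcarrier E \<and>
      norm (hinner E x (\<phi> u x)) > K * (hnorm E x)\<^sup>2" for K
    by (meson not_le)
  then have "\<exists>u x. cstar_positive u \<and> norm u \<le> 1 \<and> x \<in> hcarrier E \<and>
      norm (hinner E x (\<phi> u x)) > 4 ^ n * (hnorm E x)\<^sup>2" for n :: nat
    by blast
  then obtain u x where u: "\<And>n. cstar_positive (u n)" "\<And>n. norm (u n) \<le> 1" and x:
      "\<And>n::nat. x n \<in> hcarrier E"
    and big: "\<And>n. norm (hinner E (x n) (\<phi> (u n) (x n))) > 4 ^ n * (hnorm E (x n))\<^sup>2" by metis
  interpret pre_hilbert_module E by (rule hilbert_module_pre[OF E])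
  note lin = completely_positive_linear[OF cp]
  define v where "v n = (1/2) ^ n *\<^sub>R u n" for n
  have v_pos: "cstar_positive (v n)" for n by (simp add: v_def cstar_positive_scaleR u)
  have "summable v"
  proof (rule summable_comparison_test')
    show "summable (\<lambda>n. (1/2::real) ^ n)" by (rule summable_geometric) simp
    show "norm (v n) \<le> (1/2) ^ n" for n using u(2)[of n] by (simp add: v_def mult_left_le)
  qed
  define a where "a = suminf v"
  have lim: "(\<lambda>N. \<Sum>k<N. v k) \<longlonglongrightarrow> a" unfolding a_def by (rule summable_LIMSEQ) fact
  have rest: "cstar_positive (a - v n)" for n
  proof (rule cstar_positive_closed)
    \<comment> \<open>The shift by \<open>Suc n\<close> ensures that the term \<open>v n\<close>
      occurs in every partial sum, so that its removal leaves a sum of positive elements.\<close>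
    show "(\<lambda>N. (\<Sum>k<N + Suc n. v k) - v n) \<longlonglongrightarrow> a - v n"
      by (intro tendsto_diff tendsto_const LIMSEQ_ignore_initial_segment lim)
    have "(\<Sum>k<N + Suc n. v k) - v n = (\<Sum>k\<in>{..<N + Suc n} - {n}. v k)" for N
      by (simp add: sum_diff1)
    then show "cstar_positive ((\<Sum>k<N + Suc n. v k) - v n)" for N by (simp add: cstar_positive_sum v_pos)
  qed
  obtain K where K: "K \<ge> 0" "\<And>x. x \<in> hcarrier E \<Longrightarrow> hnorm E (\<phi> a x) \<le> K * hnorm E x"
    using adjointable_bounded[OF E pre_hilbert_module_axioms lin(1)] by blast
  have "2 ^ n < K" for n
  proof -
    have cl: "\<phi> b (x n) \<in> hcarrier E" for b using adjointable_closed[OF lin(1) x] .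
    have "\<phi> a (x n) = hadd E (\<phi> (v n) (x n)) (\<phi> (a - v n) (x n))"
      using lin(2)[OF x, of "v n" "a - v n" n] by simp
    then have eq: "hinner E (x n) (\<phi> a (x n)) = hinner E (x n) (\<phi> (v n) (x n)) + hinner E (x n) (\<phi> (a - v
        n) (x n))"
      using x cl by (simp add: inner_add)
    have "\<phi> (v n) (x n) = hscale E (of_real ((1/2) ^ n)) (\<phi> (u n) (x n))"
      unfolding v_def scaleR_scaleC by (rule lin(3)[OF x])
    then have "norm (hinner E (x n) (\<phi> (v n) (x n))) = (1/2) ^ n * norm (hinner E (x n) (\<phi> (u n) (x n)))"
      using x cl by (simp add: inner_scale norm_scaleC norm_power norm_divide)
    then have "(1/2) ^ n * (4 ^ n * (hnorm E (x n))\<^sup>2) < norm (hinner E (x n) (\<phi> (v n) (x n)))"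
      using big[of n] by simp
    also have "\<dots> \<le> norm (hinner E (x n) (\<phi> a (x n)))" unfolding eq
      by (intro cstar_positive_norm_mono completely_positive_inner_positive[OF E cp] v_pos rest x)
    also have "\<dots> \<le> hnorm E (x n) * (K * hnorm E (x n))"
      using x cl by (intro order_trans[OF cauchy_schwarz] mult_left_mono K) auto
    also have "\<dots> = K * (hnorm E (x n))\<^sup>2" by (simp add: power2_eq_square)
    finally have "((1/2) ^ n * 4 ^ n) * (hnorm E (x n))\<^sup>2 < K * (hnorm E (x n))\<^sup>2" by (simp only:
        mult.assoc)
    then have "(1/2) ^ n * 4 ^ n < K" by (rule mult_right_less_imp_less) simp
    then show ?thesis by (simp flip: power_mult_distrib)
  qed
  moreover obtain n where "2 ^ n > K" using real_arch_pow[of 2 K] by auto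
  ultimately show False using less_asym by blast
qed

text \<open>A bound on the form becomes one on the operator through \<open>\<phi> u = Z Y\<close>:
  the norm of \<open><y, \<phi> u y>\<close> is the square of the norm of \<open>Y y\<close>, so
  \<open>Y\<close> and its adjoint \<open>Z\<close> are both bounded by
  \<open>sqrt \<bar>K0\<bar>\<close>, uniformly in \<open>u\<close>.\<close>

lemma completely_positive_bounded:
  assumes E: "hilbert_module E" and cp: "completely_positive E \<phi>"
  obtains K where "K \<ge> 0" "\<And>u x. cstar_positive u \<Longrightarrow> norm u \<le> 1 \<Longrightarrow> x \<in> hcarrier E \<Longrightarrow>
    hnorm E (\<phi> u x) \<le> K * hnorm E x"
proof -
  interpret pre_hilbert_module E by (rule hilbert_module_pre[OF E])
  obtain K0 where K0: "\<And>u x. cstar_positive u \<Longrightarrow> norm u \<le> 1 \<Longrightarrow> x \<in> hcarrier E \<Longrightarrow>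
    norm (hinner E x (\<phi> u x)) \<le> K0 * (hnorm E x)\<^sup>2"
    using completely_positive_form_bounded[OF assms] by blast
  define K where "K = sqrt \<bar>K0\<bar>"
  have K: "K \<ge> 0" "K * K = \<bar>K0\<bar>" by (auto simp: K_def)
  have "hnorm E (\<phi> u x) \<le> (K * K) * hnorm E x" if u: "cstar_positive u" "norm u \<le> 1" and x:
      "x \<in> hcarrier E" for u x
  proof -
    obtain Y Z where YZ: "is_adjoint E E Y Z" "\<And>x. x \<in> hcarrier E \<Longrightarrow> \<phi> u x = Z (Y x)"
      using completely_positive_factor[OF E cp u(1)] by blast
    note ZY = is_adjoint_swap[OF pre_hilbert_module_axioms pre_hilbert_module_axioms YZ(1)]
    have Y: "hnorm E (Y y) \<le> K * hnorm E y" if y: "y \<in> hcarrier E" for y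
    proof (rule power2_le_imp_le)
      have "(hnorm E (Y y))\<^sup>2 = norm (hinner E y (\<phi> u y))"
        using y is_adjointD[OF YZ(1)] by (simp add: hnorm_square YZ(2))
      also have "\<dots> \<le> (K * K) * (hnorm E y)\<^sup>2"
        unfolding K(2) by (rule order_trans[OF K0[OF u y]]) (auto intro: mult_right_mono)
      finally show "(hnorm E (Y y))\<^sup>2 \<le> (K * hnorm E y)\<^sup>2" by (simp only:
          power_mult_distrib power2_eq_square[of K])
    qed (use K in simp)
    have "hnorm E (Z (Y x)) \<le> K * hnorm E (Y x)"
      by (rule adjoint_bound[OF pre_hilbert_module_axioms pre_hilbert_module_axioms _ _ _ Y K(1)])
        (use is_adjointD[OF ZY] is_adjointD[OF YZ(1)] x in auto)
    also have "\<dots> \<le> K * (K * hnorm E x)" using Y[OF x] K by (intro mult_left_mono) auto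
    finally show ?thesis using YZ(2)[OF x] by simp
  qed
  then show ?thesis using K by (intro that[of "K * K"]) auto
qed

section \<open>Pointwise sums and multiples of adjointable maps\<close>

lemma is_adjoint_add:
  assumes "pre_hilbert_module E\<^sub>1" "pre_hilbert_module E\<^sub>2" "is_adjoint E\<^sub>1 E\<^sub>2 T S" "is_adjoint E\<^sub>1 E\<^sub>2
      T' S'"
  shows "is_adjoint E\<^sub>1 E\<^sub>2 (\<lambda>x\<in>hcarrier E\<^sub>1. hadd E\<^sub>2 (T x) (T' x)) (\<lambda>y\<in>hcarrier E\<^sub>2. hadd E\<^sub>1 (S y) (S'
      y))"
proof -
  interpret E1: pre_hilbert_module E\<^sub>1 by fact
  interpret E2: pre_hilbert_module E\<^sub>2 by fact
  show ?thesis
    by (rule is_adjoint_restrict)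
      (use is_adjointD[OF assms(3)] is_adjointD[OF assms(4)] in \<open>simp_all add:
          E1.inner_simps E2.inner_simps\<close>)
qed

lemma is_adjoint_scale:
  assumes "pre_hilbert_module E\<^sub>1" "pre_hilbert_module E\<^sub>2" "is_adjoint E\<^sub>1 E\<^sub>2 T S"
  shows "is_adjoint E\<^sub>1 E\<^sub>2 (\<lambda>x\<in>hcarrier E\<^sub>1. hscale E\<^sub>2 c (T x)) (\<lambda>y\<in>hcarrier E\<^sub>2. hscale E\<^sub>1 (cnj c) (S
      y))"
proof -
  interpret E1: pre_hilbert_module E\<^sub>1 by fact
  interpret E2: pre_hilbert_module E\<^sub>2 by fact
  show ?thesis
    by (rule is_adjoint_restrict)
      (use is_adjointD[OF assms(3)] in \<open>simp_all add: E1.inner_simps E2.inner_simps\<close>)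
qed

lemma hsum_cong: "(\<And>k. k < n \<Longrightarrow> f k = g k) \<Longrightarrow> hsum E f n = hsum E g n"
  by (induction n) auto

lemma adjointable_hsum:
  assumes E1: "pre_hilbert_module E\<^sub>1" and E2: "pre_hilbert_module E\<^sub>2"
    and T: "\<And>k. k < n \<Longrightarrow> T k \<in> adjointable E\<^sub>1 E\<^sub>2"
  shows "(\<lambda>x\<in>hcarrier E\<^sub>1. hsum E\<^sub>2 (\<lambda>k. T k x) n) \<in> adjointable E\<^sub>1 E\<^sub>2"
  using T
proof (induction n)
  case 0
  interpret E1: pre_hilbert_module E\<^sub>1 by fact
  interpret E2: pre_hilbert_module E\<^sub>2 by fact
  have "is_adjoint E\<^sub>1 E\<^sub>2 (\<lambda>x\<in>hcarrier E\<^sub>1. hzero E\<^sub>2) (\<lambda>x\<in>hcarrier E\<^sub>2. hzero E\<^sub>1)"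
    by (rule is_adjoint_restrict) auto
  then show ?case unfolding adjointable_def by (simp only: hsum.simps) blast
next
  case (Suc n)
  have "(\<lambda>x\<in>hcarrier E\<^sub>1. hsum E\<^sub>2 (\<lambda>k. T k x) n) \<in> adjointable E\<^sub>1 E\<^sub>2" "T n \<in> adjointable E\<^sub>1 E\<^sub>2"
    by (rule Suc.IH, rule Suc.prems, simp) (rule Suc.prems, simp)
  then obtain S S' where "is_adjoint E\<^sub>1 E\<^sub>2 (\<lambda>x\<in>hcarrier E\<^sub>1. hsum E\<^sub>2 (\<lambda>k. T k x) n) S" "is_adjoint E\<^sub>1
      E\<^sub>2 (T n) S'"
    unfolding adjointable_def by blast
  from is_adjoint_add[OF E1 E2 this]
  have "(\<lambda>x\<in>hcarrier E\<^sub>1. hadd E\<^sub>2 ((\<lambda>x\<in>hcarrier E\<^sub>1. hsum E\<^sub>2 (\<lambda>k. T k x) n) x) (T n x)) \<in> adjointable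
      E\<^sub>1 E\<^sub>2"
    unfolding adjointable_def by blast
  moreover have "(\<lambda>x\<in>hcarrier E\<^sub>1. hadd E\<^sub>2 ((\<lambda>x\<in>hcarrier E\<^sub>1. hsum E\<^sub>2 (\<lambda>k. T k x) n) x) (T n x))
    = (\<lambda>x\<in>hcarrier E\<^sub>1. hsum E\<^sub>2 (\<lambda>k. T k x) (Suc n))"
    by (rule restrict_ext) simp
  ultimately show ?case by (simp only:)
qed

section \<open>The functor\<close>

lemma (in balanced) simple_tensor_eqI:
  assumes "formal_tensor x y - v \<in> relation_span"
  shows "simple_tensor E F \<pi> x y = \<iota> v"
  using assms by (simp add: simple_tensor_eq \<iota>_def flip: tensor_coset_eq_iff)

lemma (in balanced) simple_tensor_add:
  assumes "x \<in> hcarrier E" "x' \<in> hcarrier E" "y \<in> hcarrier F"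
  shows "simple_tensor E F \<pi> (hadd E x x') y = hadd (interior_tensor E F \<pi>) (simple_tensor E F \<pi> x y)
      (simple_tensor E F \<pi> x' y)"
  using simple_tensor_eqI[of "hadd E x x'" y "formal_tensor x y + formal_tensor x' y"]
      relation_intros(1)[OF assms] assms
  by (simp add: \<iota>_add formal_tensor_in_carrier simple_tensor_eq algebra_simps)

lemma (in balanced) simple_tensor_scale:
  assumes "x \<in> hcarrier E" "y \<in> hcarrier F"
  shows "simple_tensor E F \<pi> (hscale E c x) y = hscale (interior_tensor E F \<pi>) c (simple_tensor E F \<pi> x
      y)"
  using simple_tensor_eqI[OF relation_intros(3)[OF assms]] assms
  by (simp add: \<iota>_scale formal_tensor_in_carrier simple_tensor_eq)

lemma (in balanced) simple_tensor_zero: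
  assumes "y \<in> hcarrier F"
  shows "simple_tensor E F \<pi> (hzero E) y = hzero (interior_tensor E F \<pi>)"
  using simple_tensor_scale[of "hzero E" y 0] assms simple_tensor_closed[of "hzero E" y]
  by (simp add: E.scale_zero pre_hilbert_module.scale_zero[OF pre_hilbert_interior])

lemma (in balanced) simple_tensor_hsum:
  assumes "\<And>k. k < n \<Longrightarrow> f k \<in> hcarrier E" "y \<in> hcarrier F"
  shows "simple_tensor E F \<pi> (hsum E f n) y = hsum (interior_tensor E F \<pi>) (\<lambda>k. simple_tensor E F \<pi> (f k)
      y) n"
  using assms by (induction n) (auto simp: simple_tensor_zero simple_tensor_add E.hsum_closed)

context star_representation
begin

abbreviation tensor_op ("_ \<otimes>I[_,_]" [90, 0, 0] 90) where
  "T \<otimes>I[E\<^sub>1, E\<^sub>2] \<equiv> tensor_extension E\<^sub>1 E\<^sub>2 F \<pi> T"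

abbreviation tensor_module ("_\<otimes>F" [90] 90) where
  "E\<otimes>F \<equiv> interior_tensor E F \<pi>"

lemma balanced: "hilbert_module E \<Longrightarrow> balanced E F \<pi>"
  by (intro balanced.intro star_representation_axioms hilbert_module_pre)

lemma tensor_op_adjointable:
  "hilbert_module E\<^sub>1 \<Longrightarrow> hilbert_module E\<^sub>2 \<Longrightarrow> T \<in> adjointable E\<^sub>1 E\<^sub>2 \<Longrightarrow>
      T \<otimes>I[E\<^sub>1, E\<^sub>2] \<in> adjointable (E\<^sub>1\<otimes>F) (E\<^sub>2\<otimes>F)"
  by (drule (2) is_tensor_extension_tensor_extension) (simp add: is_tensor_extension_def)

lemma tensor_op_simple:
  "hilbert_module E\<^sub>1 \<Longrightarrow> hilbert_module E\<^sub>2 \<Longrightarrow> T \<in> adjointable E\<^sub>1 E\<^sub>2 \<Longrightarrow> x \<in> hcarrier E\<^sub>1 \<Longrightarrow>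
      f \<in> hcarrier F \<Longrightarrow>
    (T \<otimes>I[E\<^sub>1, E\<^sub>2]) (simple_tensor E\<^sub>1 F \<pi> x f) = simple_tensor E\<^sub>2 F \<pi> (T x) f"
  by (drule (2) is_tensor_extension_tensor_extension) (simp add: is_tensor_extension_def)

lemma tensor_op_compose:
  assumes E: "hilbert_module E\<^sub>1" "hilbert_module E\<^sub>2" "hilbert_module E\<^sub>3"
    and T: "T \<in> adjointable E\<^sub>1 E\<^sub>2" "T' \<in> adjointable E\<^sub>2 E\<^sub>3"
  shows "compose (hcarrier E\<^sub>1) T' T \<otimes>I[E\<^sub>1, E\<^sub>3] = compose (hcarrier (E\<^sub>1\<otimes>F)) (T' \<otimes>I[E\<^sub>2, E\<^sub>3]) (T
      \<otimes>I[E\<^sub>1, E\<^sub>2])"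
  by (rule tensor_extension_eqI[OF E(1,3)])
    (auto simp: is_tensor_extension_def compose_eq tensor_op_simple[OF E(1,2) T(1)] tensor_op_simple[OF
        E(2,3) T(2)]
      balanced.simple_tensor_closed[OF balanced[OF E(1)]] adjointable_closed[OF T(1)]
      intro!: adjointable_compose tensor_op_adjointable E T)

lemma tensor_op_id:
  assumes E: "hilbert_module E"
  shows "restrict id (hcarrier E) \<otimes>I[E, E] = restrict id (hcarrier (E\<otimes>F))"
  by (rule tensor_extension_eqI[OF E E])
    (auto simp: is_tensor_extension_def adjointable_id balanced.simple_tensor_closed[OF balanced[OF E]])

text \<open>\<open>T \<otimes> I\<close> has some adjoint \<open>g\<close>. Pairing with simple
  tensors shows that \<open>g\<close> sends the class of \<open>y \<otimes> f\<close> to that of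
  \<open>S y \<otimes> f\<close>, so uniqueness of extensions identifies it with
  \<open>S \<otimes> I\<close>.\<close>

lemma is_adjoint_tensor_op:
  assumes E1: "hilbert_module E\<^sub>1" and E2: "hilbert_module E\<^sub>2" and TS: "is_adjoint E\<^sub>1 E\<^sub>2 T S"
  shows "is_adjoint (E\<^sub>1\<otimes>F) (E\<^sub>2\<otimes>F) (T \<otimes>I[E\<^sub>1, E\<^sub>2]) (S \<otimes>I[E\<^sub>2, E\<^sub>1])"
proof -
  interpret B1: balanced E\<^sub>1 F \<pi> by (rule balanced[OF E1])
  interpret B2: balanced E\<^sub>2 F \<pi> by (rule balanced[OF E2])
  interpret I1: pre_hilbert_module "E\<^sub>1\<otimes>F" by (rule B1.pre_hilbert_interior)
  interpret I2: pre_hilbert_module "E\<^sub>2\<otimes>F" by (rule B2.pre_hilbert_interior)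
  have T: "T \<in> adjointable E\<^sub>1 E\<^sub>2" using TS by (auto simp: adjointable_def)
  obtain g where g: "is_adjoint (E\<^sub>1\<otimes>F) (E\<^sub>2\<otimes>F) (T \<otimes>I[E\<^sub>1, E\<^sub>2]) g"
    using tensor_op_adjointable[OF E1 E2 T] by (auto simp: adjointable_def)
  note g' = is_adjoint_swap[OF I1.pre_hilbert_module_axioms I2.pre_hilbert_module_axioms g]
  have "is_tensor_extension E\<^sub>2 E\<^sub>1 F \<pi> S g"
    unfolding is_tensor_extension_def
  proof (intro conjI ballI)
    show "g \<in> adjointable (E\<^sub>2\<otimes>F) (E\<^sub>1\<otimes>F)" using g' by (auto simp: adjointable_def)
    fix y f assume y: "y \<in> hcarrier E\<^sub>2" and f: "f \<in> hcarrier F"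
    show "g (simple_tensor E\<^sub>2 F \<pi> y f) = simple_tensor E\<^sub>1 F \<pi> (S y) f"
    proof (rule B1.eq_if_inner_simple_tensors_eq)
      fix x f' assume x: "x \<in> hcarrier E\<^sub>1" and f': "f' \<in> hcarrier F"
      have "hinner (E\<^sub>1\<otimes>F) (g (simple_tensor E\<^sub>2 F \<pi> y f)) (simple_tensor E\<^sub>1 F \<pi> x f')
        = hinner (E\<^sub>2\<otimes>F) (simple_tensor E\<^sub>2 F \<pi> y f) (simple_tensor E\<^sub>2 F \<pi> (T x) f')"
        using x y f f' is_adjointD(3)[OF g'] B1.simple_tensor_closed B2.simple_tensor_closed
        by (simp add: tensor_op_simple[OF E1 E2 T])
      also have "\<dots> = hinner (E\<^sub>1\<otimes>F) (simple_tensor E\<^sub>1 F \<pi> (S y) f) (simple_tensor E\<^sub>1 F \<pi> x f')"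
        using x y f f' is_adjointD[OF TS]
          is_adjointD(3)[OF is_adjoint_swap[OF B1.E.pre_hilbert_module_axioms
              B2.E.pre_hilbert_module_axioms TS]]
        by (simp add: B1.simple_tensor_eq B2.simple_tensor_eq B1.\<iota>_inner B2.\<iota>_inner
            formal_tensor_in_carrier formal_inner_tensor)
      finally show "hinner (E\<^sub>1\<otimes>F) (g (simple_tensor E\<^sub>2 F \<pi> y f)) (simple_tensor E\<^sub>1 F \<pi> x f')
        = hinner (E\<^sub>1\<otimes>F) (simple_tensor E\<^sub>1 F \<pi> (S y) f) (simple_tensor E\<^sub>1 F \<pi> x f')" .
    qed (use y f is_adjointD(2)[OF TS] is_adjointD(1)[OF g'] B1.simple_tensor_closed
        B2.simple_tensor_closed in auto)
  qed
  then have "S \<otimes>I[E\<^sub>2, E\<^sub>1] = g" by (rule tensor_extension_eqI[OF E2 E1])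
  then show ?thesis using g by simp
qed

text \<open>\<open>T \<mapsto> T \<otimes> I\<close> respects adjoints, composition and finite sums,
  so a factorization of the matrix \<open>\<phi> (M i j)\<close> carries over entry by
  entry.\<close>

lemma tensor_completely_positive:
  assumes E: "hilbert_module E" and cp: "completely_positive E \<phi>"
  shows "completely_positive (E\<otimes>F) (\<lambda>a. \<phi> a \<otimes>I[E, E])"
proof -
  interpret B: balanced E F \<pi> by (rule balanced[OF E])
  interpret I: pre_hilbert_module "E\<otimes>F" by (rule B.pre_hilbert_interior)
  note lin = completely_positive_linear[OF cp]
  note hat = tensor_op_adjointable[OF E E lin(1)]
  note simple = tensor_op_simple[OF E E lin(1)]
  have hat_adj: "is_adjoint (E\<otimes>F) (E\<otimes>F) (\<phi> a \<otimes>I[E, E]) (adjoint_map (E\<otimes>F) (E\<otimes>F) (\<phi> a \<otimes>I[E, E]))" for a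
    by (rule is_adjoint_adjoint_map[OF B.hilbert_interior hat])
  have "linear_into_adjointable (E\<otimes>F) (\<lambda>a. \<phi> a \<otimes>I[E, E])"
    unfolding linear_into_adjointable_def
  proof (intro conjI allI ballI)
    show "\<phi> a \<otimes>I[E, E] \<in> adjointable (E\<otimes>F) (E\<otimes>F)" for a by (rule hat)
    fix z assume z: "z \<in> hcarrier (E\<otimes>F)"
    show "(\<phi> (a + a') \<otimes>I[E, E]) z = hadd (E\<otimes>F) ((\<phi> a \<otimes>I[E, E]) z) ((\<phi> a' \<otimes>I[E, E]) z)" for a a'
    proof -
      have "\<phi> (a + a') \<otimes>I[E, E] = (\<lambda>z\<in>hcarrier (E\<otimes>F). hadd (E\<otimes>F) ((\<phi> a \<otimes>I[E, E]) z) ((\<phi> a' \<otimes>I[E, E]) z))"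
        using is_adjoint_add[OF I.pre_hilbert_module_axioms I.pre_hilbert_module_axioms hat_adj[of a]
            hat_adj[of a']]
        by (intro tensor_extension_eqI[OF E E])
          (auto simp: is_tensor_extension_def adjointable_def simple lin B.simple_tensor_closed
              B.simple_tensor_add
            adjointable_closed[OF lin(1)])
      then show ?thesis using z by simp
    qed
    show "(\<phi> (c *\<^sub>C a) \<otimes>I[E, E]) z = hscale (E\<otimes>F) c ((\<phi> a \<otimes>I[E, E]) z)" for c a
    proof -
      have "\<phi> (c *\<^sub>C a) \<otimes>I[E, E] = (\<lambda>z\<in>hcarrier (E\<otimes>F). hscale (E\<otimes>F) c ((\<phi> a \<otimes>I[E, E]) z))"
        using is_adjoint_scale[OF I.pre_hilbert_module_axioms I.pre_hilbert_module_axioms hat_adj[of a],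
            of c]
        by (intro tensor_extension_eqI[OF E E])
          (auto simp: is_tensor_extension_def adjointable_def simple lin B.simple_tensor_closed
              B.simple_tensor_scale
            adjointable_closed[OF lin(1)])
      then show ?thesis using z by simp
    qed
  qed
  moreover have "op_mat_positive (E\<otimes>F) n (\<lambda>i j. \<phi> (M i j) \<otimes>I[E, E])" if "cstar_mat_positive n M" for n M
  proof -
    have "op_mat_positive E n (\<lambda>i j. \<phi> (M i j))"
      using cp that by (simp add: completely_positive_def)
    then obtain Y where Y': "(\<forall>k<n. \<forall>i<n. Y k i \<in> adjointable E E) \<and> (\<forall>i<n. \<forall>j<n. \<forall>x\<in>hcarrier E.
        \<phi> (M i j) x = hsum E (\<lambda>k. adjoint_map E E (Y k i) (Y k j x)) n)"
      unfolding op_mat_positive_def ..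
    have Y: "\<And>k i. k < n \<Longrightarrow> i < n \<Longrightarrow> Y k i \<in> adjointable E E"
      "\<And>i j x. i < n \<Longrightarrow> j < n \<Longrightarrow> x \<in> hcarrier E \<Longrightarrow>
        \<phi> (M i j) x = hsum E (\<lambda>k. adjoint_map E E (Y k i) (Y k j x)) n"
      using Y' by auto
    show ?thesis
      unfolding op_mat_positive_def
    proof (intro exI[of _ "\<lambda>k i. Y k i \<otimes>I[E, E]"] conjI allI impI ballI)
      show "Y k i \<otimes>I[E, E] \<in> adjointable (E\<otimes>F) (E\<otimes>F)" if "k < n" "i < n" for k i
        using tensor_op_adjointable[OF E E Y(1)] that .
      fix i j z assume i: "i < n" and j: "j < n" and z: "z \<in> hcarrier (E\<otimes>F)"
      define A where "A k = adjoint_map E E (Y k i)" for k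
      have A: "is_adjoint E E (Y k i) (A k)" "A k \<in> adjointable E E" if "k < n" for k
      proof -
        show "is_adjoint E E (Y k i) (A k)" unfolding A_def by (rule is_adjoint_adjoint_map[OF E Y(1)[OF
            that i]])
        from is_adjoint_swap[OF B.E.pre_hilbert_module_axioms B.E.pre_hilbert_module_axioms this]
        show "A k \<in> adjointable E E" by (auto simp: adjointable_def)
      qed
      have A': "adjoint_map (E\<otimes>F) (E\<otimes>F) (Y k i \<otimes>I[E, E]) = A k \<otimes>I[E, E]" if "k < n" for k
        by (rule adjoint_map_eq[OF B.hilbert_interior is_adjoint_tensor_op[OF E E A(1)[OF that]]])
      define G where "G k = compose (hcarrier (E\<otimes>F)) (A k \<otimes>I[E, E]) (Y k j \<otimes>I[E, E])" for k
      have G: "G k \<in> adjointable (E\<otimes>F) (E\<otimes>F)" if "k < n" for k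
        unfolding G_def
        by (rule adjointable_compose[OF tensor_op_adjointable[OF E E Y(1)[OF that j]]
            tensor_op_adjointable[OF E E A(2)[OF that]]])
      have Gs: "G k (simple_tensor E F \<pi> x f) = simple_tensor E F \<pi> (A k (Y k j x)) f"
        if "k < n" "x \<in> hcarrier E" "f \<in> hcarrier F" for k x f
        using that by (simp add: G_def compose_eq B.simple_tensor_closed tensor_op_simple[OF E E] A Y j
            adjointable_closed[OF Y(1)])
      have AY: "A k (Y k j x) \<in> hcarrier E" if "k < n" "x \<in> hcarrier E" for k x
        using adjointable_closed[OF A(2)] adjointable_closed[OF Y(1)] that j by blast
      \<comment> \<open>The right-hand side is an adjointable map with the values of
        \<open>\<phi> (M i j) \<otimes> I\<close> on simple tensors, which suffices by
        uniqueness.\<close>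
      have "\<phi> (M i j) \<otimes>I[E, E] = (\<lambda>z\<in>hcarrier (E\<otimes>F). hsum (E\<otimes>F) (\<lambda>k. G k z) n)"
      proof (rule tensor_extension_eqI[OF E E])
        have "hsum (E\<otimes>F) (\<lambda>k. G k (simple_tensor E F \<pi> x f)) n = simple_tensor E F \<pi> (\<phi> (M i j) x) f"
          if "x \<in> hcarrier E" "f \<in> hcarrier F" for x f
        proof -
          have "hsum (E\<otimes>F) (\<lambda>k. G k (simple_tensor E F \<pi> x f)) n =
              hsum (E\<otimes>F) (\<lambda>k. simple_tensor E F \<pi> (A k (Y k j x)) f) n"
            by (rule hsum_cong) (rule Gs[OF _ that])
          also have "\<dots> = simple_tensor E F \<pi> (hsum E (\<lambda>k. A k (Y k j x)) n) f"
            by (rule B.simple_tensor_hsum[symmetric]) (use AY that in auto)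
          also have "hsum E (\<lambda>k. A k (Y k j x)) n = \<phi> (M i j) x" using Y(2)[OF i j that(1)] by (simp add:
              A_def)
          finally show ?thesis .
        qed
        then show "is_tensor_extension E E F \<pi> (\<phi> (M i j)) (\<lambda>z\<in>hcarrier (E\<otimes>F). hsum (E\<otimes>F) (\<lambda>k. G k z) n)"
          using adjointable_hsum[OF I.pre_hilbert_module_axioms I.pre_hilbert_module_axioms G]
          by (simp add: is_tensor_extension_def B.simple_tensor_closed)
      qed
      then have "(\<phi> (M i j) \<otimes>I[E, E]) z = hsum (E\<otimes>F) (\<lambda>k. G k z) n" using z by simp
      also have "\<dots> = hsum (E\<otimes>F) (\<lambda>k. adjoint_map (E\<otimes>F) (E\<otimes>F) (Y k i \<otimes>I[E, E]) ((Y k j \<otimes>I[E, E]) z)) n"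
        by (rule hsum_cong) (simp add: A' G_def compose_eq z)
      finally show "(\<phi> (M i j) \<otimes>I[E, E]) z
        = hsum (E\<otimes>F) (\<lambda>k. adjoint_map (E\<otimes>F) (E\<otimes>F) (Y k i \<otimes>I[E, E]) ((Y k j \<otimes>I[E, E]) z)) n" .
    qed
  qed
  ultimately show ?thesis by (auto simp: completely_positive_def)
qed

text \<open>The same approximate unit works. The Cauchy property passes from \<open>x\<close> to the
  class of \<open>x \<otimes> f\<close> by the cross-norm estimate, to finite sums by linearity, and
  to limits because the operators \<open>\<phi> u \<otimes> I\<close> are uniformly bounded on
  positive contractions \<open>u\<close>.\<close>

lemma tensor_strict:
  fixes \<phi> :: "'a::cstar_algebra \<Rightarrow> 'e \<Rightarrow> 'e"
  assumes E: "hilbert_module E" and cp: "completely_positive E \<phi>" and strict: "strict_map E \<phi>"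
  shows "strict_map (E\<otimes>F) (\<lambda>a. \<phi> a \<otimes>I[E, E])"
proof -
  interpret B: balanced E F \<pi> by (rule balanced[OF E])
  interpret I: pre_hilbert_module "E\<otimes>F" by (rule B.pre_hilbert_interior)
  note lin = completely_positive_linear[OF cp]
  note hat = tensor_op_adjointable[OF E E lin(1)]
  note hat_linear = adjointable_linear[OF I.pre_hilbert_module_axioms B.hilbert_interior hat]
  note simple = tensor_op_simple[OF E E lin(1)]
  note [simp] = adjointable_closed[OF hat] adjointable_closed[OF lin(1)]
  obtain U where U: "approximate_unit U" and Cauchy: "\<And>x e. x \<in> hcarrier E \<Longrightarrow> e > 0 \<Longrightarrow>
     \<exists>P. eventually P U \<and> (\<forall>u v. P u \<longrightarrow> P v \<longrightarrow> hnorm E (hdiff E (\<phi> u x) (\<phi> v x)) < e)"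
    using strict unfolding strict_map_def by meson
  define pc where "pc u \<longleftrightarrow> cstar_positive u \<and> norm u \<le> 1" for u :: 'a
  have pc: "eventually pc U" using U by (auto simp: approximate_unit_def pc_def[abs_def])
  obtain K where K: "K \<ge> 0" "\<And>u x. pc u \<Longrightarrow> x \<in> hcarrier E \<Longrightarrow> hnorm E (\<phi> u x) \<le> K * hnorm E x"
    using completely_positive_bounded[OF E cp] unfolding pc_def by metis
  have hat_bound: "hnorm (E\<otimes>F) ((\<phi> u \<otimes>I[E, E]) z) \<le> K * hnorm (E\<otimes>F) z" if "pc u" "z \<in> hcarrier (E\<otimes>F)"
      for u z
    by (rule hnorm_tensor_extension[OF E E lin(1) K(1) K(2)[OF that(1)] that(2)])
  let ?D = "\<lambda>z u v. hnorm (E\<otimes>F) (hdiff (E\<otimes>F) ((\<phi> u \<otimes>I[E, E]) z) ((\<phi> v \<otimes>I[E, E]) z))"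
  define small where "small z \<longleftrightarrow> (\<forall>e>0. \<exists>P. eventually P U \<and> (\<forall>u v. P u \<longrightarrow> P v \<longrightarrow> ?D z u v < e))" for z
  have smallE: "\<exists>P. eventually P U \<and> (\<forall>u v. P u \<longrightarrow> P v \<longrightarrow> ?D z u v < e)" if "small z" "e > 0" for z e
    using that by (simp add: small_def)
  have dense: "small (B.\<iota> w)"
    if "w \<in> formal_carrier E F" for w
  proof -
    have "w \<in> {w \<in> formal_carrier E F. small (B.\<iota> w)}"
      using that
    proof (induction rule: formal_carrier_induct)
      case zero
      \<comment> \<open>Writing the zero vector as 0 times itself lets homogeneity show that all
        differences of its images have norm 0.\<close>
      have "B.\<iota> 0 = hscale (E\<otimes>F) 0 (B.\<iota> 0)"
        using B.\<iota>_scale[of 0 0] by (simp add: formal.subspace_0[OF subspace_formal_carrier])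
      then have "?D (B.\<iota> 0) u v = ?D (hscale (E\<otimes>F) 0 (B.\<iota> 0)) u v" for u v by simp
      also have "\<dots> u v = 0" for u v
        by (simp add: hat_linear(2) I.hnorm_diff_scale formal.subspace_0[OF subspace_formal_carrier])
      finally show ?case by (auto simp: small_def formal.subspace_0[OF subspace_formal_carrier] intro!:
          exI[of _ "\<lambda>u. True"])
    next
      case (add w w')
      have "\<exists>P. eventually P U \<and> (\<forall>u v. P u \<longrightarrow> P v \<longrightarrow> ?D (B.\<iota> (w + w')) u v < e)" if "e > 0" for e
      proof -
        have e2: "e / 2 > 0" using that by simp
        obtain P where P: "eventually P U" "\<And>u v. P u \<Longrightarrow> P v \<Longrightarrow> ?D (B.\<iota> w) u v < e / 2"
          using smallE[OF _ e2, of "B.\<iota> w"] add(1) by blast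
        obtain P' where P': "eventually P' U" "\<And>u v. P' u \<Longrightarrow> P' v \<Longrightarrow> ?D (B.\<iota> w') u v < e / 2"
          using smallE[OF _ e2, of "B.\<iota> w'"] add(2) by blast
        have "?D (B.\<iota> (w + w')) u v < e" if "P u \<and> P' u" "P v \<and> P' v" for u v
        proof -
          have "?D (B.\<iota> (w + w')) u v \<le> ?D (B.\<iota> w) u v + ?D (B.\<iota> w') u v"
            using add by (simp add: B.\<iota>_add hat_linear(1) I.hnorm_diff_add)
          then show ?thesis using P(2)[of u v] P'(2)[of u v] that by simp
        qed
        then show ?thesis using eventually_conj[OF P(1) P'(1)] by (intro exI[of _ "\<lambda>u. P u \<and> P' u"]) auto
      qed
      then show ?case using add by (auto simp: small_def intro:
          formal.subspace_add[OF subspace_formal_carrier])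
    next
      case (scale c w)
      have "\<exists>P. eventually P U \<and> (\<forall>u v. P u \<longrightarrow> P v \<longrightarrow> ?D (B.\<iota> (formal_scale c w)) u v < e)" if "e > 0"
          for e
      proof -
        have d: "e / (cmod c + 1) > 0" using that by (simp add: add_nonneg_pos)
        obtain P where P: "eventually P U" "\<And>u v. P u \<Longrightarrow> P v \<Longrightarrow> ?D (B.\<iota> w) u v < e / (cmod c + 1)"
          using smallE[OF _ d, of "B.\<iota> w"] scale by auto
        have "?D (B.\<iota> (formal_scale c w)) u v < e" if "P u" "P v" for u v
        proof -
          have "?D (B.\<iota> (formal_scale c w)) u v = cmod c * ?D (B.\<iota> w) u v"
            using scale by (simp add: B.\<iota>_scale hat_linear(2) I.hnorm_diff_scale)
          also have "\<dots> \<le> (cmod c + 1) * ?D (B.\<iota> w) u v" by (intro mult_right_mono) auto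
          also have "\<dots> < (cmod c + 1) * (e / (cmod c + 1))"
            using P(2)[OF that] by (intro mult_strict_left_mono) (auto simp: add_nonneg_pos)
          also have "\<dots> = e" using norm_ge_zero[of c] by (simp del: norm_ge_zero)
          finally show ?thesis .
        qed
        then show ?thesis using P(1) by blast
      qed
      then show ?case using scale by (auto simp: small_def intro:
          formal.subspace_scale[OF subspace_formal_carrier])
    next
      case (tensor x f)
      have "\<exists>P. eventually P U \<and> (\<forall>u v. P u \<longrightarrow> P v \<longrightarrow> ?D (B.\<iota> (formal_tensor x f)) u v < e)" if "e > 0"
          for e
      proof -
        have d: "e / (hnorm F f + 1) > 0" using that by (simp add: add_nonneg_pos)
        obtain P where P: "eventually P U" "\<And>u v. P u \<Longrightarrow> P v \<Longrightarrow>
            hnorm E (hdiff E (\<phi> u x) (\<phi> v x)) < e / (hnorm F f + 1)"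
          using Cauchy[OF tensor(1) d] by blast
        have "?D (B.\<iota> (formal_tensor x f)) u v < e" if "P u" "P v" for u v
        proof -
          have "?D (B.\<iota> (formal_tensor x f)) u v \<le> hnorm E (hdiff E (\<phi> u x) (\<phi> v x)) * hnorm F f"
            using tensor by (simp add: simple B.hnorm_simple_tensor_diff_le flip: B.simple_tensor_eq)
          also have "\<dots> \<le> hnorm E (hdiff E (\<phi> u x) (\<phi> v x)) * (hnorm F f + 1)"
              by (intro mult_left_mono) auto
          also have "\<dots> < (e / (hnorm F f + 1)) * (hnorm F f + 1)"
            using P(2)[OF that] by (intro mult_strict_right_mono) (auto simp: add_nonneg_pos)
          also have "\<dots> = e" using F.hnorm_nonneg[of f] by (simp del: F.hnorm_nonneg)
          finally show ?thesis .
        qed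
        then show ?thesis using P(1) by blast
      qed
      then show ?case using tensor by (auto simp: small_def formal_tensor_in_carrier)
    qed
    then show ?thesis by blast
  qed
  have main: "\<exists>P. eventually P U \<and> (\<forall>u v. P u \<longrightarrow> P v \<longrightarrow> ?D z u v < e)"
    if z: "z \<in> hcarrier (E\<otimes>F)" and e: "e > 0" for z e
  proof -
    \<comment> \<open>Two approximation errors of at most \<open>K * d <= e / 4\<close> each leave
      \<open>e / 2\<close> for the approximating vector; the \<open>+ 1\<close> allows
      \<open>K = 0\<close>.\<close>
    define d where "d = e / (4 * (K + 1))"
    have d: "d > 0" using e K(1) by (simp add: d_def)
    obtain w where w: "w \<in> formal_carrier E F" "hnorm (E\<otimes>F) (hdiff (E\<otimes>F) z (B.\<iota> w)) < d"
      using B.interior_approx[OF z d] .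
    obtain P where P: "eventually P U" "\<And>u v. P u \<Longrightarrow> P v \<Longrightarrow> ?D (B.\<iota> w) u v < e / 2"
      using smallE[OF dense[OF w(1)] half_gt_zero[OF e]] by blast
    have "?D z u v < e" if "P u \<and> pc u" "P v \<and> pc v" for u v
    proof -
      have near: "hnorm (E\<otimes>F) (hdiff (E\<otimes>F) ((\<phi> u \<otimes>I[E, E]) z) ((\<phi> u \<otimes>I[E, E]) (B.\<iota> w))) \<le> K * d"
          if "pc u" for u
      proof -
        have "hnorm (E\<otimes>F) ((\<phi> u \<otimes>I[E, E]) (hdiff (E\<otimes>F) z (B.\<iota> w))) \<le>
            K * hnorm (E\<otimes>F) (hdiff (E\<otimes>F) z (B.\<iota> w))"
          using z w by (intro hat_bound that) auto
        also have "\<dots> \<le> K * d" using w(2) K(1) by (intro mult_left_mono) auto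
        finally show ?thesis using z w by (simp add: hat_linear(4))
      qed
      let ?u = "\<phi> u \<otimes>I[E, E]" and ?v = "\<phi> v \<otimes>I[E, E]" and ?n = "\<lambda>a b. hnorm (E\<otimes>F) (hdiff (E\<otimes>F) a b)"
      have "?n (?u z) (?v z) \<le> ?n (?u z) (?u (B.\<iota> w)) + (?n (?u (B.\<iota> w)) (?v (B.\<iota> w)) + ?n (?v (B.\<iota> w))
          (?v z))"
        by (rule order_trans[OF I.hnorm_diff_triangle[of _ "?u (B.\<iota> w)"] add_left_mono[OF
            I.hnorm_diff_triangle]])
          (use z w in auto)
      also have "?n (?v (B.\<iota> w)) (?v z) = ?n (?v z) (?v (B.\<iota> w))" using z w
          by (intro I.hnorm_diff_commute) auto
      also have "?n (?u z) (?u (B.\<iota> w)) + (?n (?u (B.\<iota> w)) (?v (B.\<iota> w)) + ?n (?v z) (?v (B.\<iota> w))) < K * d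
          + (e / 2 + K * d)"
        using near[of u] near[of v] P(2)[of u v] that by (intro add_le_less_mono add_less_le_mono) auto
      also have "\<dots> \<le> e"
      proof -
        have "(K + 1) * d = e / 4"
          unfolding d_def using K(1) by (simp add: add_nonneg_eq_0_iff del: distrib_left_numeral)
        then have "K * d \<le> e / 4" using d by (simp add: algebra_simps)
        then show ?thesis by simp
      qed
      finally show ?thesis .
    qed
    then show ?thesis using eventually_conj[OF P(1) pc] by (intro exI[of _ "\<lambda>u. P u \<and> pc u"]) auto
  qed
  \<comment> \<open>On positive contractions the adjoint seminorm therefore equals the direct one,
    and the bound \<open>main\<close> settles both.\<close>
  have self: "adjoint_map (E\<otimes>F) (E\<otimes>F) (\<phi> u \<otimes>I[E, E]) = \<phi> u \<otimes>I[E, E]" if "pc u" for u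
    using that unfolding pc_def
    by (intro adjoint_map_eq[OF B.hilbert_interior] is_adjoint_tensor_op[OF E E]
        completely_positive_self_adjoint[OF E cp]) auto
  show ?thesis
    unfolding strict_map_def
  proof (intro exI[of _ U] conjI U ballI allI impI)
    fix z e assume "z \<in> hcarrier (E\<otimes>F)" "(e::real) > 0"
    then obtain P where "eventually P U" "\<forall>u v. P u \<longrightarrow> P v \<longrightarrow> ?D z u v < e" using main by blast
    then show "\<exists>P. eventually P U \<and> (\<forall>u v. P u \<longrightarrow> P v \<longrightarrow> ?D z u v < e \<and>
        hnorm (E\<otimes>F) (hdiff (E\<otimes>F) (adjoint_map (E\<otimes>F) (E\<otimes>F) (\<phi> u \<otimes>I[E, E]) z) (adjoint_map (E\<otimes>F) (E\<otimes>F) (\<phi> v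
            \<otimes>I[E, E]) z)) < e)"
      using eventually_conj[OF \<open>eventually P U\<close> pc] by (intro exI[of _ "\<lambda>u. P u \<and> pc u"]) (simp add:
          self)
  qed
qed

end

section \<open>The category of positive correspondences and the functor on it\<close>

lemma star_automorphism_id: "star_automorphism id"
  by (simp add: star_automorphism_def)

lemma star_automorphism_comp: "star_automorphism \<alpha> \<Longrightarrow> star_automorphism \<beta> \<Longrightarrow> star_automorphism (\<beta> \<circ> \<alpha>)"
  by (simp add: star_automorphism_def bij_comp)

lemma PosCor_simps:
  "(E, \<phi>) \<in> Ob PosCor \<longleftrightarrow> hilbert_module E \<and> completely_positive E \<phi> \<and> strict_map E \<phi>"
  "(\<eta>, \<alpha>) \<in> Hom PosCor (E\<^sub>1, \<phi>\<^sub>1) (E\<^sub>2, \<phi>\<^sub>2) \<longleftrightarrow> \<eta> \<in> adjointable E\<^sub>1 E\<^sub>2 \<and> star_automorphism \<alpha> \<and>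
    (\<forall>a. compose (hcarrier E\<^sub>1) (\<phi>\<^sub>2 (\<alpha> a)) \<eta> = compose (hcarrier E\<^sub>1) \<eta> (\<phi>\<^sub>1 a))"
  "Id PosCor (E, \<phi>) = (restrict id (hcarrier E), id)"
  "Comp PosCor (E\<^sub>1, \<phi>\<^sub>1) (E\<^sub>2, \<phi>\<^sub>2) (E\<^sub>3, \<phi>\<^sub>3) (\<xi>, \<beta>) (\<eta>, \<alpha>) = (compose (hcarrier E\<^sub>1) \<xi> \<eta>, \<beta> \<circ> \<alpha>)"
  by (simp_all add: PosCor_def)

text \<open>Serves both the source and the target of the functor, at different module types. Since
  maps are extensional on their carriers, the unit laws hold as equalities of functions although the
  identity is a restricted one.\<close>

lemma is_category_PosCor: "is_category PosCor"
proof -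
  have closed: "\<phi> a x \<in> hcarrier E" if "(E, \<phi>) \<in> Ob PosCor" "x \<in> hcarrier E" for E \<phi> a x
    using that adjointable_closed completely_positive_linear(1) unfolding PosCor_simps by metis
  have intertwine: "\<phi>\<^sub>2 (\<alpha> a) (\<eta> x) = \<eta> (\<phi>\<^sub>1 a x)"
    if "(\<eta>, \<alpha>) \<in> Hom PosCor (E\<^sub>1, \<phi>\<^sub>1) (E\<^sub>2, \<phi>\<^sub>2)" "x \<in> hcarrier E\<^sub>1" for E\<^sub>1 \<phi>\<^sub>1 E\<^sub>2 \<phi>\<^sub>2 \<eta> \<alpha> a x
  proof -
    have "compose (hcarrier E\<^sub>1) (\<phi>\<^sub>2 (\<alpha> a)) \<eta> x = compose (hcarrier E\<^sub>1) \<eta> (\<phi>\<^sub>1 a) x" using that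
        by (simp add: PosCor_simps)
    then show ?thesis using that by (simp add: compose_eq)
  qed
  have comp: "Comp PosCor X Y Z g f \<in> Hom PosCor X Z"
    if "X \<in> Ob PosCor" "Y \<in> Ob PosCor" "Z \<in> Ob PosCor" "f \<in> Hom PosCor X Y" "g \<in> Hom PosCor Y Z"
        for X Y Z f g
  proof -
    obtain E\<^sub>1 \<phi>\<^sub>1 E\<^sub>2 \<phi>\<^sub>2 E\<^sub>3 \<phi>\<^sub>3 \<eta> \<alpha> \<xi> \<beta> where [simp]: "X = (E\<^sub>1, \<phi>\<^sub>1)" "Y = (E\<^sub>2, \<phi>\<^sub>2)" "Z =
        (E\<^sub>3, \<phi>\<^sub>3)" "f = (\<eta>, \<alpha>)" "g = (\<xi>, \<beta>)"
      by (cases X, cases Y, cases Z, cases f, cases g)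
    note f = that(4)[simplified] and g = that(5)[simplified]
    have "compose (hcarrier E\<^sub>1) (\<phi>\<^sub>3 (\<beta> (\<alpha> a))) (compose (hcarrier E\<^sub>1) \<xi> \<eta>) =
        compose (hcarrier E\<^sub>1) (compose (hcarrier E\<^sub>1) \<xi> \<eta>) (\<phi>\<^sub>1 a)" for a
    proof (rule extensionalityI[of _ "hcarrier E\<^sub>1"])
      fix x assume x: "x \<in> hcarrier E\<^sub>1"
      then have "\<eta> x \<in> hcarrier E\<^sub>2" "\<phi>\<^sub>1 a x \<in> hcarrier E\<^sub>1"
        using f adjointable_closed[of \<eta>] closed[OF that(1)[simplified]] by (auto simp: PosCor_simps)
      then show "compose (hcarrier E\<^sub>1) (\<phi>\<^sub>3 (\<beta> (\<alpha> a))) (compose (hcarrier E\<^sub>1) \<xi> \<eta>) x =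
          compose (hcarrier E\<^sub>1) (compose (hcarrier E\<^sub>1) \<xi> \<eta>) (\<phi>\<^sub>1 a) x"
        using x by (simp add: compose_eq intertwine[OF f] intertwine[OF g])
    qed auto
    then show ?thesis using f g
      by (auto simp: PosCor_simps intro: adjointable_compose star_automorphism_comp)
  qed
  have id: "Id PosCor X \<in> Hom PosCor X X" if "X \<in> Ob PosCor" for X
  proof -
    obtain E \<phi> where [simp]: "X = (E, \<phi>)" by (metis surj_pair)
    have "compose (hcarrier E) (\<phi> a) (restrict id (hcarrier E)) =
        compose (hcarrier E) (restrict id (hcarrier E)) (\<phi> a)" for a
      using closed[OF that[simplified]] by (auto simp: compose_def fun_eq_iff)
    then show ?thesis by (simp add: PosCor_simps adjointable_id star_automorphism_id)
  qed
  have unit: "Comp PosCor X X Y f (Id PosCor X) = f \<and> Comp PosCor X Y Y (Id PosCor Y) f = f"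
      if "f \<in> Hom PosCor X Y" for X Y f
  proof -
    obtain E\<^sub>1 \<phi>\<^sub>1 E\<^sub>2 \<phi>\<^sub>2 \<eta> \<alpha> where [simp]: "X = (E\<^sub>1, \<phi>\<^sub>1)" "Y = (E\<^sub>2, \<phi>\<^sub>2)" "f = (\<eta>, \<alpha>)"
        by (cases X, cases Y, cases f)
    have \<eta>: "\<eta> \<in> adjointable E\<^sub>1 E\<^sub>2" using that by (simp add: PosCor_simps)
    have "compose (hcarrier E\<^sub>1) \<eta> (restrict id (hcarrier E\<^sub>1)) = \<eta>"
      by (rule extensionalityI[of _ "hcarrier E\<^sub>1"]) (auto simp: compose_eq adjointable_extensional[OF
          \<eta>])
    moreover have "compose (hcarrier E\<^sub>1) (restrict id (hcarrier E\<^sub>2)) \<eta> = \<eta>"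
      by (rule extensionalityI[of _ "hcarrier E\<^sub>1"]) (auto simp: compose_eq adjointable_extensional[OF \<eta>]
          adjointable_closed[OF \<eta>])
    ultimately show ?thesis by (simp add: PosCor_simps)
  qed
  have assoc: "Comp PosCor W X Z (Comp PosCor X Y Z h g) f = Comp PosCor W Y Z h (Comp PosCor W X Y g f)"
    if "f \<in> Hom PosCor W X" for W X Y Z f g h
  proof -
    obtain E\<^sub>1 \<phi>\<^sub>1 E\<^sub>2 \<phi>\<^sub>2 E\<^sub>3 \<phi>\<^sub>3 E\<^sub>4 \<phi>\<^sub>4 where [simp]: "W = (E\<^sub>1, \<phi>\<^sub>1)" "X = (E\<^sub>2, \<phi>\<^sub>2)" "Y =
        (E\<^sub>3, \<phi>\<^sub>3)" "Z = (E\<^sub>4, \<phi>\<^sub>4)"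
      by (cases W, cases X, cases Y, cases Z)
    obtain \<eta> \<alpha> \<xi> \<beta> \<zeta> \<gamma> where [simp]: "f = (\<eta>, \<alpha>)" "g = (\<xi>, \<beta>)" "h = (\<zeta>, \<gamma>)"
      by (cases f, cases g, cases h)
    have "\<eta> \<in> adjointable E\<^sub>1 E\<^sub>2" using that by (simp add: PosCor_simps)
    then show ?thesis by (simp add: PosCor_simps comp_assoc) (auto simp: compose_def fun_eq_iff
        adjointable_closed)
  qed
  show ?thesis unfolding is_category_def by (simp add: comp id unit assoc)
qed

theorem theorem3p4:
  fixes F :: "('c::cstar_algebra, 'f) hmod"
    and \<pi> :: "'b::cstar_algebra \<Rightarrow> 'f \<Rightarrow> 'f"
  assumes "(F, \<pi>) \<in> Ob Cor"
  shows "(\<forall>(E\<^sub>1 :: ('b, 'e) hmod) (\<phi>\<^sub>1 :: 'a::cstar_algebra \<Rightarrow> 'e \<Rightarrow> 'e) E\<^sub>2 \<phi>\<^sub>2 \<eta> \<alpha>.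
            (E\<^sub>1, \<phi>\<^sub>1) \<in> Ob PosCor \<longrightarrow> (E\<^sub>2, \<phi>\<^sub>2) \<in> Ob PosCor \<longrightarrow>
            (\<eta>, \<alpha>) \<in> Hom PosCor (E\<^sub>1, \<phi>\<^sub>1) (E\<^sub>2, \<phi>\<^sub>2) \<longrightarrow>
            (\<exists>!\<eta>'. is_tensor_extension E\<^sub>1 E\<^sub>2 F \<pi> \<eta> \<eta>')) \<and>
         is_functor
           (PosCor :: (('a, 'b, 'e) correspondence, ('a, 'e) correspondence_map) category)
           (PosCor :: (('a, 'c, ('e, 'f) interior) correspondence,
                       ('a, ('e, 'f) interior) correspondence_map) category)
           (tensor_obj F \<pi>) (tensor_mor F \<pi>)"
proof -
  interpret star_representation F \<pi>
    using assms by (intro star_representation.intro) (auto simp: Cor_def)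
  have obj: "tensor_obj F \<pi> X \<in> Ob PosCor" if "X \<in> Ob PosCor" for X :: "('a, 'b, 'e) correspondence"
    using that
    by (cases X) (simp add: tensor_obj_def PosCor_simps balanced.hilbert_interior[OF balanced]
      tensor_completely_positive tensor_strict)
  have mor: "tensor_mor F \<pi> X Y f \<in> Hom PosCor (tensor_obj F \<pi> X) (tensor_obj F \<pi> Y)"
    if "X \<in> Ob PosCor" "Y \<in> Ob PosCor" "f \<in> Hom PosCor X Y" for X Y :: "('a, 'b, 'e) correspondence"
        and f
  proof -
    obtain E\<^sub>1 \<phi>\<^sub>1 E\<^sub>2 \<phi>\<^sub>2 \<eta> \<alpha> where [simp]: "X = (E\<^sub>1, \<phi>\<^sub>1)" "Y = (E\<^sub>2, \<phi>\<^sub>2)" "f = (\<eta>, \<alpha>)"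
        by (cases X, cases Y, cases f)
    have E: "hilbert_module E\<^sub>1" "hilbert_module E\<^sub>2" and cp: "completely_positive E\<^sub>1 \<phi>\<^sub>1"
        "completely_positive E\<^sub>2 \<phi>\<^sub>2"
      and \<eta>: "\<eta> \<in> adjointable E\<^sub>1 E\<^sub>2" and \<alpha>: "star_automorphism \<alpha>"
      and eq: "\<And>a. compose (hcarrier E\<^sub>1) (\<phi>\<^sub>2 (\<alpha> a)) \<eta> = compose (hcarrier E\<^sub>1) \<eta> (\<phi>\<^sub>1 a)"
      using that by (auto simp: PosCor_simps)
    note \<phi> = completely_positive_linear(1)[OF cp(1)] completely_positive_linear(1)[OF cp(2)]
    \<comment> \<open>Tensoring the two equal composites in \<open>eq\<close> and splitting each by
      \<open>tensor_op_compose\<close> gives the intertwining relation for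
      \<open>\<eta> \<otimes> I\<close>.\<close>
    show ?thesis
      using tensor_op_adjointable[OF E \<eta>] \<alpha> tensor_op_compose[OF E(1,2,2) \<eta> \<phi>(2)] tensor_op_compose[OF
          E(1,1,2) \<phi>(1) \<eta>] eq
      by (simp add: tensor_mor_def tensor_obj_def PosCor_simps) metis
  qed
  have comp: "tensor_mor F \<pi> X Z (Comp PosCor X Y Z g f)
      = Comp PosCor (tensor_obj F \<pi> X) (tensor_obj F \<pi> Y) (tensor_obj F \<pi> Z) (tensor_mor F \<pi> Y Z g)
          (tensor_mor F \<pi> X Y f)"
    if "X \<in> Ob PosCor" "Y \<in> Ob PosCor" "Z \<in> Ob PosCor" "f \<in> Hom PosCor X Y" "g \<in> Hom PosCor Y Z"
    for X Y Z :: "('a, 'b, 'e) correspondence" and f g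
  proof -
    obtain E\<^sub>1 \<phi>\<^sub>1 E\<^sub>2 \<phi>\<^sub>2 E\<^sub>3 \<phi>\<^sub>3 \<eta> \<alpha> \<xi> \<beta> where [simp]: "X = (E\<^sub>1, \<phi>\<^sub>1)" "Y = (E\<^sub>2, \<phi>\<^sub>2)" "Z =
        (E\<^sub>3, \<phi>\<^sub>3)" "f = (\<eta>, \<alpha>)" "g = (\<xi>, \<beta>)"
      by (cases X, cases Y, cases Z, cases f, cases g)
    show ?thesis using that
      by (simp add: tensor_mor_def tensor_obj_def PosCor_simps tensor_op_compose)
  qed
  have id: "tensor_mor F \<pi> X X (Id PosCor X) = Id PosCor (tensor_obj F \<pi> X)" if "X \<in> Ob PosCor"
    for X :: "('a, 'b, 'e) correspondence"
    using that by (cases X) (simp add: tensor_mor_def tensor_obj_def PosCor_simps tensor_op_id)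
  show ?thesis
  proof (intro conjI allI impI)
    show "\<exists>!\<eta>'. is_tensor_extension E\<^sub>1 E\<^sub>2 F \<pi> \<eta> \<eta>'"
      if "(E\<^sub>1, \<phi>\<^sub>1) \<in> Ob PosCor" "(E\<^sub>2, \<phi>\<^sub>2) \<in> Ob PosCor" "(\<eta>, \<alpha>) \<in> Hom PosCor (E\<^sub>1, \<phi>\<^sub>1) (E\<^sub>2, \<phi>\<^sub>2)"
      for E\<^sub>1 E\<^sub>2 :: "('b, 'e) hmod" and \<phi>\<^sub>1 \<phi>\<^sub>2 :: "'a \<Rightarrow> 'e \<Rightarrow> 'e" and \<eta> \<alpha>
      using that by (intro tensor_extension_ex1) (auto simp: PosCor_simps)
  qed (auto simp: is_functor_def is_category_PosCor obj mor id comp)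
qed

end
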